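(* Let $\widetilde{\mathscr P}$ be a pro-conformal pseudo operad over a field $\mathbb F$ of characteristic $0$. Consider the $\mathbb Z_{\ge-1}$-graded vector superspace $$\widetilde W(\widetilde{\mathscr P})=\bigoplus_{n\ge-1}\widetilde W_n,\qquad \widetilde W_n=\widetilde{\mathscr P}(n+1)^{S_{n+1}}.$$ Then $\widetilde W(\widetilde{\mathscr P})$ has the structure of a pro-Lie conformal superalgebra, with $\lambda$-bracket the restriction to $\widetilde W(\widetilde{\mathscr P})$ of $$[f_\lambda g]=f\Box_\lambda g-(-1)^{p(f)p(g)}g\Box_{-\lambda-\partial}f,\qquad f\in\widetilde{\mathscr P}(n+1),\ g\in\widetilde{\mathscr P}(m+1),$$ where $f\Box_\lambda g=\sum_{\sigma\in S_{m+1,n}}(f\circ^1_{-\lambda-\partial}g)^{\sigma^{-1}}$.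
   Context: Superspaces are over $\mathbb F$; $p$ is parity; $S_0$ is trivial. Permutations: $\sigma\circ_i\tau\in S_{n+m-1}$ ($\sigma\in S_n,\tau\in S_m$) is the permutation which acts on $v_1\otimes\cdots\otimes v_{n+m-1}$ by first applying $\tau$ to $v_i\otimes\cdots\otimes v_{i+m-1}$ and then $\sigma$ to the result viewed as a tensor product of $n$ factors, where $\sigma\in S_n$ acts on tensors by $\sigma(v_1\otimes\cdots\otimes v_n)=\pm v_{\sigma^{-1}(1)}\otimes\cdots\otimes v_{\sigma^{-1}(n)}$ (Koszul sign). $S_{m,n}\subset S_{m+n}$ is the set of $(m,n)$-shuffles ($\sigma(1)<\dots<\sigma(m)$, $\sigma(m+1)<\dots<\sigma(m+n)$), $S_{n,0}=S_{0,n}=\{1\}$, and $S_{m,n}=\emptyset$ if $m<0$ or $n<0$. $\mathbb F[\partial]$-mod is the category of superspaces with an even endomorphism $\partial$, with morphisms the parity preserving linear maps commuting with $\partial$. $\mathbb F[\partial]$-mod-$S_n$ is the category of superspaces with commuting parity preserving left action of $\mathbb F[\partial]$ and right action of $S_n$, with morphisms the parity preserving linear maps commuting with both. A projective system is a sequence $(V_q)_{q\ge0}$ with morphisms $\pi_{q+1,q}:V_{q+1}\to V_q$; its projective limit $V=\varprojlim V_q$ comes with morphisms $\pi_q:V\to V_q$. Maps $\pi_q$ are extended coefficientwise to power series. One has $\varprojlim(P_q[\lambda])=\{a(\lambda)\in P[[\lambda]]:\pi_q(a(\lambda))\in P_q[\lambda]\ \forall q\}$, $P=\varprojlim P_q$.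 A pro-conformal pseudo operad is a collection of superspaces $\widetilde{\mathscr P}(n)$, $n\ge0$, with an even endomorphism $\partial$, a parity preserving right action $f\mapsto f^\sigma$ of $S_n$ commuting with $\partial$, and parity preserving bilinear products $\circ^i_\lambda:\widetilde{\mathscr P}(n)\otimes\widetilde{\mathscr P}(m)\to\widetilde{\mathscr P}(m+n-1)[[\lambda]]$, $1\le i\le n$, satisfying ($f\in\widetilde{\mathscr P}(n)$, $g\in\widetilde{\mathscr P}(m)$, $h\in\widetilde{\mathscr P}(\ell)$), as identities of formal power series: $(\partial f)\circ^i_\lambda g=(\lambda+\partial)(f\circ^i_\lambda g)$; $f\circ^i_\lambda(\partial g)=-\lambda f\circ^i_\lambda g$; $(f\circ^i_\lambda g)\circ^j_\mu h=(-1)^{p(g)p(h)}(f\circ^j_\mu h)\circ^{\ell+i-1}_\lambda g$ for $1\le j<i$; $(f\circ^i_\lambda g)\circ^j_\mu h=f\circ^i_{\lambda+\mu}(g\circ^{j-i+1}_\mu h)$ for $i\le j<i+m$; $f^\sigma\circ^i_\lambda g^\tau=(f\circ^{\sigma(i)}_\lambda g)^{\sigma\circ_i\tau}$. Moreover each $\widetilde{\mathscr P}(n)=\varprojlim\widetilde{\mathscr P}_q(n)$ is the projective limit of a projective system in $\mathbb F[\partial]$-mod-$S_n$, and $\pi_q(f\circ^i_\lambda g)\in\widetilde{\mathscr P}_q(m+n-1)[\lambda]$ for all $q,f,g,i$. Substitutions such as $\lambda\mapsto-\lambda-\partial$ are performed, for each $q$, in the polynomial $\pi_q(\cdot)$ (with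 $\partial$ moved to the left and acting on the coefficients); the resulting compatible family defines, by the universal property of the projective limit, an element of $\varprojlim(\widetilde{\mathscr P}_q(\cdot)[\lambda])\subset\widetilde{\mathscr P}(\cdot)[[\lambda]]$. This gives meaning to $\circ^1_{-\lambda-\partial}$, $\Box_\lambda$ and $\Box_{-\lambda-\partial}$. A pro-Lie conformal superalgebra $R$ is a superspace with an even endomorphism $\partial$ and a parity preserving bilinear $\lambda$-bracket $R\otimes R\to R[[\lambda]]$, $a\otimes b\mapsto[a_\lambda b]$, such that $[\partial a_\lambda b]=-\lambda[a_\lambda b]$, $[a_\lambda\partial b]=(\lambda+\partial)[a_\lambda b]$ in $R[[\lambda]]$; $[a_\lambda[b_\mu c]]-(-1)^{p(a)p(b)}[b_\mu[a_\lambda c]]=[[a_\lambda b]_{\lambda+\mu}c]$ in $R[[\lambda,\mu]]$; $R=\varprojlim R_q$ is the projective limit of a projective system in $\mathbb F[\partial]$-mod with $\pi_q([a_\lambda b])\in R_q[\lambda]$ for all $q$; and $\pi_q([a_\lambda b])=-(-1)^{p(a)p(b)}\pi_q([b_{-\lambda-\partial}a])$ in $R_q[\lambda]$ for all $q$. Here the projective system for $\widetilde W_n$ is $(\widetilde{\mathscr P}_q(n+1)^{S_{n+1}})_{q\ge0}$.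
   Formalization: The projective limit condition is taken degree by degree (each W_n is the limit of the invariants of P_q(n+1)), since the infinite direct sum of the W_n is in general not the projective limit of the direct sums; all other axioms hold on the whole direct sum. *)

theory Defs
  imports Complex_Main "HOL-Library.Z2" "HOL-Library.Poly_Mapping" "HOL-Combinatorics.Permutations"
begin

section \<open>Superspaces\<close>

text \<open>
  A superspace is a pair of independent subspaces (the even part at \<open>0\<close>, the odd part at \<open>1\<close>)
  of an ambient vector space; parities live in the field type \<open>bit\<close> with two elements.
  A formal power series (in one or two variables) with coefficients in a vector space
  is the function giving its coefficients.
\<close>

definition total :: "(bit \<Rightarrow> 'v::plus set) \<Rightarrow> 'v set" where
  "total V = {x + y |x y. x \<in> V 0 \<and> y \<in> V 1}"

locale superspace = vector_space scale
  for scale :: "'k::field \<Rightarrow> 'v::ab_group_add \<Rightarrow> 'v" +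
  fixes V :: "bit \<Rightarrow> 'v set"
  assumes subspace_component: "subspace (V p)"
    and independent_components: "V 0 \<inter> V 1 = {0}"

definition koszul_sign :: "bit \<Rightarrow> bit \<Rightarrow> 'k::field" where
  "koszul_sign p q = (if p = 1 \<and> q = 1 then - 1 else 1)"

definition even_linear ::
  "('k \<Rightarrow> 'v::ab_group_add \<Rightarrow> 'v) \<Rightarrow> (bit \<Rightarrow> 'v set) \<Rightarrow>
   ('k \<Rightarrow> 'w::ab_group_add \<Rightarrow> 'w) \<Rightarrow> (bit \<Rightarrow> 'w set) \<Rightarrow> ('v \<Rightarrow> 'w) \<Rightarrow> bool" where
  "even_linear scale V scale' W \<phi> \<longleftrightarrow>
     (\<forall>p. \<forall>x\<in>V p. \<phi> x \<in> W p) \<and>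
     (\<forall>x\<in>total V. \<forall>y\<in>total V. \<phi> (x + y) = \<phi> x + \<phi> y) \<and>
     (\<forall>c. \<forall>x\<in>total V. \<phi> (scale c x) = scale' c (\<phi> x))"

definition even_bilinear_series ::
  "('k \<Rightarrow> 'u::ab_group_add \<Rightarrow> 'u) \<Rightarrow> (bit \<Rightarrow> 'u set) \<Rightarrow> (bit \<Rightarrow> 'u set) \<Rightarrow> (bit \<Rightarrow> 'u set) \<Rightarrow>
   ('u \<Rightarrow> 'u \<Rightarrow> nat \<Rightarrow> 'u) \<Rightarrow> bool" where
  "even_bilinear_series scale U V W \<beta> \<longleftrightarrow>
     (\<forall>p q. \<forall>x\<in>U p. \<forall>y\<in>V q. \<forall>k. \<beta> x y k \<in> W (p + q)) \<and>
     (\<forall>x\<in>total U. \<forall>x'\<in>total U. \<forall>y\<in>total V. \<forall>k. \<beta> (x + x') y k = \<beta> x y k + \<beta> x' y k) \<and>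
     (\<forall>x\<in>total U. \<forall>y\<in>total V. \<forall>y'\<in>total V. \<forall>k. \<beta> x (y + y') k = \<beta> x y k + \<beta> x y' k) \<and>
     (\<forall>c. \<forall>x\<in>total U. \<forall>y\<in>total V. \<forall>k. \<beta> (scale c x) y k = scale c (\<beta> x y k)) \<and>
     (\<forall>c. \<forall>x\<in>total U. \<forall>y\<in>total V. \<forall>k. \<beta> x (scale c y) k = scale c (\<beta> x y k))"


section \<open>Superspaces with an endomorphism and a symmetric group action\<close>

locale diff_superspace = superspace scale V
  for scale :: "'k::field \<Rightarrow> 'v::ab_group_add \<Rightarrow> 'v" and V +
  fixes D :: "'v \<Rightarrow> 'v"
  assumes even_endomorphism: "even_linear scale V scale V D"

definition diff_hom ::
  "('k \<Rightarrow> 'v::ab_group_add \<Rightarrow> 'v) \<Rightarrow> (bit \<Rightarrow> 'v set) \<Rightarrow> ('v \<Rightarrow> 'v) \<Rightarrow>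
   ('k \<Rightarrow> 'w::ab_group_add \<Rightarrow> 'w) \<Rightarrow> (bit \<Rightarrow> 'w set) \<Rightarrow> ('w \<Rightarrow> 'w) \<Rightarrow> ('v \<Rightarrow> 'w) \<Rightarrow> bool" where
  "diff_hom scale V D scale' V' D' \<phi> \<longleftrightarrow>
     even_linear scale V scale' V' \<phi> \<and> (\<forall>x\<in>total V. \<phi> (D x) = D' (\<phi> x))"

text \<open>Permutations of \<open>{1..n}\<close> compose as functions, and \<open>act \<sigma> x\<close> is \<open>x\<^sup>\<sigma>\<close>, a right action.\<close>

locale sym_diff_superspace = diff_superspace scale V D
  for scale :: "'k::field \<Rightarrow> 'v::ab_group_add \<Rightarrow> 'v" and V D +
  fixes n :: nat and act :: "(nat \<Rightarrow> nat) \<Rightarrow> 'v \<Rightarrow> 'v"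
  assumes act_even_linear: "\<sigma> permutes {1..n} \<Longrightarrow> even_linear scale V scale V (act \<sigma>)"
    and act_id: "x \<in> total V \<Longrightarrow> act id x = x"
    and act_comp: "\<sigma> permutes {1..n} \<Longrightarrow> \<tau> permutes {1..n} \<Longrightarrow> x \<in> total V \<Longrightarrow>
      act (\<sigma> \<circ> \<tau>) x = act \<tau> (act \<sigma> x)"
    and act_D: "\<sigma> permutes {1..n} \<Longrightarrow> x \<in> total V \<Longrightarrow> act \<sigma> (D x) = D (act \<sigma> x)"

definition sym_diff_hom ::
  "nat \<Rightarrow> ('k \<Rightarrow> 'v::ab_group_add \<Rightarrow> 'v) \<Rightarrow> (bit \<Rightarrow> 'v set) \<Rightarrow> ('v \<Rightarrow> 'v) \<Rightarrow> ((nat \<Rightarrow> nat) \<Rightarrow> 'v \<Rightarrow> 'v) \<Rightarrow>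
   ('k \<Rightarrow> 'w::ab_group_add \<Rightarrow> 'w) \<Rightarrow> (bit \<Rightarrow> 'w set) \<Rightarrow> ('w \<Rightarrow> 'w) \<Rightarrow> ((nat \<Rightarrow> nat) \<Rightarrow> 'w \<Rightarrow> 'w) \<Rightarrow>
   ('v \<Rightarrow> 'w) \<Rightarrow> bool" where
  "sym_diff_hom n scale V D act scale' V' D' act' \<phi> \<longleftrightarrow>
     diff_hom scale V D scale' V' D' \<phi> \<and>
     (\<forall>\<sigma>. \<sigma> permutes {1..n} \<longrightarrow> (\<forall>x\<in>total V. \<phi> (act \<sigma> x) = act' \<sigma> (\<phi> x)))"

text \<open>
  The maps \<open>pr q\<close> identify \<open>V\<close> with the compatible sequences of the projective system
  \<open>Vq 0 \<leftarrow> Vq 1 \<leftarrow> \<dots>\<close> with transition maps \<open>tr q\<close> from \<open>Vq (q + 1)\<close> to \<open>Vq q\<close>. That all these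
  maps are morphisms of the category at hand is always required separately.
\<close>

definition is_projective_limit ::
  "'v set \<Rightarrow> (nat \<Rightarrow> 'w set) \<Rightarrow> (nat \<Rightarrow> 'w \<Rightarrow> 'w) \<Rightarrow> (nat \<Rightarrow> 'v \<Rightarrow> 'w) \<Rightarrow> bool" where
  "is_projective_limit V Vq tr pr \<longleftrightarrow>
     (\<forall>x\<in>V. \<forall>q. tr q (pr (Suc q) x) = pr q x) \<and>
     (\<forall>y. (\<forall>q. y q \<in> Vq q \<and> tr q (y (Suc q)) = y q) \<longrightarrow> (\<exists>!x. x \<in> V \<and> (\<forall>q. pr q x = y q)))"


section \<open>Operations on power series\<close>

definition times_var :: "(nat \<Rightarrow> 'v::zero) \<Rightarrow> nat \<Rightarrow> 'v" where
  "times_var a k = (case k of 0 \<Rightarrow> 0 | Suc j \<Rightarrow> a j)"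

text \<open>The coefficient of \<open>x\<^sup>i y\<^sup>j\<close> in the series \<open>\<Sum>k l. c k l x\<^sup>k (x + y)\<^sup>l\<close>.\<close>

definition expand_sum :: "('k::field \<Rightarrow> 'v::ab_group_add \<Rightarrow> 'v) \<Rightarrow> (nat \<Rightarrow> nat \<Rightarrow> 'v) \<Rightarrow> nat \<Rightarrow> nat \<Rightarrow> 'v" where
  "expand_sum scale c i j = (\<Sum>k\<le>i. scale (of_nat ((i + j - k) choose j)) (c k (i + j - k)))"

text \<open>
  The coefficient of \<open>\<lambda>\<^sup>j\<close> in \<open>\<Sum>k. (- \<lambda> - \<partial>)\<^sup>k a\<^sub>k\<close>, for a polynomial \<open>a = \<Sum>k. a\<^sub>k \<lambda>\<^sup>k\<close>.
\<close>

definition subst_poly :: "('k::field \<Rightarrow> 'v::ab_group_add \<Rightarrow> 'v) \<Rightarrow> ('v \<Rightarrow> 'v) \<Rightarrow> (nat \<Rightarrow> 'v) \<Rightarrow> nat \<Rightarrow> 'v" where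
  "subst_poly scale D a j =
     (\<Sum>k\<in>{k. j \<le> k \<and> a k \<noteq> 0}. scale ((- 1) ^ k * of_nat (k choose j)) ((D ^^ (k - j)) (a k)))"

text \<open>
  The substitution \<open>\<lambda> \<mapsto> - \<lambda> - \<partial>\<close> in a power series over a projective limit \<open>V\<close>, all of whose
  projections are polynomials.
\<close>

definition subst_series ::
  "'v set \<Rightarrow> ('k::field \<Rightarrow> 'w::ab_group_add \<Rightarrow> 'w) \<Rightarrow> (nat \<Rightarrow> 'w \<Rightarrow> 'w) \<Rightarrow> (nat \<Rightarrow> 'v \<Rightarrow> 'w) \<Rightarrow>
   (nat \<Rightarrow> 'v) \<Rightarrow> nat \<Rightarrow> 'v" where
  "subst_series V scaleq Dq pr a j =
     (THE x. x \<in> V \<and> (\<forall>q. pr q x = subst_poly scaleq (Dq q) (\<lambda>k. pr q (a k)) j))"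


section \<open>Permutations\<close>

text \<open>
  \<open>perm_circ m i \<sigma> \<tau>\<close> is \<open>\<sigma> \<circ>\<^sub>i \<tau>\<close> for \<open>\<tau> \<in> S\<^sub>m\<close>. A permutation moves the factor in place \<open>a\<close>
  to place \<open>\<sigma> a\<close>. The \<open>m\<close> factors in places \<open>i, \<dots>, i + m - 1\<close> are rearranged by \<open>\<tau>\<close>
  and form block number \<open>i\<close>; any other factor is a block by itself, with number \<open>c\<close>.
  The block moved to position \<open>s\<close> begins in place \<open>s\<close>, or in place \<open>s + m - 1\<close> if it comes
  after the long block.
\<close>

definition perm_circ :: "nat \<Rightarrow> nat \<Rightarrow> (nat \<Rightarrow> nat) \<Rightarrow> (nat \<Rightarrow> nat) \<Rightarrow> nat \<Rightarrow> nat" where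
  "perm_circ m i \<sigma> \<tau> a =
     (if i \<le> a \<and> a < i + m then \<sigma> i - 1 + \<tau> (a - i + 1)
      else let c = (if a < i then a else a + 1 - m)
           in if \<sigma> c < \<sigma> i then \<sigma> c else \<sigma> c + m - 1)"

definition shuffles :: "int \<Rightarrow> int \<Rightarrow> (nat \<Rightarrow> nat) set" where
  "shuffles m n =
     (if m < 0 \<or> n < 0 then {}
      else {\<sigma>. \<sigma> permutes {1..nat (m + n)} \<and>
               strict_mono_on {1..nat m} \<sigma> \<and> strict_mono_on {nat m + 1..nat (m + n)} \<sigma>})"


section \<open>Pro-conformal pseudo operads\<close>

text \<open>
  \<open>circ n m i f g k\<close> is the coefficient of \<open>\<lambda>\<^sup>k\<close> in the \<open>i\<close>-th product of \<open>f\<close> of arity \<open>n\<close> and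
  \<open>g\<close> of arity \<open>m\<close>. Identities in two variables are compared at \<open>\<lambda>\<^sup>a \<mu>\<^sup>b\<close>.
\<close>

locale pro_conformal_pseudo_operad =
  fixes scale :: "'k::field \<Rightarrow> 'a::ab_group_add \<Rightarrow> 'a"
    and P :: "nat \<Rightarrow> bit \<Rightarrow> 'a set"
    and D :: "nat \<Rightarrow> 'a \<Rightarrow> 'a"
    and act :: "nat \<Rightarrow> (nat \<Rightarrow> nat) \<Rightarrow> 'a \<Rightarrow> 'a"
    and circ :: "nat \<Rightarrow> nat \<Rightarrow> nat \<Rightarrow> 'a \<Rightarrow> 'a \<Rightarrow> nat \<Rightarrow> 'a"
    and scaleq :: "'k \<Rightarrow> 'b::ab_group_add \<Rightarrow> 'b"
    and Pq :: "nat \<Rightarrow> nat \<Rightarrow> bit \<Rightarrow> 'b set"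
    and Dq :: "nat \<Rightarrow> nat \<Rightarrow> 'b \<Rightarrow> 'b"
    and actq :: "nat \<Rightarrow> nat \<Rightarrow> (nat \<Rightarrow> nat) \<Rightarrow> 'b \<Rightarrow> 'b"
    and tr :: "nat \<Rightarrow> nat \<Rightarrow> 'b \<Rightarrow> 'b"
    and pr :: "nat \<Rightarrow> nat \<Rightarrow> 'a \<Rightarrow> 'b"
  assumes space: "sym_diff_superspace scale (P n) (D n) n (act n)"
    and circ_bilinear: "i \<in> {1..n} \<Longrightarrow> even_bilinear_series scale (P n) (P m) (P (m + n - 1)) (circ n m i)"
    and circ_D_left: "i \<in> {1..n} \<Longrightarrow> f \<in> total (P n) \<Longrightarrow> g \<in> total (P m) \<Longrightarrow>
      circ n m i (D n f) g k = times_var (circ n m i f g) k + D (m + n - 1) (circ n m i f g k)"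
    and circ_D_right: "i \<in> {1..n} \<Longrightarrow> f \<in> total (P n) \<Longrightarrow> g \<in> total (P m) \<Longrightarrow>
      circ n m i f (D m g) k = - times_var (circ n m i f g) k"
    and circ_commute: "1 \<le> j \<Longrightarrow> j < i \<Longrightarrow> i \<le> n \<Longrightarrow>
      f \<in> total (P n) \<Longrightarrow> g \<in> P m r \<Longrightarrow> h \<in> P l s \<Longrightarrow>
      circ (m + n - 1) l j (circ n m i f g a) h b =
        scale (koszul_sign r s) (circ (l + n - 1) m (l + i - 1) (circ n l j f h b) g a)"
    and circ_assoc: "1 \<le> i \<Longrightarrow> i \<le> n \<Longrightarrow> i \<le> j \<Longrightarrow> j < i + m \<Longrightarrow>
      f \<in> total (P n) \<Longrightarrow> g \<in> total (P m) \<Longrightarrow> h \<in> total (P l) \<Longrightarrow>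
      circ (m + n - 1) l j (circ n m i f g a) h b =
        expand_sum scale (\<lambda>k. circ n (l + m - 1) i f (circ m l (j - i + 1) g h k)) b a"
    and circ_equivariant: "i \<in> {1..n} \<Longrightarrow> \<sigma> permutes {1..n} \<Longrightarrow> \<tau> permutes {1..m} \<Longrightarrow>
      f \<in> total (P n) \<Longrightarrow> g \<in> total (P m) \<Longrightarrow>
      circ n m i (act n \<sigma> f) (act m \<tau> g) k =
        act (m + n - 1) (perm_circ m i \<sigma> \<tau>) (circ n m (\<sigma> i) f g k)"
    and spaceq: "sym_diff_superspace scaleq (Pq q n) (Dq q n) n (actq q n)"
    and tr_hom: "sym_diff_hom n scaleq (Pq (Suc q) n) (Dq (Suc q) n) (actq (Suc q) n)
      scaleq (Pq q n) (Dq q n) (actq q n) (tr q n)"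
    and pr_hom: "sym_diff_hom n scale (P n) (D n) (act n) scaleq (Pq q n) (Dq q n) (actq q n) (pr q n)"
    and limit: "is_projective_limit (total (P n)) (\<lambda>q. total (Pq q n)) (\<lambda>q. tr q n) (\<lambda>q. pr q n)"
    and circ_polynomial: "i \<in> {1..n} \<Longrightarrow> f \<in> total (P n) \<Longrightarrow> g \<in> total (P m) \<Longrightarrow>
      finite {k. pr q (m + n - 1) (circ n m i f g k) \<noteq> 0}"


section \<open>Graded pro-Lie conformal superalgebras\<close>

text \<open>
  All axioms of a pro-Lie conformal superalgebra except that \<open>R\<close> is the projective limit of
  the system \<open>Rq\<close>. The coefficient of \<open>\<lambda>\<^sup>k\<close> in \<open>[a\<^sub>\<lambda> b]\<close> is \<open>br a b k\<close>, and the Jacobi identity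
  is compared at \<open>\<lambda>\<^sup>i \<mu>\<^sup>j\<close>.
\<close>

locale pro_Lie_bracket = diff_superspace scale R D
  for scale :: "'k::field \<Rightarrow> 'r::ab_group_add \<Rightarrow> 'r" and R D +
  fixes br :: "'r \<Rightarrow> 'r \<Rightarrow> nat \<Rightarrow> 'r"
    and scaleq :: "'k \<Rightarrow> 's::ab_group_add \<Rightarrow> 's"
    and Rq :: "nat \<Rightarrow> bit \<Rightarrow> 's set"
    and Dq :: "nat \<Rightarrow> 's \<Rightarrow> 's"
    and tr :: "nat \<Rightarrow> 's \<Rightarrow> 's"
    and pr :: "nat \<Rightarrow> 'r \<Rightarrow> 's"
  assumes br_bilinear: "even_bilinear_series scale R R R br"
    and br_D_left: "a \<in> total R \<Longrightarrow> b \<in> total R \<Longrightarrow> br (D a) b k = - times_var (br a b) k"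
    and br_D_right: "a \<in> total R \<Longrightarrow> b \<in> total R \<Longrightarrow>
      br a (D b) k = times_var (br a b) k + D (br a b k)"
    and jacobi: "a \<in> R p \<Longrightarrow> b \<in> R r \<Longrightarrow> c \<in> total R \<Longrightarrow>
      br a (br b c j) i - scale (koszul_sign p r) (br b (br a c i) j) =
        expand_sum scale (\<lambda>k. br (br a b k) c) i j"
    and spaceq: "diff_superspace scaleq (Rq q) (Dq q)"
    and tr_hom: "diff_hom scaleq (Rq (Suc q)) (Dq (Suc q)) scaleq (Rq q) (Dq q) (tr q)"
    and pr_hom: "diff_hom scale R D scaleq (Rq q) (Dq q) (pr q)"
    and br_polynomial: "a \<in> total R \<Longrightarrow> b \<in> total R \<Longrightarrow> finite {k. pr q (br a b k) \<noteq> 0}"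
    and skew_symmetry: "a \<in> R p \<Longrightarrow> b \<in> R r \<Longrightarrow>
      pr q (br a b k) =
        - scaleq (koszul_sign p r) (subst_poly scaleq (Dq q) (\<lambda>k. pr q (br b a k)) k)"

text \<open>A direct sum consists of the finitely supported families of elements.\<close>

definition direct_sum :: "('i \<Rightarrow> bit \<Rightarrow> 'v::zero set) \<Rightarrow> bit \<Rightarrow> ('i \<Rightarrow>\<^sub>0 'v) set" where
  "direct_sum V p = {x. \<forall>i. Poly_Mapping.lookup x i \<in> V i p}"

text \<open>
  The algebra is the direct sum of the family \<open>R\<close>. The limit is taken in the category of graded
  objects, i.e. degree by degree. All structure maps except the bracket are given by
  their graded components.
\<close>

locale graded_pro_Lie_conformal_superalgebra =
  fixes scale :: "'k::field \<Rightarrow> 'a::ab_group_add \<Rightarrow> 'a"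
    and R :: "int \<Rightarrow> bit \<Rightarrow> 'a set"
    and D :: "int \<Rightarrow> 'a \<Rightarrow> 'a"
    and br :: "(int \<Rightarrow>\<^sub>0 'a) \<Rightarrow> (int \<Rightarrow>\<^sub>0 'a) \<Rightarrow> nat \<Rightarrow> (int \<Rightarrow>\<^sub>0 'a)"
    and scaleq :: "'k \<Rightarrow> 'b::ab_group_add \<Rightarrow> 'b"
    and Rq :: "nat \<Rightarrow> int \<Rightarrow> bit \<Rightarrow> 'b set"
    and Dq :: "nat \<Rightarrow> int \<Rightarrow> 'b \<Rightarrow> 'b"
    and tr :: "nat \<Rightarrow> int \<Rightarrow> 'b \<Rightarrow> 'b"
    and pr :: "nat \<Rightarrow> int \<Rightarrow> 'a \<Rightarrow> 'b"
  assumes algebra: "pro_Lie_bracket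
      (\<lambda>c. Poly_Mapping.mapp (\<lambda>_. scale c)) (direct_sum R) (Poly_Mapping.mapp D) br
      (\<lambda>c. Poly_Mapping.mapp (\<lambda>_. scaleq c)) (\<lambda>q. direct_sum (Rq q)) (\<lambda>q. Poly_Mapping.mapp (Dq q))
      (\<lambda>q. Poly_Mapping.mapp (tr q)) (\<lambda>q. Poly_Mapping.mapp (pr q))"
    and graded: "f \<in> total (R n) \<Longrightarrow> g \<in> total (R m) \<Longrightarrow>
      Poly_Mapping.keys (br (Poly_Mapping.single n f) (Poly_Mapping.single m g) k) \<subseteq> {n + m}"
    and limit: "is_projective_limit (total (R n)) (\<lambda>q. total (Rq q n)) (\<lambda>q. tr q n) (\<lambda>q. pr q n)"


section \<open>The superalgebra of a pseudo operad\<close>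

definition arity :: "int \<Rightarrow> nat" where
  "arity n = nat (n + 1)"

text \<open>The component in degree \<open>n\<close>, which is zero for \<open>n < - 1\<close>.\<close>

definition W_space ::
  "(nat \<Rightarrow> bit \<Rightarrow> 'v::zero set) \<Rightarrow> (nat \<Rightarrow> (nat \<Rightarrow> nat) \<Rightarrow> 'v \<Rightarrow> 'v) \<Rightarrow> int \<Rightarrow> bit \<Rightarrow> 'v set" where
  "W_space P act n p =
     (if n < - 1 then {0}
      else {f \<in> P (arity n) p. \<forall>\<sigma>. \<sigma> permutes {1..arity n} \<longrightarrow> act (arity n) \<sigma> f = f})"

text \<open>
  For \<open>f\<close> of arity \<open>n + 1\<close> and \<open>g\<close> of arity \<open>m + 1\<close>, \<open>box \<dots> n m f g\<close> is the series \<open>f \<box>\<^sub>\<lambda> g\<close> and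
  \<open>box_subst \<dots> n m f g\<close> is \<open>f \<box> g\<close> at \<open>- \<lambda> - \<partial>\<close>, both with coefficients of arity \<open>n + m + 1\<close>.
\<close>

definition box ::
  "(nat \<Rightarrow> bit \<Rightarrow> 'a::ab_group_add set) \<Rightarrow> (nat \<Rightarrow> (nat \<Rightarrow> nat) \<Rightarrow> 'a \<Rightarrow> 'a) \<Rightarrow>
   (nat \<Rightarrow> nat \<Rightarrow> nat \<Rightarrow> 'a \<Rightarrow> 'a \<Rightarrow> nat \<Rightarrow> 'a) \<Rightarrow>
   ('k::field \<Rightarrow> 'b::ab_group_add \<Rightarrow> 'b) \<Rightarrow> (nat \<Rightarrow> nat \<Rightarrow> 'b \<Rightarrow> 'b) \<Rightarrow> (nat \<Rightarrow> nat \<Rightarrow> 'a \<Rightarrow> 'b) \<Rightarrow>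
   int \<Rightarrow> int \<Rightarrow> 'a \<Rightarrow> 'a \<Rightarrow> nat \<Rightarrow> 'a" where
  "box P act circ scaleq Dq pr n m f g k =
     (let N = arity (n + m)
      in \<Sum>\<sigma>\<in>shuffles (m + 1) n.
           act N (inv \<sigma>)
             (subst_series (total (P N)) scaleq (\<lambda>q. Dq q N) (\<lambda>q. pr q N)
               (circ (arity n) (arity m) 1 f g) k))"

definition box_subst ::
  "(nat \<Rightarrow> bit \<Rightarrow> 'a::ab_group_add set) \<Rightarrow> (nat \<Rightarrow> (nat \<Rightarrow> nat) \<Rightarrow> 'a \<Rightarrow> 'a) \<Rightarrow>
   (nat \<Rightarrow> nat \<Rightarrow> nat \<Rightarrow> 'a \<Rightarrow> 'a \<Rightarrow> nat \<Rightarrow> 'a) \<Rightarrow>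
   ('k::field \<Rightarrow> 'b::ab_group_add \<Rightarrow> 'b) \<Rightarrow> (nat \<Rightarrow> nat \<Rightarrow> 'b \<Rightarrow> 'b) \<Rightarrow> (nat \<Rightarrow> nat \<Rightarrow> 'a \<Rightarrow> 'b) \<Rightarrow>
   int \<Rightarrow> int \<Rightarrow> 'a \<Rightarrow> 'a \<Rightarrow> nat \<Rightarrow> 'a" where
  "box_subst P act circ scaleq Dq pr n m f g =
     (let N = arity (n + m)
      in subst_series (total (P N)) scaleq (\<lambda>q. Dq q N) (\<lambda>q. pr q N)
           (box P act circ scaleq Dq pr n m f g))"

end

theory Submission
  imports Defs "HOL-Computational_Algebra.Polynomial"
begin

text \<open>
  Write \<open>f *\<^sub>\<lambda> g\<close> for the sum over shuffles of \<open>f \<circ>\<^sup>1\<^sub>\<lambda> g\<close>, so that the bracket of two symmetric operations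
  is \<open>[f\<^sub>\<lambda> g] = f *\<^sub>-\<^sub>\<lambda>\<^sub>-\<^sub>\<partial> g \<minusplus> g *\<^sub>\<lambda> f\<close>. The theorem has an algebraic and an analytic side.

  The algebraic side is the right-symmetric identity: the associator
  \<open>(f *\<^sub>\<lambda> g) *\<^sub>\<mu> h - f *\<^sub>\<lambda>\<^sub>+\<^sub>\<mu> (g *\<^sub>\<mu> h)\<close> is unchanged, up to the Koszul sign, when \<open>(g, \<lambda>)\<close> and \<open>(h, \<mu>)\<close> are
  exchanged. Indeed the iterated product on the left inserts \<open>h\<close> into every input of the composite of
  \<open>f\<close> and \<open>g\<close>. Insertions into an input of \<open>g\<close> are cancelled by the second term, by associativity; in the
  others \<open>g\<close> and \<open>h\<close> occupy two different inputs of \<open>f\<close>, and there commutativity of the products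
  applies. As the field has characteristic 0, a sum over shuffles is a normalised sum over all
  permutations (\<open>star_eq_sum_shuffles\<close>). After this symmetrisation equivariance only has to say which
  input is used, and no shuffles need to be composed (\<open>right_symmetric_star\<close>). The Jacobi identity for
  the bracket is the combination of three instances of the identity, one for each of the three elements
  in the role of \<open>f\<close>, and skew-symmetry is built into the bracket (\<open>jacobi\<close>, \<open>bracket_skew\<close>).

  The analytic side is the meaning of \<open>f *\<^sub>-\<^sub>\<lambda>\<^sub>-\<^sub>\<partial> g\<close> inside a further product. Its coefficients are sums
  \<open>\<Sum>k. c\<^sub>k \<partial>\<^sup>e\<^sup>k a\<^sub>k\<close> that converge in the projective limit, and the products of a pseudo operad are
  not assumed to be continuous. Continuity is automatic. The maps \<open>x \<mapsto> f *\<^sub>\<lambda> x\<close> and \<open>x \<mapsto> x *\<^sub>-\<^sub>\<lambda>\<^sub>-\<^sub>\<partial> h\<close> turn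
  \<open>\<partial>\<close> into multiplication by \<open>- \<lambda>\<close>, and at each level \<open>q\<close> they take polynomial values. If such a map were
  nonzero on infinitely many \<open>a\<^sub>k\<close>, then for sufficiently sparse exponents its value on the convergent sum
  \<open>\<Sum>k. \<partial>\<^sup>e\<^sup>k a\<^sub>k\<close> would have infinitely many nonzero coefficients. This is Specker's argument that a
  polynomial ring is slender (\<open>functional_star_eventually_0\<close>). Hence at each level all triple products are
  polynomials in both variables, and the substitutions may be carried out term by term
  (\<open>functional_dstar\<close>).

  The computations with \<open>\<partial>\<close> are organised by evaluation: the coefficients form a module over the
  commutative ring \<open>F[\<partial>]\<close>, a polynomial in \<open>\<lambda>\<close> is evaluated at elements of this ring, and substituting
  \<open>- \<lambda> - \<partial>\<close> for \<open>\<lambda>\<close> means evaluating at \<open>- X - \<partial>\<close> instead of \<open>X\<close>. Over an infinite field the values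
  at constants determine a polynomial (\<open>polynomial_eqI\<close>).
\<close>


section \<open>Superspaces\<close>

lemma bit_cases: "p = (0::bit) \<or> p = 1"
  by (cases p) auto

lemma koszul_sign_commute: "koszul_sign p q = koszul_sign q p"
  by (auto simp: koszul_sign_def)

lemma koszul_sign_square: "koszul_sign p q * koszul_sign p q = (1::'k::field)"
  by (auto simp: koszul_sign_def)

lemma koszul_sign_add_left: "koszul_sign (p + q) r = (koszul_sign p r * koszul_sign q r :: 'k::field)"
  using bit_cases[of p] bit_cases[of q] by (auto simp: koszul_sign_def)

lemma koszul_sign_add_right: "koszul_sign r (p + q) = (koszul_sign r p * koszul_sign r q :: 'k::field)"
  using bit_cases[of p] bit_cases[of q] by (auto simp: koszul_sign_def)

lemma times_var_0: "times_var a 0 = 0"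
  and times_var_Suc: "times_var a (Suc k) = a k"
  by (simp_all add: times_var_def)

definition even_part :: "(bit \<Rightarrow> 'v::plus set) \<Rightarrow> 'v \<Rightarrow> 'v" where
  "even_part V x = (THE y. y \<in> V 0 \<and> (\<exists>z\<in>V 1. x = y + z))"

definition odd_part :: "(bit \<Rightarrow> 'v::plus set) \<Rightarrow> 'v \<Rightarrow> 'v" where
  "odd_part V x = (THE z. z \<in> V 1 \<and> (\<exists>y\<in>V 0. x = y + z))"

context superspace
begin

lemma total_subspace: "subspace (total V)"
proof -
  have "total V = {x + y |x y. x \<in> V 0 \<and> y \<in> V 1}" by (simp add: total_def)
  then show ?thesis
    using subspace_sums[OF subspace_component[of 0] subspace_component[of 1]] by simp
qed

lemma in_total: "x \<in> V p \<Longrightarrow> x \<in> total V"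
proof -
  assume x: "x \<in> V p"
  have z: "0 \<in> V q" for q using subspace_component subspace_0 by blast
  show ?thesis
  proof (cases "p = 0")
    case True
    then have "x = x + 0 \<and> x \<in> V 0 \<and> 0 \<in> V 1" using x z by auto
    then show ?thesis unfolding total_def by blast
  next
    case False
    then have "x = 0 + x \<and> 0 \<in> V 0 \<and> x \<in> V 1" using x z bit_cases[of p] by auto
    then show ?thesis unfolding total_def by blast
  qed
qed

lemma total_0: "0 \<in> total V"
  and total_add: "x \<in> total V \<Longrightarrow> y \<in> total V \<Longrightarrow> x + y \<in> total V"
  and total_scale: "x \<in> total V \<Longrightarrow> scale c x \<in> total V"
  and total_uminus: "x \<in> total V \<Longrightarrow> - x \<in> total V"
  and total_diff: "x \<in> total V \<Longrightarrow> y \<in> total V \<Longrightarrow> x - y \<in> total V"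
  and total_sum: "(\<And>i. i \<in> I \<Longrightarrow> h i \<in> total V) \<Longrightarrow> sum h I \<in> total V"
  using total_subspace
  by (auto intro: subspace_0 subspace_add subspace_scale subspace_neg subspace_diff subspace_sum)

lemma component_0: "0 \<in> V p"
  and component_add: "x \<in> V p \<Longrightarrow> y \<in> V p \<Longrightarrow> x + y \<in> V p"
  and component_scale: "x \<in> V p \<Longrightarrow> scale c x \<in> V p"
  and component_diff: "x \<in> V p \<Longrightarrow> y \<in> V p \<Longrightarrow> x - y \<in> V p"
  and component_sum: "(\<And>i. i \<in> I \<Longrightarrow> h i \<in> V p) \<Longrightarrow> sum h I \<in> V p"
  using subspace_component[of p]
  by (auto intro: subspace_0 subspace_add subspace_scale subspace_neg subspace_diff subspace_sum)

lemma decompose_unique: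
  assumes "x \<in> V 0" "y \<in> V 1" "x' \<in> V 0" "y' \<in> V 1" "x + y = x' + y'"
  shows "x = x' \<and> y = y'"
proof -
  have e: "x - x' = y' - y" using assms(5) by (simp add: algebra_simps)
  have "x - x' \<in> V 0" "y' - y \<in> V 1" using assms component_diff by auto
  then have "x - x' \<in> V 0 \<inter> V 1" using e by simp
  then have "x - x' = 0" using independent_components by blast
  then show ?thesis using e by simp
qed

lemma parts:
  assumes "x \<in> total V"
  shows "even_part V x \<in> V 0" "odd_part V x \<in> V 1" "x = even_part V x + odd_part V x"
proof -
  obtain y z where yz: "y \<in> V 0" "z \<in> V 1" "x = y + z"
    using assms unfolding total_def by blast
  have "even_part V x = y" unfolding even_part_def
    by (rule the_equality) (use yz decompose_unique in blast)+
  moreover have "odd_part V x = z" unfolding odd_part_def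
    by (rule the_equality) (use yz decompose_unique in blast)+
  ultimately show "even_part V x \<in> V 0" "odd_part V x \<in> V 1" "x = even_part V x + odd_part V x"
    using yz by auto
qed

lemma odd_part_sum:
  assumes "y \<in> V 0" "z \<in> V 1"
  shows "odd_part V (y + z) = z"
proof -
  have "y + z \<in> total V" using assms unfolding total_def by blast
  from parts[OF this] show ?thesis using decompose_unique assms by metis
qed

lemma odd_part_component:
  assumes "x \<in> V p"
  shows "odd_part V x = (if p = 1 then x else 0)"
  using odd_part_sum[of x 0] odd_part_sum[of 0 x] assms component_0 bit_cases[of p] by auto

lemma odd_part_add:
  assumes "x \<in> total V" "y \<in> total V"
  shows "odd_part V (x + y) = odd_part V x + odd_part V y"
proof -
  have "x + y = (even_part V x + even_part V y) + (odd_part V x + odd_part V y)"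
    using parts(3)[OF assms(1)] parts(3)[OF assms(2)] by (metis add.assoc add.left_commute)
  then show ?thesis
    using odd_part_sum[of "even_part V x + even_part V y" "odd_part V x + odd_part V y"]
      parts[OF assms(1)] parts[OF assms(2)] component_add by metis
qed

lemma odd_part_scale:
  assumes "x \<in> total V"
  shows "odd_part V (scale c x) = scale c (odd_part V x)"
proof -
  have "scale c x = scale c (even_part V x) + scale c (odd_part V x)"
    using parts(3)[OF assms] by (metis scale_right_distrib)
  then show ?thesis
    using odd_part_sum[of "scale c (even_part V x)" "scale c (odd_part V x)"]
      parts[OF assms] component_scale by metis
qed

lemma odd_part_total: "x \<in> total V \<Longrightarrow> odd_part V x \<in> total V"
  using parts(2) in_total by blast

end

lemma even_linear_sum:
  assumes "superspace s V" "even_linear s V s' W \<phi>" "\<And>i. i \<in> I \<Longrightarrow> h i \<in> total V"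
  shows "\<phi> (sum h I) = (\<Sum>i\<in>I. \<phi> (h i))"
proof -
  interpret superspace s V by fact
  have z: "\<phi> 0 = 0"
  proof -
    have "\<phi> (0 + 0) = \<phi> 0 + \<phi> 0" using assms(2) total_0 unfolding even_linear_def by blast
    then show ?thesis by simp
  qed
  show ?thesis using assms(3)
  proof (induction I rule: infinite_finite_induct)
    case (insert i I)
    have "\<phi> (h i + sum h I) = \<phi> (h i) + \<phi> (sum h I)"
      using assms(2) insert.prems total_sum[of I h] unfolding even_linear_def by blast
    then show ?case using insert by simp
  qed (simp_all add: z)
qed

lemma even_linear_0:
  assumes "superspace s V" "even_linear s V s' W \<phi>"
  shows "\<phi> 0 = 0"
  using even_linear_sum[OF assms, of "{}"] by simp

lemma even_linear_total:
  assumes "superspace s V" "superspace s' W" "even_linear s V s' W \<phi>" "x \<in> total V"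
  shows "\<phi> x \<in> total W"
proof -
  interpret A: superspace s V by fact
  interpret B: superspace s' W by fact
  obtain y z where yz: "y \<in> V 0" "z \<in> V 1" "x = y + z"
    using assms(4) unfolding total_def by blast
  have "\<phi> x = \<phi> y + \<phi> z"
    using yz assms(3) A.in_total unfolding even_linear_def by blast
  moreover have "\<phi> y \<in> W 0" "\<phi> z \<in> W 1"
    using yz assms(3) unfolding even_linear_def by blast+
  ultimately show ?thesis unfolding total_def by blast
qed


section \<open>Polynomials over a space with an endomorphism\<close>

abbreviation del :: "'k::field poly" where "del \<equiv> [:0, 1:]"

context diff_superspace
begin

lemma D_add: "x \<in> total V \<Longrightarrow> y \<in> total V \<Longrightarrow> D (x + y) = D x + D y"
  and D_scale: "x \<in> total V \<Longrightarrow> D (scale c x) = scale c (D x)"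
  and D_component: "x \<in> V p \<Longrightarrow> D x \<in> V p"
  using even_endomorphism unfolding even_linear_def by blast+

lemma D_total: "x \<in> total V \<Longrightarrow> D x \<in> total V"
  using even_linear_total[OF superspace_axioms superspace_axioms even_endomorphism] .

lemma D_0: "D 0 = 0"
  using even_linear_0[OF superspace_axioms even_endomorphism] .

lemma D_sum: "(\<And>i. i \<in> I \<Longrightarrow> h i \<in> total V) \<Longrightarrow> D (sum h I) = (\<Sum>i\<in>I. D (h i))"
  using even_linear_sum[OF superspace_axioms even_endomorphism] .

lemma Dpow_even_linear: "even_linear scale V scale V (D ^^ d)"
  by (induction d)
    (use even_endomorphism even_linear_total[OF superspace_axioms superspace_axioms]
      in \<open>auto simp: even_linear_def\<close>)

lemma Dpow_add: "x \<in> total V \<Longrightarrow> y \<in> total V \<Longrightarrow> (D ^^ d) (x + y) = (D ^^ d) x + (D ^^ d) y"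
  and Dpow_scale: "x \<in> total V \<Longrightarrow> (D ^^ d) (scale c x) = scale c ((D ^^ d) x)"
  and Dpow_component: "x \<in> V p \<Longrightarrow> (D ^^ d) x \<in> V p"
  using Dpow_even_linear[of d] unfolding even_linear_def by blast+

lemma Dpow_total: "x \<in> total V \<Longrightarrow> (D ^^ d) x \<in> total V"
  using even_linear_total[OF superspace_axioms superspace_axioms Dpow_even_linear] .

lemma Dpow_0: "(D ^^ d) 0 = 0"
  using even_linear_0[OF superspace_axioms Dpow_even_linear] .

lemma Dpow_sum:
  "(\<And>i. i \<in> I \<Longrightarrow> h i \<in> total V) \<Longrightarrow> (D ^^ d) (sum h I) = (\<Sum>i\<in>I. (D ^^ d) (h i))"
  using even_linear_sum[OF superspace_axioms Dpow_even_linear] .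

text \<open>
  The module structure over the polynomial ring \<open>F[\<partial>]\<close>, in which \<open>\<partial>\<close> acts as \<^term>\<open>D\<close>.
\<close>

definition pact :: "'k poly \<Rightarrow> 'v \<Rightarrow> 'v" where
  "pact u x = (\<Sum>d\<le>degree u. scale (coeff u d) ((D ^^ d) x))"

lemma pact_eq:
  assumes "degree u \<le> n"
  shows "pact u x = (\<Sum>d\<le>n. scale (coeff u d) ((D ^^ d) x))"
  unfolding pact_def
  by (rule sum.mono_neutral_left) (use assms coeff_eq_0 in \<open>auto simp: not_le\<close>)

lemma pact_total: "x \<in> total V \<Longrightarrow> pact u x \<in> total V"
  unfolding pact_def by (intro total_sum total_scale Dpow_total)

lemma pact_0: "pact u 0 = 0"
  by (simp add: pact_def Dpow_0)

lemma pact_0_left: "pact 0 x = 0"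
  by (simp add: pact_def)

lemma pact_add_left: "pact (u + v) x = pact u x + pact v x"
proof -
  define n where "n = max (degree u) (degree v)"
  have "degree (u + v) \<le> n" "degree u \<le> n" "degree v \<le> n"
    by (auto simp: n_def intro: degree_add_le)
  then show ?thesis
    by (simp add: pact_eq[of _ n] scale_left_distrib sum.distrib)
qed

lemma pact_smult: "pact (smult c u) x = scale c (pact u x)"
  using pact_eq[of "smult c u" "degree u" x] degree_smult_le[of c u]
  by (simp add: pact_def scale_sum_right del: scale_scale add: scale_scale[symmetric])

lemma pact_const: "pact [:c:] x = scale c x"
  by (simp add: pact_def)

lemma pact_1: "pact 1 x = x"
  using pact_const[of 1 x] by (simp add: pCons_one)

lemma pact_sum_left: "pact (sum u I) x = (\<Sum>i\<in>I. pact (u i) x)"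
  by (induction I rule: infinite_finite_induct) (simp_all add: pact_0_left pact_add_left)

lemma pact_add: "x \<in> total V \<Longrightarrow> y \<in> total V \<Longrightarrow> pact u (x + y) = pact u x + pact u y"
  by (simp add: pact_def Dpow_add scale_right_distrib sum.distrib)

lemma pact_scale: "x \<in> total V \<Longrightarrow> pact u (scale c x) = scale c (pact u x)"
  by (simp add: pact_def Dpow_scale scale_sum_right mult.commute[of c])

lemma pact_sum:
  "(\<And>i. i \<in> I \<Longrightarrow> h i \<in> total V) \<Longrightarrow> pact u (sum h I) = (\<Sum>i\<in>I. pact u (h i))"
proof (induction I rule: infinite_finite_induct)
  case (insert i I)
  then show ?case using pact_add[of "h i" "sum h I" u] total_sum[of I h] by simp
qed (simp_all add: pact_0)

lemma pact_uminus_left: "pact (- u) x = - pact u x"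
  using pact_smult[of "- 1" u x] by simp

lemma pact_pCons_0:
  assumes "x \<in> total V"
  shows "pact (pCons 0 u) x = D (pact u x)"
proof -
  have "pact (pCons 0 u) x = (\<Sum>d\<le>Suc (degree u). scale (coeff (pCons 0 u) d) ((D ^^ d) x))"
    by (rule pact_eq) (rule degree_pCons_le)
  also have "\<dots> = (\<Sum>d\<le>degree u. scale (coeff u d) ((D ^^ Suc d) x))"
    by (subst sum.atMost_Suc_shift) simp
  also have "\<dots> = D (pact u x)"
    unfolding pact_def using assms
    by (subst D_sum) (auto intro!: total_scale Dpow_total sum.cong simp: D_scale Dpow_total)
  finally show ?thesis .
qed

lemma pact_mult:
  assumes "x \<in> total V"
  shows "pact (u * v) x = pact u (pact v x)"
proof (induction u)
  case 0
  then show ?case by (simp add: pact_0_left)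
next
  case (pCons c u)
  have split: "pact (pCons c u) y = scale c y + D (pact u y)" if "y \<in> total V" for y
  proof -
    have "pCons c u = [:c:] + pCons 0 u" by simp
    then have "pact (pCons c u) y = pact [:c:] y + pact (pCons 0 u) y"
      by (metis pact_add_left)
    then show ?thesis by (simp add: pact_const pact_pCons_0 that)
  qed
  have "pact (pCons c u * v) x = scale c (pact v x) + D (pact (u * v) x)"
    by (simp add: mult_pCons_left pact_add_left pact_smult pact_pCons_0 assms)
  then show ?case using pCons split[OF pact_total[OF assms]] by simp
qed

lemma pact_del: "x \<in> total V \<Longrightarrow> pact del x = D x"
  using pact_pCons_0[of x 1] by (simp add: pact_1 pCons_one)

lemma pact_del_power:
  assumes "x \<in> total V"
  shows "pact (del ^ d) x = (D ^^ d) x"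
proof (induction d)
  case (Suc d)
  then show ?case using pact_mult[OF assms, of del "del ^ d"] pact_del Dpow_total assms by simp
qed (simp add: pact_1)

definition polynomial :: "(nat \<Rightarrow> 'v) \<Rightarrow> bool" where
  "polynomial a \<longleftrightarrow> (\<forall>k. a k \<in> total V) \<and> (\<exists>K. \<forall>k\<ge>K. a k = 0)"

text \<open>
  The value of a polynomial \<open>\<Sum>k. a\<^sub>k \<lambda>\<^sup>k\<close> at an element of the commutative ring \<open>F[\<partial>]\<close>. A
  substitution such as \<open>\<lambda> \<mapsto> - \<lambda> - \<partial>\<close> becomes the evaluation at another point.
\<close>

definition ev :: "'k poly \<Rightarrow> (nat \<Rightarrow> 'v) \<Rightarrow> 'v" where
  "ev X a = (\<Sum>k | a k \<noteq> 0. pact (X ^ k) (a k))"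

lemma ev_eq:
  assumes "\<And>k. k \<ge> K \<Longrightarrow> a k = 0"
  shows "ev X a = (\<Sum>k<K. pact (X ^ k) (a k))"
  unfolding ev_def
  by (rule sum.mono_neutral_left) (use assms in \<open>auto simp: pact_0 not_less[symmetric]\<close>)

lemma polynomialI:
  "(\<And>k. a k \<in> total V) \<Longrightarrow> (\<And>k. k \<ge> K \<Longrightarrow> a k = 0) \<Longrightarrow> polynomial a"
  unfolding polynomial_def by blast

lemma polynomial_iff: "polynomial a \<longleftrightarrow> (\<forall>k. a k \<in> total V) \<and> finite {k. a k \<noteq> 0}"
proof -
  have "(\<exists>K. \<forall>k\<ge>K. a k = 0) \<longleftrightarrow> finite {k. a k \<noteq> 0}"
    unfolding finite_nat_set_iff_bounded by (auto simp: not_less[symmetric])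
  then show ?thesis by (simp add: polynomial_def)
qed

lemma polynomial_total: "polynomial a \<Longrightarrow> a k \<in> total V"
  by (simp add: polynomial_def)

lemma ev_total: "(\<And>k. a k \<in> total V) \<Longrightarrow> ev X a \<in> total V"
  unfolding ev_def by (intro total_sum pact_total) auto

lemma polynomial_zero: "polynomial (\<lambda>k. 0)"
  by (auto simp: polynomial_def total_0)

lemma polynomial_add:
  assumes "polynomial a" "polynomial b"
  shows "polynomial (\<lambda>k. a k + b k)"
proof -
  obtain K L where "\<forall>k\<ge>K. a k = 0" "\<forall>k\<ge>L. b k = 0"
    using assms unfolding polynomial_def by blast
  then show ?thesis using assms
    by (intro polynomialI[of _ "max K L"]) (auto simp: polynomial_def total_add)
qed

lemma polynomial_scale: "polynomial a \<Longrightarrow> polynomial (\<lambda>k. scale c (a k))"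
  unfolding polynomial_def using total_scale by fastforce

lemma polynomial_uminus: "polynomial a \<Longrightarrow> polynomial (\<lambda>k. - a k)"
  using polynomial_scale[of a "- 1"] by simp

lemma polynomial_diff: "polynomial a \<Longrightarrow> polynomial b \<Longrightarrow> polynomial (\<lambda>k. a k - b k)"
  using polynomial_add[of a "\<lambda>k. - b k"] polynomial_uminus[of b] by simp

lemma ev_zero: "ev X (\<lambda>k. 0) = 0"
  by (simp add: ev_def)

lemma ev_add:
  assumes "polynomial a" "polynomial b"
  shows "ev X (\<lambda>k. a k + b k) = ev X a + ev X b"
proof -
  obtain K L where K: "\<And>k. k \<ge> K \<Longrightarrow> a k = 0" "\<And>k. k \<ge> L \<Longrightarrow> b k = 0"
    using assms unfolding polynomial_def by blast
  show ?thesis using assms K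
    by (simp add: ev_eq[of "max K L"] polynomial_total pact_add sum.distrib)
qed

lemma ev_scale:
  assumes "polynomial a"
  shows "ev X (\<lambda>k. scale c (a k)) = scale c (ev X a)"
proof -
  obtain K where K: "\<And>k. k \<ge> K \<Longrightarrow> a k = 0" using assms unfolding polynomial_def by blast
  show ?thesis using assms K
    by (simp add: ev_eq[of K] polynomial_total pact_scale scale_sum_right)
qed

lemma ev_uminus: "polynomial a \<Longrightarrow> ev X (\<lambda>k. - a k) = - ev X a"
  using ev_scale[of a X "- 1"] by simp

lemma ev_diff: "polynomial a \<Longrightarrow> polynomial b \<Longrightarrow> ev X (\<lambda>k. a k - b k) = ev X a - ev X b"
  using ev_add[of a "\<lambda>k. - b k" X] polynomial_uminus[of b] ev_uminus[of b X] by simp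

lemma polynomial_times_var:
  assumes "polynomial a"
  shows "polynomial (times_var a)"
proof -
  obtain K where K: "\<And>k. k \<ge> K \<Longrightarrow> a k = 0" using assms unfolding polynomial_def by blast
  show ?thesis
    by (rule polynomialI[of _ "Suc K"])
      (use assms K total_0 in \<open>auto simp: times_var_def polynomial_total split: nat.split\<close>)
qed

lemma ev_times_var:
  assumes "polynomial a"
  shows "ev X (times_var a) = pact X (ev X a)"
proof -
  obtain K where K: "\<And>k. k \<ge> K \<Longrightarrow> a k = 0" using assms unfolding polynomial_def by blast
  have K': "k \<ge> Suc K \<Longrightarrow> times_var a k = 0" for k
    using K by (auto simp: times_var_def split: nat.split)
  have "ev X (times_var a) = (\<Sum>k<K. pact (X * X ^ k) (a k))"
    by (subst ev_eq[OF K'], simp) (subst sum.lessThan_Suc_shift, simp add: times_var_def pact_0)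
  also have "\<dots> = pact X (ev X a)"
    using assms K by (simp add: ev_eq[of K] pact_mult polynomial_total pact_sum pact_total)
  finally show ?thesis .
qed

lemma polynomial_D: "polynomial a \<Longrightarrow> polynomial (\<lambda>k. D (a k))"
  unfolding polynomial_def using D_total D_0 by fastforce

lemma ev_D:
  assumes "polynomial a"
  shows "ev X (\<lambda>k. D (a k)) = pact del (ev X a)"
proof -
  obtain K where K: "\<And>k. k \<ge> K \<Longrightarrow> a k = 0" using assms unfolding polynomial_def by blast
  have "ev X (\<lambda>k. D (a k)) = (\<Sum>k<K. pact (X ^ k) (pact del (a k)))"
    using assms K by (simp add: ev_eq[of K] D_0 pact_del polynomial_total)
  also have "\<dots> = (\<Sum>k<K. pact del (pact (X ^ k) (a k)))"
    by (intro sum.cong refl)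
      (metis pact_mult mult.commute polynomial_total[OF assms])
  also have "\<dots> = pact del (ev X a)"
    using assms K by (simp add: ev_eq[of K] pact_sum pact_total polynomial_total)
  finally show ?thesis .
qed

lemma subst_poly_eq:
  assumes "\<And>k. k \<ge> K \<Longrightarrow> a k = 0"
  shows "subst_poly scale D a j =
    (\<Sum>k\<in>{j..<K}. scale ((- 1) ^ k * of_nat (k choose j)) ((D ^^ (k - j)) (a k)))"
  unfolding subst_poly_def
proof (rule sum.mono_neutral_left)
    show "{k. j \<le> k \<and> a k \<noteq> 0} \<subseteq> {j..<K}" using assms by (auto simp: not_le[symmetric])
qed (auto simp: Dpow_0)

lemma polynomial_subst_poly:
  assumes "polynomial a"
  shows "polynomial (subst_poly scale D a)"
proof -
  obtain K where K: "\<And>k. k \<ge> K \<Longrightarrow> a k = 0" using assms unfolding polynomial_def by blast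
  show ?thesis
    by (rule polynomialI[of _ K])
      (use assms in \<open>auto simp: subst_poly_eq[of K a, OF K] polynomial_total intro!: total_sum total_scale Dpow_total\<close>)
qed

text \<open>
  The binomial theorem in \<open>F[\<partial>]\<close>, in the form shared by all substitutions of a sum for a variable.
\<close>

lemma ev_binomial:
  assumes K: "\<And>k. k \<ge> K \<Longrightarrow> a k = 0" and t: "\<And>k. a k \<in> total V"
    and b: "\<And>j. b j = (\<Sum>k\<in>{j..<K}. pact ([:of_nat (k choose j):] * Z ^ (k - j)) (a k))"
  shows "ev X b = (\<Sum>k<K. pact ((X + Z) ^ k) (a k))"
proof -
  have bK: "j \<ge> K \<Longrightarrow> b j = 0" for j by (simp add: b)
  have "ev X b = (\<Sum>j<K. \<Sum>k\<in>{j..<K}. pact (X ^ j * ([:of_nat (k choose j):] * Z ^ (k - j))) (a k))"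
    using t by (simp only: ev_eq[of K b, OF bK] b pact_sum pact_total pact_mult)
  also have "\<dots> = (\<Sum>j<K. \<Sum>k\<in>{k\<in>{..<K}. j \<le> k}. pact (X ^ j * ([:of_nat (k choose j):] * Z ^ (k - j))) (a k))"
    by (intro sum.cong refl) auto
  also have "\<dots> = (\<Sum>k<K. \<Sum>j\<in>{j\<in>{..<K}. j \<le> k}. pact (X ^ j * ([:of_nat (k choose j):] * Z ^ (k - j))) (a k))"
    by (rule sum.swap_restrict) auto
  also have "\<dots> = (\<Sum>k<K. \<Sum>j\<le>k. pact (X ^ j * ([:of_nat (k choose j):] * Z ^ (k - j))) (a k))"
    by (intro sum.cong refl) auto
  also have "\<dots> = (\<Sum>k<K. pact ((X + Z) ^ k) (a k))"
  proof (intro sum.cong refl)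
    fix k
    have "(X + Z) ^ k = (\<Sum>j\<le>k. X ^ j * ([:of_nat (k choose j):] * Z ^ (k - j)))"
      unfolding binomial_ring sum_distrib_left
      by (intro sum.cong refl) (simp add: of_nat_poly algebra_simps)
    then show "(\<Sum>j\<le>k. pact (X ^ j * ([:of_nat (k choose j):] * Z ^ (k - j))) (a k))
        = pact ((X + Z) ^ k) (a k)"
      by (simp only: pact_sum_left)
  qed
  finally show ?thesis .
qed


lemma ev_subst_poly:
  assumes a: "polynomial a"
  shows "ev X (subst_poly scale D a) = ev (- X - del) a"
proof -
  obtain K where K: "\<And>k. k \<ge> K \<Longrightarrow> a k = 0" using a unfolding polynomial_def by blast
  let ?a = "\<lambda>k. scale ((- 1) ^ k) (a k)"
  have "ev X (subst_poly scale D a) = (\<Sum>k<K. pact ((X + del) ^ k) (?a k))"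
  proof (rule ev_binomial)
    fix j
    show "subst_poly scale D a j =
        (\<Sum>k\<in>{j..<K}. pact ([:of_nat (k choose j):] * del ^ (k - j)) (?a k))"
      using K
      by (subst subst_poly_eq[of K a]) (auto intro!: sum.cong simp: pact_smult pact_const pact_del_power polynomial_total[OF a] total_scale Dpow_scale
          pact_scale mult.commute)
  qed (use K polynomial_total[OF a] total_scale in auto)
  also have "\<dots> = (\<Sum>k<K. pact ((- X - del) ^ k) (a k))"
  proof (intro sum.cong refl)
    fix k
    have "(- X - del) ^ k = smult ((- 1) ^ k) ((X + del) ^ k)"
      using power_minus[of "X + del" k]
      by (metis (no_types, lifting) minus_add_distrib smult_power diff_conv_add_uminus
          smult_1_left smult_minus_left)
    then show "pact ((X + del) ^ k) (?a k) = pact ((- X - del) ^ k) (a k)"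
      by (simp add: pact_smult pact_scale polynomial_total[OF a])
  qed
  also have "\<dots> = ev (- X - del) a" by (simp add: ev_eq[of K a, OF K])
  finally show ?thesis .
qed

lemma ev_const:
  assumes "\<And>k. k \<ge> K \<Longrightarrow> a k = 0"
  shows "ev [:s:] a = (\<Sum>k<K. scale (s ^ k) (a k))"
  by (simp add: ev_eq[of K a, OF assms] poly_const_pow pact_const)

text \<open>
  A coordinate functional reduces the statement to polynomials over the field, where a nonzero polynomial
  has finitely many roots.
\<close>

lemma polynomial_eqI:
  assumes inf: "infinite (UNIV :: 'k set)"
    and a: "polynomial a" and b: "polynomial b" and e: "\<And>s. ev [:s:] a = ev [:s:] b"
  shows "a = b"
proof -
  define c where "c k = a k - b k" for k
  have c: "polynomial c" using polynomial_diff[OF a b] by (simp add: c_def[abs_def])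
  obtain K where K: "\<And>k. k \<ge> K \<Longrightarrow> c k = 0" using c unfolding polynomial_def by blast
  have z: "(\<Sum>k<K. scale (s ^ k) (c k)) = 0" for s
    using ev_diff[OF a b, of "[:s:]"] e[of s] ev_const[of K c s, OF K] by (simp add: c_def[abs_def])
  define B where "B = extend_basis {}"
  have B: "independent B" "span B = UNIV"
    using independent_extend_basis[OF independent_empty] span_extend_basis[OF independent_empty]
    by (simp_all add: B_def)
  have "c k = 0" for k
  proof (rule ccontr)
    assume "c k \<noteq> 0"
    then have "\<exists>v. representation B (c k) v \<noteq> 0"
      using sum_nonzero_representation_eq[OF B(1), of "c k"] B(2) by (metis (mono_tags, lifting) UNIV_I sum.neutral mem_Collect_eq)
    then obtain v where v: "representation B (c k) v \<noteq> 0" by blast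
    define u where "u = (\<Sum>j<K. monom (representation B (c j) v) j)"
    have cu: "coeff u k = representation B (c k) v"
      using K[of k] \<open>c k \<noteq> 0\<close> by (force simp: u_def coeff_sum if_distrib cong: if_cong)
    have "poly u s = 0" for s
    proof -
      have "poly u s = representation B (\<Sum>k<K. scale (s ^ k) (c k)) v"
        using B by (simp add: u_def poly_sum poly_monom representation_sum representation_scale mult.commute)
      then show ?thesis using z by (simp add: representation_zero)
    qed
    then have "{s. poly u s = 0} = UNIV" by auto
    then have "u = 0" using poly_roots_finite[of u] inf by auto
    then show False using cu v by simp
  qed
  then show ?thesis by (simp add: c_def fun_eq_iff)
qed

lemma subst_poly_involution:
  assumes "infinite (UNIV :: 'k set)" "polynomial a"
  shows "subst_poly scale D (subst_poly scale D a) = a"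
  by (rule polynomial_eqI)
    (use assms in \<open>simp_all add: polynomial_subst_poly ev_subst_poly\<close>)

definition polynomial2 :: "(nat \<Rightarrow> nat \<Rightarrow> 'v) \<Rightarrow> bool" where
  "polynomial2 c \<longleftrightarrow> (\<forall>i j. c i j \<in> total V) \<and> (\<exists>K. \<forall>i j. K \<le> i \<or> K \<le> j \<longrightarrow> c i j = 0)"

definition ev2 :: "'k poly \<Rightarrow> 'k poly \<Rightarrow> (nat \<Rightarrow> nat \<Rightarrow> 'v) \<Rightarrow> 'v" where
  "ev2 X Y c = ev X (\<lambda>i. ev Y (c i))"

lemma polynomial2I:
  assumes "\<And>i j. c i j \<in> total V" "\<And>i j. K \<le> i \<Longrightarrow> c i j = 0" "\<And>i. polynomial (c i)"
  shows "polynomial2 c"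
proof -
  have "\<forall>i. \<exists>L. \<forall>j\<ge>L. c i j = 0" using assms(3) by (auto simp: polynomial_def)
  then obtain L where L: "\<And>i j. j \<ge> L i \<Longrightarrow> c i j = 0" by metis
  define M where "M = Max (insert K (L ` {..<K}))"
  have "K \<le> M" "i < K \<Longrightarrow> L i \<le> M" for i by (auto simp: M_def)
  then have "M \<le> i \<or> M \<le> j \<longrightarrow> c i j = 0" for i j
    using assms(2)[of i j] L[of i j] by (cases "i < K") force+
  then show ?thesis using assms(1) unfolding polynomial2_def by blast
qed

lemma polynomial2_row: "polynomial2 c \<Longrightarrow> polynomial (c i)"
  unfolding polynomial2_def polynomial_def by blast

lemma polynomial2_flip: "polynomial2 c \<Longrightarrow> polynomial2 (\<lambda>i j. c j i)"
  unfolding polynomial2_def by blast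

lemma polynomial2_add:
  assumes "polynomial2 c" "polynomial2 d"
  shows "polynomial2 (\<lambda>i j. c i j + d i j)"
proof -
  obtain K L where K: "\<forall>i j. K \<le> i \<or> K \<le> j \<longrightarrow> c i j = 0" "\<forall>i j. L \<le> i \<or> L \<le> j \<longrightarrow> d i j = 0"
    using assms unfolding polynomial2_def by blast
  have "\<forall>i j. max K L \<le> i \<or> max K L \<le> j \<longrightarrow> c i j + d i j = 0" using K by auto
  then show ?thesis using assms total_add unfolding polynomial2_def by blast
qed

lemma polynomial2_scale:
  assumes "polynomial2 c"
  shows "polynomial2 (\<lambda>i j. scale r (c i j))"
proof -
  obtain K where K: "\<forall>i j. K \<le> i \<or> K \<le> j \<longrightarrow> c i j = 0"
    using assms unfolding polynomial2_def by blast
  then have "\<forall>i j. K \<le> i \<or> K \<le> j \<longrightarrow> scale r (c i j) = 0" by auto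
  then show ?thesis using assms total_scale unfolding polynomial2_def by blast
qed

lemma polynomial2_diff:
  "polynomial2 c \<Longrightarrow> polynomial2 d \<Longrightarrow> polynomial2 (\<lambda>i j. c i j - d i j)"
  using polynomial2_add[of c "\<lambda>i j. scale (- 1) (d i j)"] polynomial2_scale[of d "- 1"] by simp

lemma polynomial_ev_row:
  assumes "polynomial2 c"
  shows "polynomial (\<lambda>i. ev Y (c i))"
proof -
  obtain K where K: "\<forall>i j. K \<le> i \<or> K \<le> j \<longrightarrow> c i j = 0" and t: "\<And>i j. c i j \<in> total V"
    using assms unfolding polynomial2_def by blast
  show ?thesis
    by (rule polynomialI[of _ K]) (use K t ev_total in \<open>auto simp: ev_def\<close>)
qed

lemma ev2_eq:
  assumes "\<And>i j. K \<le> i \<or> K \<le> j \<Longrightarrow> c i j = 0" "\<And>i j. c i j \<in> total V"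
  shows "ev2 X Y c = (\<Sum>i<K. \<Sum>j<K. pact (X ^ i * Y ^ j) (c i j))"
proof -
  have r: "ev Y (c i) = (\<Sum>j<K. pact (Y ^ j) (c i j))" for i
    by (rule ev_eq) (use assms in auto)
  have "ev2 X Y c = (\<Sum>i<K. pact (X ^ i) (ev Y (c i)))"
    unfolding ev2_def by (rule ev_eq) (use assms in \<open>auto simp: r pact_0\<close>)
  then show ?thesis using assms(2) by (simp add: r pact_sum pact_total pact_mult)
qed

lemma ev2_swap:
  assumes "polynomial2 c"
  shows "ev2 X Y c = ev2 Y X (\<lambda>i j. c j i)"
proof -
  obtain K where K: "\<And>i j. K \<le> i \<or> K \<le> j \<Longrightarrow> c i j = 0" and t: "\<And>i j. c i j \<in> total V"
    using assms unfolding polynomial2_def by blast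
  have "ev2 X Y c = (\<Sum>i<K. \<Sum>j<K. pact (X ^ i * Y ^ j) (c i j))" by (rule ev2_eq) (use K t in auto)
  also have "\<dots> = (\<Sum>j<K. \<Sum>i<K. pact (X ^ i * Y ^ j) (c i j))" by (rule sum.swap)
  also have "\<dots> = ev2 Y X (\<lambda>i j. c j i)"
    by (subst ev2_eq[of K]) (use K t in \<open>auto simp: mult.commute\<close>)
  finally show ?thesis .
qed

lemma ev2_scale: "polynomial2 c \<Longrightarrow> ev2 X Y (\<lambda>i j. scale r (c i j)) = scale r (ev2 X Y c)"
  unfolding ev2_def by (simp add: ev_scale polynomial2_row polynomial_ev_row)

lemma ev2_diff: "polynomial2 c \<Longrightarrow> polynomial2 d \<Longrightarrow> ev2 X Y (\<lambda>i j. c i j - d i j) = ev2 X Y c - ev2 X Y d"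
  unfolding ev2_def by (simp add: ev_diff polynomial2_row polynomial_ev_row)

lemma polynomial2_eqI:
  assumes inf: "infinite (UNIV :: 'k set)"
    and c: "polynomial2 c" and d: "polynomial2 d" and e: "\<And>s t. ev2 [:s:] [:t:] c = ev2 [:s:] [:t:] d"
  shows "c = d"
proof -
  have "(\<lambda>i. ev [:t:] (c i)) = (\<lambda>i. ev [:t:] (d i))" for t
    using polynomial_eqI[OF inf polynomial_ev_row[OF c] polynomial_ev_row[OF d]] e
    unfolding ev2_def by blast
  then have "ev [:t:] (c i) = ev [:t:] (d i)" for t i by (rule fun_cong)
  then have "c i = d i" for i
    using polynomial_eqI[OF inf polynomial2_row[OF c] polynomial2_row[OF d]] by blast
  then show ?thesis by blast
qed

text \<open>
  A Cauchy product is the restriction of a polynomial in two variables to the diagonal.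
\<close>

lemma ev_diagonal:
  assumes "\<And>i j. K \<le> i \<or> K \<le> j \<Longrightarrow> c i j = 0" "\<And>i j. c i j \<in> total V"
  shows "ev Y (\<lambda>n. \<Sum>k\<le>n. c k (n - k)) = ev2 Y Y c"
proof -
  have "ev Y (\<lambda>n. \<Sum>k\<le>n. c k (n - k)) = (\<Sum>n<K+K. pact (Y ^ n) (\<Sum>k\<le>n. c k (n - k)))"
  proof (rule ev_eq)
    fix n assume n: "K + K \<le> n"
    show "(\<Sum>k\<le>n. c k (n - k)) = 0"
    proof (rule sum.neutral, rule ballI)
      fix k show "c k (n - k) = 0" using n by (intro assms(1)) linarith
    qed
  qed
  also have "\<dots> = (\<Sum>n<K+K. \<Sum>k\<le>n. pact (Y ^ k * Y ^ (n - k)) (c k (n - k)))"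
    using assms(2) by (intro sum.cong refl) (simp add: pact_sum power_add[symmetric])
  also have "\<dots> = (\<Sum>(i, j)\<in>{(i, j). i + j < K + K}. pact (Y ^ i * Y ^ j) (c i j))"
    by (rule sum.triangle_reindex[symmetric])
  also have "\<dots> = (\<Sum>(i, j)\<in>{..<K} \<times> {..<K}. pact (Y ^ i * Y ^ j) (c i j))"
  proof (rule sum.mono_neutral_right)
    show "finite {(i, j). i + j < K + K}"
      by (rule finite_subset[of _ "{..<K+K} \<times> {..<K+K}"]) auto
  qed (use assms(1) in \<open>auto simp: pact_0 not_le[symmetric]\<close>)
  also have "\<dots> = ev2 Y Y c" using assms by (simp add: ev2_eq[of K] sum.cartesian_product)
  finally show ?thesis .
qed

lemma expand_sum_large:
  assumes "\<And>i j. K \<le> i \<or> K \<le> j \<Longrightarrow> c i j = 0" "K + K \<le> i + j"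
  shows "expand_sum scale c i j = 0"
  unfolding expand_sum_def
proof (rule sum.neutral, rule ballI)
  fix k assume "k \<in> {..i}"
  then have "c k (i + j - k) = 0" using assms(2) by (intro assms(1)) (simp, linarith)
  then show "scale (of_nat ((i + j - k) choose j)) (c k (i + j - k)) = 0" by simp
qed

lemma polynomial2_expand_sum:
  assumes "polynomial2 c"
  shows "polynomial2 (expand_sum scale c)"
proof -
  obtain K where K: "\<And>i j. K \<le> i \<or> K \<le> j \<Longrightarrow> c i j = 0" and t: "\<And>i j. c i j \<in> total V"
    using assms unfolding polynomial2_def by blast
  have "K + K \<le> i \<or> K + K \<le> j \<longrightarrow> expand_sum scale c i j = 0" for i j
    using expand_sum_large[of K c i j, OF K] by auto
  moreover have "expand_sum scale c i j \<in> total V" for i j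
    unfolding expand_sum_def by (intro total_sum total_scale t)
  ultimately show ?thesis unfolding polynomial2_def by blast
qed

text \<open>
  In the expansion of \<open>\<Sum>k l. c k l x\<^sup>k (x + y)\<^sup>l\<close> the power of \<open>x\<close> collects a contribution from \<open>x\<^sup>k\<close>, a
  Cauchy product, and one from \<open>(x + y)\<^sup>l\<close>, a binomial expansion.
\<close>

lemma ev2_expand_sum:
  assumes "polynomial2 c"
  shows "ev2 Y X (expand_sum scale c) = ev2 Y (X + Y) c"
proof -
  obtain K where K: "\<And>i j. K \<le> i \<or> K \<le> j \<Longrightarrow> c i j = 0" and t: "\<And>i j. c i j \<in> total V"
    using assms unfolding polynomial2_def by blast
  define d where "d a k = (\<Sum>l\<in>{a..<K}. pact ([:of_nat (l choose a):] * Y ^ (l - a)) (c k l))" for a k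
  have dp: "polynomial2 d"
    unfolding polynomial2_def
  proof (intro conjI allI exI[of _ K] impI)
    fix i j show "d i j \<in> total V" unfolding d_def by (intro total_sum pact_total t)
    show "d i j = 0" if "K \<le> i \<or> K \<le> j" using that K by (auto simp: d_def pact_0)
  qed
  have row: "ev Y (\<lambda>b. expand_sum scale c b a) = ev Y (d a)" for a
  proof -
    let ?e = "\<lambda>k l. scale (of_nat ((l + a) choose a)) (c k (l + a))"
    have "expand_sum scale c b a = (\<Sum>k\<le>b. ?e k (b - k))" for b
      unfolding expand_sum_def by (intro sum.cong refl) (simp add: add.commute)
    moreover have "ev Y (\<lambda>b. \<Sum>k\<le>b. ?e k (b - k)) = ev2 Y Y ?e"
      by (rule ev_diagonal[of K]) (use K t total_scale in auto)
    ultimately have "ev Y (\<lambda>b. expand_sum scale c b a) = ev2 Y Y ?e" by presburger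
    moreover have "ev Y (?e k) = d a k" for k
    proof -
      have "ev Y (?e k) = (\<Sum>l<K - a. pact (Y ^ l) (?e k l))"
      proof (rule ev_eq)
        fix l assume "K - a \<le> l"
        then have "c k (l + a) = 0" by (intro K) linarith
        then show "?e k l = 0" by simp
      qed
      also have "\<dots> = (\<Sum>l<K - a. pact ([:of_nat ((l + a) choose a):] * Y ^ l) (c k (l + a)))"
        by (simp add: pact_smult pact_scale t)
      also have "\<dots> = (\<Sum>l\<in>{0+a..<(K-a)+a}. pact ([:of_nat (l choose a):] * Y ^ (l - a)) (c k l))"
        by (subst sum.shift_bounds_nat_ivl) (simp add: lessThan_atLeast0)
      also have "\<dots> = d a k"
        unfolding d_def by (cases "a \<le> K") simp_all
      finally show ?thesis .
    qed
    ultimately show ?thesis by (simp add: ev2_def)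
  qed
  have "ev2 Y X (expand_sum scale c) = ev2 X Y (\<lambda>a b. expand_sum scale c b a)"
    using ev2_swap[OF polynomial2_expand_sum[OF assms]] .
  also have "\<dots> = ev2 X Y d" by (simp add: ev2_def row)
  also have "\<dots> = ev2 Y X (\<lambda>k a. d a k)" using ev2_swap[OF dp] .
  also have "\<dots> = ev2 Y (X + Y) c"
  proof -
    have "ev X (\<lambda>a. d a k) = ev (X + Y) (c k)" for k
    proof -
      have "ev X (\<lambda>a. d a k) = (\<Sum>l<K. pact ((X + Y) ^ l) (c k l))"
        by (rule ev_binomial) (use K t in \<open>auto simp: d_def\<close>)
      then show ?thesis by (subst (2) ev_eq[of K]) (use K in auto)
    qed
    then show ?thesis by (simp add: ev2_def)
  qed
  finally show ?thesis .
qed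

end

section \<open>From right-symmetric products to Lie brackets\<close>

text \<open>
  The part of the structure that the bracket depends on. The limit enters through two properties only:
  the projections separate points, and the series made from the coefficients of a product and powers
  of \<open>\<partial>\<close> converge. The direct sum of the spaces of invariants has these properties, although it
  is itself only a projective limit degree by degree.
\<close>

locale pro_right_symmetric = diff_superspace scale R D
  for scale :: "'k::field_char_0 \<Rightarrow> 'r::ab_group_add \<Rightarrow> 'r" and R D +
  fixes star :: "'r \<Rightarrow> 'r \<Rightarrow> nat \<Rightarrow> 'r"
    and scaleq :: "'k \<Rightarrow> 's::ab_group_add \<Rightarrow> 's"
    and Rq :: "nat \<Rightarrow> bit \<Rightarrow> 's set"
    and Dq :: "nat \<Rightarrow> 's \<Rightarrow> 's"
    and pr :: "nat \<Rightarrow> 'r \<Rightarrow> 's"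
  assumes star_bilinear: "even_bilinear_series scale R R R star"
    and star_D_left: "f \<in> total R \<Longrightarrow> g \<in> total R \<Longrightarrow>
      star (D f) g k = times_var (star f g) k + D (star f g k)"
    and star_D_right: "f \<in> total R \<Longrightarrow> g \<in> total R \<Longrightarrow> star f (D g) k = - times_var (star f g) k"
    and right_symmetric: "f \<in> total R \<Longrightarrow> g \<in> R p \<Longrightarrow> h \<in> R r \<Longrightarrow>
      star (star f g a) h b - expand_sum scale (\<lambda>k. star f (star g h k)) b a =
        scale (koszul_sign p r)
          (star (star f h b) g a - expand_sum scale (\<lambda>k. star f (star h g k)) a b)"
    and level: "diff_superspace scaleq (Rq q) (Dq q)"
    and pr_diff_hom: "diff_hom scale R D scaleq (Rq q) (Dq q) (pr q)"
    and pr_separates: "x \<in> total R \<Longrightarrow> (\<And>q. pr q x = 0) \<Longrightarrow> x = 0"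
    and star_polynomial: "f \<in> total R \<Longrightarrow> g \<in> total R \<Longrightarrow> finite {k. pr q (star f g k) \<noteq> 0}"
    and star_complete: "f \<in> total R \<Longrightarrow> g \<in> total R \<Longrightarrow>
      \<exists>y\<in>total R. \<forall>q. pr q y =
        (\<Sum>k | pr q (star f g k) \<noteq> 0. scaleq (c k) ((Dq q ^^ e k) (pr q (star f g k))))"
begin

sublocale level: diff_superspace scaleq "Rq q" "Dq q" for q
  by (rule level)

lemma pr_even_linear: "even_linear scale R scaleq (Rq q) (pr q)"
  using pr_diff_hom unfolding diff_hom_def by blast

lemma pr_add: "x \<in> total R \<Longrightarrow> y \<in> total R \<Longrightarrow> pr q (x + y) = pr q x + pr q y"
  and pr_scale: "x \<in> total R \<Longrightarrow> pr q (scale c x) = scaleq c (pr q x)"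
  and pr_component: "x \<in> R p \<Longrightarrow> pr q x \<in> Rq q p"
  and pr_D: "x \<in> total R \<Longrightarrow> pr q (D x) = Dq q (pr q x)"
  using pr_diff_hom[of q] unfolding diff_hom_def even_linear_def by blast+

lemma pr_0: "pr q 0 = 0"
  using even_linear_0[OF superspace_axioms pr_even_linear] .

lemma pr_total: "x \<in> total R \<Longrightarrow> pr q x \<in> total (Rq q)"
  using even_linear_total[OF superspace_axioms level.superspace_axioms pr_even_linear] .

lemma pr_sum: "(\<And>i. i \<in> I \<Longrightarrow> h i \<in> total R) \<Longrightarrow> pr q (sum h I) = (\<Sum>i\<in>I. pr q (h i))"
  using even_linear_sum[OF superspace_axioms pr_even_linear] .

lemma pr_uminus: "x \<in> total R \<Longrightarrow> pr q (- x) = - pr q x"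
  using pr_scale[of x q "- 1"] by simp

lemma pr_diff: "x \<in> total R \<Longrightarrow> y \<in> total R \<Longrightarrow> pr q (x - y) = pr q x - pr q y"
  using pr_add[of x "- y" q] pr_uminus[of y q] total_uminus by simp

lemma pr_Dpow: "x \<in> total R \<Longrightarrow> pr q ((D ^^ d) x) = (Dq q ^^ d) (pr q x)"
  by (induction d) (simp_all add: pr_D Dpow_total)

lemma pr_injective:
  assumes "x \<in> total R" "y \<in> total R" "\<And>q. pr q x = pr q y"
  shows "x = y"
  using pr_separates[of "x - y"] assms by (simp add: pr_diff total_diff)

lemma star_component: "f \<in> R p \<Longrightarrow> g \<in> R r \<Longrightarrow> star f g k \<in> R (p + r)"
  and star_add_left: "f \<in> total R \<Longrightarrow> f' \<in> total R \<Longrightarrow> g \<in> total R \<Longrightarrow>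
      star (f + f') g k = star f g k + star f' g k"
  and star_add_right: "f \<in> total R \<Longrightarrow> g \<in> total R \<Longrightarrow> g' \<in> total R \<Longrightarrow>
      star f (g + g') k = star f g k + star f g' k"
  and star_scale_left: "f \<in> total R \<Longrightarrow> g \<in> total R \<Longrightarrow> star (scale c f) g k = scale c (star f g k)"
  and star_scale_right: "f \<in> total R \<Longrightarrow> g \<in> total R \<Longrightarrow> star f (scale c g) k = scale c (star f g k)"
  using star_bilinear by (auto simp: even_bilinear_series_def)

lemma star_total:
  assumes "f \<in> total R" "g \<in> total R"
  shows "star f g k \<in> total R"
proof -
  obtain f0 f1 g0 g1 where d: "f0 \<in> R 0" "f1 \<in> R 1" "f = f0 + f1" "g0 \<in> R 0" "g1 \<in> R 1" "g = g0 + g1"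
    using assms unfolding total_def by blast
  then have "star f g k = star f0 g0 k + star f0 g1 k + (star f1 g0 k + star f1 g1 k)"
    by (simp add: star_add_left star_add_right in_total total_add)
  moreover have "star x y k \<in> total R" if "x \<in> R p" "y \<in> R r" for x y p r
    using in_total star_component that by blast
  ultimately show ?thesis using d total_add by metis
qed

lemma pr_star_polynomial:
  "f \<in> total R \<Longrightarrow> g \<in> total R \<Longrightarrow> level.polynomial q (\<lambda>k. pr q (star f g k))"
  by (simp add: level.polynomial_iff star_polynomial star_total pr_total)

text \<open>
  The product \<open>f *\<^sub>-\<^sub>\<lambda>\<^sub>-\<^sub>\<partial> g\<close>, whose coefficients exist by completeness.
\<close>

definition dstar :: "'r \<Rightarrow> 'r \<Rightarrow> nat \<Rightarrow> 'r" where
  "dstar f g k = (SOME y. y \<in> total R \<and>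
     (\<forall>q. pr q y = subst_poly scaleq (Dq q) (\<lambda>k. pr q (star f g k)) k))"

lemma dstar_total: "f \<in> total R \<Longrightarrow> g \<in> total R \<Longrightarrow> dstar f g k \<in> total R"
  and pr_dstar: "f \<in> total R \<Longrightarrow> g \<in> total R \<Longrightarrow>
    pr q (dstar f g k) = subst_poly scaleq (Dq q) (\<lambda>k. pr q (star f g k)) k"
proof -
  assume fg: "f \<in> total R" "g \<in> total R"
  obtain y where y: "y \<in> total R" "\<And>q. pr q y =
      (\<Sum>i | pr q (star f g i) \<noteq> 0.
        scaleq ((- 1) ^ i * of_nat (i choose k)) ((Dq q ^^ (i - k)) (pr q (star f g i))))"
    using star_complete[OF fg, of "\<lambda>i. (- 1) ^ i * of_nat (i choose k)" "\<lambda>i. i - k"] by blast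
  have "pr q y = subst_poly scaleq (Dq q) (\<lambda>k. pr q (star f g k)) k" for q
    unfolding y(2) subst_poly_def
    by (rule sum.mono_neutral_right) (use star_polynomial[OF fg] in \<open>auto simp: not_le\<close>)
  then have "\<exists>y. y \<in> total R \<and> (\<forall>q. pr q y = subst_poly scaleq (Dq q) (\<lambda>k. pr q (star f g k)) k)"
    using y(1) by blast
  then have "dstar f g k \<in> total R \<and>
      (\<forall>q. pr q (dstar f g k) = subst_poly scaleq (Dq q) (\<lambda>k. pr q (star f g k)) k)"
    unfolding dstar_def by (rule someI_ex)
  then show "dstar f g k \<in> total R"
    "pr q (dstar f g k) = subst_poly scaleq (Dq q) (\<lambda>k. pr q (star f g k)) k" by blast+
qed

text \<open>
  The component of the wrong parity has zero projections.
\<close>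

lemma component_of_pr:
  assumes x: "x \<in> total R" and pr: "\<And>q. pr q x \<in> Rq q p"
  shows "x \<in> R p"
proof -
  obtain y z where d: "y \<in> R 0" "z \<in> R 1" "x = y + z" using x unfolding total_def by blast
  have dt: "y \<in> total R" "z \<in> total R" using d in_total by blast+
  let ?z = "if p = 0 then z else y"
  have "pr q ?z = 0" for q
  proof -
    have e: "pr q x = pr q y + pr q z"
      unfolding d(3) by (rule pr_add[OF dt])
    have c: "pr q y \<in> Rq q 0" "pr q z \<in> Rq q 1"
      using d pr_component by blast+
    show ?thesis
    proof (cases "p = 0")
      case True
      then have "pr q x \<in> Rq q 0" using pr[of q] by simp
      moreover have "pr q y + pr q z = pr q x + 0" using e by simp
      ultimately have "pr q z = 0" using level.decompose_unique[OF c _ level.component_0] by blast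
      then show ?thesis using True by simp
    next
      case False
      then have "p = 1" using bit_cases[of p] by simp
      then have "pr q x \<in> Rq q 1" using pr[of q] by simp
      moreover have "pr q y + pr q z = 0 + pr q x" using e by simp
      ultimately have "pr q y = 0" using level.decompose_unique[OF c level.component_0] by blast
      then show ?thesis using \<open>p = 1\<close> by simp
    qed
  qed
  moreover have "?z \<in> total R" using dt by simp
  ultimately have "?z = 0" by (rule pr_separates[rotated])
  then show ?thesis using d bit_cases[of p] by (auto split: if_splits)
qed

lemma dstar_component:
  assumes f: "f \<in> R p" and g: "g \<in> R r"
  shows "dstar f g k \<in> R (p + r)"
proof (rule component_of_pr)
  have t: "f \<in> total R" "g \<in> total R" using f g in_total by blast+
  then show "dstar f g k \<in> total R" by (rule dstar_total)
  show "pr q (dstar f g k) \<in> Rq q (p + r)" for q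
    unfolding pr_dstar[OF t] subst_poly_def
    by (intro level.component_sum level.component_scale level.Dpow_component pr_component star_component f g)
qed

lemma pr_dstar_polynomial:
  "f \<in> total R \<Longrightarrow> g \<in> total R \<Longrightarrow> level.polynomial q (\<lambda>k. pr q (dstar f g k))"
  by (simp add: pr_dstar level.polynomial_subst_poly pr_star_polynomial)

lemma ev_dstar:
  "f \<in> total R \<Longrightarrow> g \<in> total R \<Longrightarrow>
    level.ev q X (\<lambda>k. pr q (dstar f g k)) = level.ev q (- X - del) (\<lambda>k. pr q (star f g k))"
  by (simp add: pr_dstar level.ev_subst_poly pr_star_polynomial)

lemma series_eqI:
  assumes "\<And>k. a k \<in> total R" "\<And>k. b k \<in> total R"
    and "\<And>q. level.polynomial q (\<lambda>k. pr q (a k))" "\<And>q. level.polynomial q (\<lambda>k. pr q (b k))"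
    and "\<And>q X. level.ev q X (\<lambda>k. pr q (a k)) = level.ev q X (\<lambda>k. pr q (b k))"
  shows "a k = b k"
proof (rule pr_injective)
  fix q
  have "(\<lambda>k. pr q (a k)) = (\<lambda>k. pr q (b k))"
    using level.polynomial_eqI[OF infinite_UNIV_char_0 assms(3,4,5)] .
  then show "pr q (a k) = pr q (b k)" by (rule fun_cong)
qed (use assms in auto)

lemma dstar_add_left:
  assumes "f \<in> total R" "f' \<in> total R" "g \<in> total R"
  shows "dstar (f + f') g k = dstar f g k + dstar f' g k"
  by (rule series_eqI)
    (use assms in \<open>simp_all add: dstar_total total_add pr_add level.ev_add pr_dstar_polynomial
      level.polynomial_add ev_dstar star_add_left star_total pr_star_polynomial\<close>)

lemma dstar_add_right:
  assumes "f \<in> total R" "g \<in> total R" "g' \<in> total R"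
  shows "dstar f (g + g') k = dstar f g k + dstar f g' k"
  by (rule series_eqI)
    (use assms in \<open>simp_all add: dstar_total total_add pr_add level.ev_add pr_dstar_polynomial
      level.polynomial_add ev_dstar star_add_right star_total pr_star_polynomial\<close>)

lemma dstar_scale_left:
  assumes "f \<in> total R" "g \<in> total R"
  shows "dstar (scale c f) g k = scale c (dstar f g k)"
  by (rule series_eqI)
    (use assms in \<open>simp_all add: dstar_total total_scale pr_scale level.ev_scale pr_dstar_polynomial
      level.polynomial_scale ev_dstar star_scale_left star_total pr_star_polynomial\<close>)

lemma dstar_scale_right:
  assumes "f \<in> total R" "g \<in> total R"
  shows "dstar f (scale c g) k = scale c (dstar f g k)"
  by (rule series_eqI)
    (use assms in \<open>simp_all add: dstar_total total_scale pr_scale level.ev_scale pr_dstar_polynomial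
      level.polynomial_scale ev_dstar star_scale_right star_total pr_star_polynomial\<close>)

lemma pr_times_var: "pr q (times_var a k) = times_var (\<lambda>k. pr q (a k)) k"
  by (cases k) (simp_all add: times_var_def pr_0)

lemma times_var_total: "(\<And>k. a k \<in> total R) \<Longrightarrow> times_var a k \<in> total R"
  by (cases k) (simp_all add: times_var_def total_0)

text \<open>
  Substituting \<open>- \<lambda> - \<partial>\<close> exchanges the two sesquilinearity rules: the factor \<open>\<lambda> + \<partial>\<close> becomes \<open>- \<lambda>\<close>, and
  \<open>- \<lambda>\<close> becomes \<open>\<lambda> + \<partial>\<close>.
\<close>

lemma dstar_D_left:
  assumes fg: "f \<in> total R" "g \<in> total R"
  shows "dstar (D f) g k = - times_var (dstar f g) k"
proof (rule series_eqI)
  fix q X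
  let ?s = "\<lambda>k. pr q (star f g k)" and ?d = "\<lambda>k. pr q (dstar f g k)"
  have p: "level.polynomial q ?s" "level.polynomial q ?d"
    using fg by (auto intro: pr_star_polynomial pr_dstar_polynomial)
  have d: "pr q (- times_var (dstar f g) k) = - times_var ?d k" for k
    using fg by (simp add: pr_uminus times_var_total dstar_total pr_times_var)
  show "level.polynomial q (\<lambda>k. pr q (- times_var (dstar f g) k))"
    unfolding d using p(2) by (intro level.polynomial_uminus level.polynomial_times_var)
  have s: "pr q (star (D f) g k) = times_var ?s k + Dq q (?s k)" for k
    using fg by (simp add: star_D_left pr_add pr_D times_var_total star_total D_total pr_times_var)
  have "level.ev q X (\<lambda>k. pr q (dstar (D f) g k)) = level.ev q (- X - del) (\<lambda>k. times_var ?s k + Dq q (?s k))"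
    using fg by (simp add: ev_dstar D_total s)
  also have "\<dots> = level.pact q (- X - del) (level.ev q (- X - del) ?s) + level.pact q del (level.ev q (- X - del) ?s)"
    using p by (simp add: level.ev_add level.polynomial_times_var level.polynomial_D level.ev_times_var level.ev_D)
  also have "\<dots> = level.pact q (- X) (level.ev q (- X - del) ?s)"
    by (simp add: level.pact_add_left[symmetric])
  also have "\<dots> = level.ev q X (\<lambda>k. pr q (- times_var (dstar f g) k))"
    unfolding d using fg p
    by (simp add: level.ev_uminus level.polynomial_times_var level.ev_times_var ev_dstar level.pact_uminus_left)
  finally show "level.ev q X (\<lambda>k. pr q (dstar (D f) g k)) = level.ev q X (\<lambda>k. pr q (- times_var (dstar f g) k))" .
qed (use fg in \<open>auto intro: dstar_total D_total pr_dstar_polynomial total_uminus times_var_total\<close>)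

lemma dstar_D_right:
  assumes fg: "f \<in> total R" "g \<in> total R"
  shows "dstar f (D g) k = times_var (dstar f g) k + D (dstar f g k)"
proof (rule series_eqI)
  fix q X
  let ?s = "\<lambda>k. pr q (star f g k)" and ?d = "\<lambda>k. pr q (dstar f g k)"
  have p: "level.polynomial q ?s" "level.polynomial q ?d"
    using fg by (auto intro: pr_star_polynomial pr_dstar_polynomial)
  have d: "pr q (times_var (dstar f g) k + D (dstar f g k)) = times_var ?d k + Dq q (?d k)" for k
    using fg by (simp add: pr_add pr_D times_var_total dstar_total D_total pr_times_var)
  show "level.polynomial q (\<lambda>k. pr q (times_var (dstar f g) k + D (dstar f g k)))"
    unfolding d using p(2) by (intro level.polynomial_add level.polynomial_times_var level.polynomial_D)
  have s: "pr q (star f (D g) k) = - times_var ?s k" for k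
    using fg by (simp add: star_D_right pr_uminus times_var_total star_total pr_times_var)
  have "level.ev q X (\<lambda>k. pr q (dstar f (D g) k)) = level.ev q (- X - del) (\<lambda>k. - times_var ?s k)"
    using fg by (simp add: ev_dstar D_total s)
  also have "\<dots> = level.pact q (X + del) (level.ev q (- X - del) ?s)"
    using p by (simp add: level.ev_uminus level.polynomial_times_var level.ev_times_var level.pact_uminus_left[symmetric] add.commute)
  also have "\<dots> = level.ev q X (\<lambda>k. pr q (times_var (dstar f g) k + D (dstar f g k)))"
    unfolding d using fg p
    by (subst level.pact_add_left) (simp add: level.ev_add level.polynomial_times_var
        level.polynomial_D level.ev_times_var level.ev_D ev_dstar)
  finally show "level.ev q X (\<lambda>k. pr q (dstar f (D g) k)) = level.ev q X (\<lambda>k. pr q (times_var (dstar f g) k + D (dstar f g k)))" .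
qed (use fg in \<open>auto intro: dstar_total D_total pr_dstar_polynomial total_add times_var_total\<close>)


section \<open>Automatic continuity\<close>

text \<open>
  \<open>y\<close> is the sum of the convergent series \<open>\<Sum>k. c\<^sub>k \<partial>\<^sup>e\<^sup>k a\<^sub>k\<close>; every bound \<open>K\<close> for the support of the
  projected sequence is allowed, so that sequences can be compared without matching supports.
\<close>

definition completes :: "(nat \<Rightarrow> 'r) \<Rightarrow> (nat \<Rightarrow> 'k) \<Rightarrow> (nat \<Rightarrow> nat) \<Rightarrow> 'r \<Rightarrow> bool" where
  "completes a c e y \<longleftrightarrow> y \<in> total R \<and>
     (\<forall>q K. (\<forall>k\<ge>K. pr q (a k) = 0) \<longrightarrow>
        pr q y = (\<Sum>k<K. scaleq (c k) ((Dq q ^^ e k) (pr q (a k)))))"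

lemma star_completion:
  assumes "f \<in> total R" "g \<in> total R"
  shows "\<exists>y. completes (star f g) c e y"
proof -
  obtain y where y: "y \<in> total R" "\<And>q. pr q y =
        (\<Sum>k | pr q (star f g k) \<noteq> 0. scaleq (c k) ((Dq q ^^ e k) (pr q (star f g k))))"
    using star_complete[OF assms, of c e] by blast
  have "pr q y = (\<Sum>k<K. scaleq (c k) ((Dq q ^^ e k) (pr q (star f g k))))"
    if "\<forall>k\<ge>K. pr q (star f g k) = 0" for q K
    unfolding y(2)
    by (rule sum.mono_neutral_left) (use that in \<open>auto simp: level.Dpow_0 not_le[symmetric]\<close>)
  then show ?thesis using y(1) unfolding completes_def by blast
qed

lemma dstar_completes:
  assumes "f \<in> total R" "g \<in> total R"
  shows "completes (star f g) (\<lambda>k. (- 1) ^ k * of_nat (k choose m)) (\<lambda>k. k - m) (dstar f g m)"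
  unfolding completes_def
proof (intro conjI allI impI)
  fix q K assume K: "\<forall>k\<ge>K. pr q (star f g k) = 0"
  have "pr q (dstar f g m) = (\<Sum>k\<in>{m..<K}. scaleq ((- 1) ^ k * of_nat (k choose m)) ((Dq q ^^ (k - m)) (pr q (star f g k))))"
    unfolding pr_dstar[OF assms] by (rule level.subst_poly_eq) (use K in auto)
  also have "\<dots> = (\<Sum>k<K. scaleq ((- 1) ^ k * of_nat (k choose m)) ((Dq q ^^ (k - m)) (pr q (star f g k))))"
    by (rule sum.mono_neutral_left) auto
  finally show "pr q (dstar f g m) = \<dots>" .
qed (rule dstar_total[OF assms])

text \<open>
  If \<open>\<partial>\<^sup>d\<close> divides every term from the \<open>N\<close>-th on, it divides the sum of these terms: the cofactor
  is the sum of another convergent series of the same kind.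
\<close>

lemma completes_tail:
  assumes fg: "f \<in> total R" "g \<in> total R" and y: "completes (star f g) c e y"
    and e: "\<And>k. N \<le> k \<Longrightarrow> d \<le> e k"
  shows "\<exists>z\<in>total R. y = (\<Sum>k<N. scale (c k) ((D ^^ e k) (star f g k))) + (D ^^ d) z"
proof -
  obtain z where z: "completes (star f g) (\<lambda>k. if k < N then 0 else c k) (\<lambda>k. e k - d) z"
    using star_completion[OF fg] by blast
  then have zt: "z \<in> total R" unfolding completes_def by blast
  have t: "(\<Sum>k<N. scale (c k) ((D ^^ e k) (star f g k))) \<in> total R"
    using fg by (intro total_sum total_scale Dpow_total star_total)
  have "y = (\<Sum>k<N. scale (c k) ((D ^^ e k) (star f g k))) + (D ^^ d) z"
  proof (rule pr_injective)
    fix q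
    obtain K' where K': "\<forall>k\<ge>K'. pr q (star f g k) = 0"
      using pr_star_polynomial[OF fg, of q] unfolding level.polynomial_def by blast
    define K where "K = max K' N"
    have K: "\<forall>k\<ge>K. pr q (star f g k) = 0" "N \<le> K" using K' by (auto simp: K_def)
    let ?t = "\<lambda>k. scaleq (c k) ((Dq q ^^ e k) (pr q (star f g k)))"
    have tt: "pr q (star f g k) \<in> total (Rq q)" for k using fg by (intro pr_total star_total)
    have "pr q z = (\<Sum>k<K. scaleq (if k < N then 0 else c k) ((Dq q ^^ (e k - d)) (pr q (star f g k))))"
      using z K unfolding completes_def by blast
    also have "\<dots> = (\<Sum>k\<in>{N..<K}. scaleq (c k) ((Dq q ^^ (e k - d)) (pr q (star f g k))))"
      by (rule sum.mono_neutral_cong_right) auto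
    finally have "(Dq q ^^ d) (pr q z) = (\<Sum>k\<in>{N..<K}. scaleq (c k) ((Dq q ^^ d) ((Dq q ^^ (e k - d)) (pr q (star f g k)))))"
      using tt by (simp add: level.Dpow_sum level.total_scale level.Dpow_total level.Dpow_scale)
    also have "\<dots> = (\<Sum>k\<in>{N..<K}. ?t k)"
      using e by (intro sum.cong refl) (simp add: funpow_add[unfolded comp_def, THEN fun_cong, symmetric])
    finally have 1: "pr q ((D ^^ d) z) = (\<Sum>k\<in>{N..<K}. ?t k)" using zt by (simp add: pr_Dpow)
    have 2: "pr q (\<Sum>k<N. scale (c k) ((D ^^ e k) (star f g k))) = (\<Sum>k<N. ?t k)"
      using fg by (simp add: pr_sum total_scale Dpow_total star_total pr_scale pr_Dpow)
    have "pr q y = (\<Sum>k<K. ?t k)" using y K unfolding completes_def by blast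
    also have "\<dots> = (\<Sum>k<N. ?t k) + (\<Sum>k\<in>{N..<K}. ?t k)"
      using sum.atLeastLessThan_concat[of 0 N K ?t] K(2) by (simp add: lessThan_atLeast0)
    finally show "pr q y = pr q ((\<Sum>k<N. scale (c k) ((D ^^ e k) (star f g k))) + (D ^^ d) z)"
      using 1 2 t zt by (simp add: pr_add Dpow_total)
  qed (use y zt t in \<open>auto simp: completes_def intro: total_add Dpow_total\<close>)
  then show ?thesis using zt by blast
qed

text \<open>
  The property that makes both \<open>f *\<^sub>\<lambda> x\<close> and \<open>x *\<^sub>-\<^sub>\<lambda>\<^sub>-\<^sub>\<partial> h\<close> continuous in \<open>x\<close>.
\<close>

definition conformal_functional :: "nat \<Rightarrow> ('r \<Rightarrow> nat \<Rightarrow> 's) \<Rightarrow> bool" where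
  "conformal_functional q \<psi> \<longleftrightarrow>
     (\<forall>x\<in>total R. level.polynomial q (\<psi> x)) \<and>
     (\<forall>x\<in>total R. \<forall>y\<in>total R. \<forall>j. \<psi> (x + y) j = \<psi> x j + \<psi> y j) \<and>
     (\<forall>c. \<forall>x\<in>total R. \<forall>j. \<psi> (scale c x) j = scaleq c (\<psi> x j)) \<and>
     (\<forall>x\<in>total R. \<forall>j. \<psi> (D x) j = - times_var (\<psi> x) j)"

lemma conformal_functional_star:
  assumes f: "f \<in> total R"
  shows "conformal_functional q (\<lambda>x j. pr q (star f x j))"
  unfolding conformal_functional_def
  using f by (simp add: pr_star_polynomial star_add_right star_scale_right star_D_right star_total
      total_add total_scale times_var_total pr_add pr_scale pr_uminus pr_times_var)

lemma conformal_functional_dstar: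
  assumes h: "h \<in> total R"
  shows "conformal_functional q (\<lambda>x j. pr q (dstar x h j))"
  unfolding conformal_functional_def
  using h by (simp add: pr_dstar_polynomial dstar_add_left dstar_scale_left dstar_D_left dstar_total
      total_add total_scale times_var_total pr_add pr_scale pr_uminus pr_times_var)

context
  fixes q :: nat and \<psi> :: "'r \<Rightarrow> nat \<Rightarrow> 's"
  assumes \<psi>: "conformal_functional q \<psi>"
begin

lemma functional_polynomial: "x \<in> total R \<Longrightarrow> level.polynomial q (\<psi> x)"
  and functional_add: "x \<in> total R \<Longrightarrow> y \<in> total R \<Longrightarrow> \<psi> (x + y) j = \<psi> x j + \<psi> y j"
  and functional_scale: "x \<in> total R \<Longrightarrow> \<psi> (scale c x) j = scaleq c (\<psi> x j)"
  and functional_D: "x \<in> total R \<Longrightarrow> \<psi> (D x) j = - times_var (\<psi> x) j"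
  using \<psi> unfolding conformal_functional_def by blast+

lemma functional_sum:
  "(\<And>i. i \<in> I \<Longrightarrow> h i \<in> total R) \<Longrightarrow> \<psi> (sum h I) j = (\<Sum>i\<in>I. \<psi> (h i) j)"
proof (induction I rule: infinite_finite_induct)
  case (insert i I)
  then show ?case using functional_add[of "h i" "sum h I" j] total_sum[of I h] by simp
qed (use functional_scale[OF total_0, of 0 j] in auto)

lemma functional_Dpow:
  assumes x: "x \<in> total R"
  shows "\<psi> ((D ^^ d) x) j = (if j < d then 0 else scaleq ((- 1) ^ d) (\<psi> x (j - d)))"
proof (induction d arbitrary: j)
  case (Suc d)
  have "\<psi> ((D ^^ Suc d) x) j = - times_var (\<psi> ((D ^^ d) x)) j"
    using x by (simp add: functional_D Dpow_total)
  then show ?case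
    by (cases j) (simp_all add: times_var_0 times_var_Suc Suc)
qed simp

lemma functional_ev_Dpow:
  assumes x: "x \<in> total R"
  shows "level.ev q Y (\<psi> ((D ^^ d) x)) = level.pact q ((- Y) ^ d) (level.ev q Y (\<psi> x))"
proof (induction d)
  case (Suc d)
  have "\<psi> ((D ^^ Suc d) x) = (\<lambda>j. - times_var (\<psi> ((D ^^ d) x)) j)"
    using x by (intro ext) (simp add: functional_D Dpow_total)
  then have "level.ev q Y (\<psi> ((D ^^ Suc d) x)) = level.pact q (- Y) (level.ev q Y (\<psi> ((D ^^ d) x)))"
    using x by (simp add: level.ev_uminus level.polynomial_times_var functional_polynomial Dpow_total
      level.ev_times_var level.pact_uminus_left)
  moreover have "level.ev q Y (\<psi> x) \<in> total (Rq q)"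
    using x by (intro level.ev_total level.polynomial_total functional_polynomial)
  ultimately show ?case by (simp only: Suc power_Suc level.pact_mult)
qed (simp add: level.pact_1)

text \<open>
  The coefficient of \<open>\<lambda>\<^sup>j\<close> does not see multiples of \<open>\<partial>\<^sup>j\<^sup>+\<^sup>1\<close>, and \<open>completes_tail\<close> provides such a multiple.
\<close>

lemma functional_completes:
  assumes fg: "f \<in> total R" "g \<in> total R" and y: "completes (star f g) c e y"
    and e: "\<And>k. N \<le> k \<Longrightarrow> j < e k"
  shows "\<psi> y j = (\<Sum>k<N. scaleq (c k) (\<psi> ((D ^^ e k) (star f g k)) j))"
proof -
  obtain z where z: "z \<in> total R" "y = (\<Sum>k<N. scale (c k) ((D ^^ e k) (star f g k))) + (D ^^ Suc j) z"
    using completes_tail[OF fg y, of N "Suc j"] e by (auto simp: Suc_le_eq)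
  have t: "scale (c k) ((D ^^ e k) (star f g k)) \<in> total R" for k
    using fg by (intro total_scale Dpow_total star_total)
  have "\<psi> y j = (\<Sum>k<N. \<psi> (scale (c k) ((D ^^ e k) (star f g k))) j) + \<psi> ((D ^^ Suc j) z) j"
    unfolding z(2) by (subst functional_add) (simp_all only: total_sum t Dpow_total z(1) functional_sum)
  also have "\<psi> ((D ^^ Suc j) z) j = 0" using functional_Dpow[OF z(1)] by (simp del: funpow.simps)
  finally show ?thesis
    using fg by (simp add: functional_scale Dpow_total star_total)
qed

text \<open>
  Slenderness of polynomial modules. The exponents \<open>e\<close> grow so fast that the values of the functional
  on the summands \<open>\<partial>\<^sup>e\<^sup>k a\<^sub>k\<close> of a convergent series have disjoint supports, hence cannot cancel. Since
  the value on the whole series is a polynomial, almost all of them vanish.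
\<close>

lemma functional_star_eventually_0:
  assumes fg: "f \<in> total R" "g \<in> total R"
  shows "\<exists>K. \<forall>k\<ge>K. \<forall>j. \<psi> (star f g k) j = 0"
proof -
  let ?a = "star f g"
  have a: "?a k \<in> total R" for k using star_total fg by blast
  have "\<exists>b. \<forall>k. \<forall>j\<ge>b k. \<psi> (?a k) j = 0"
    using functional_polynomial[OF a] unfolding level.polynomial_def by metis
  then obtain b where b: "\<And>k j. b k \<le> j \<Longrightarrow> \<psi> (?a k) j = 0" by blast
  \<comment> \<open>The value on the \<open>k\<close>-th summand is supported in the interval from \<open>e k\<close> to \<open>e (Suc k)\<close>.\<close>
  define e where "e k = (\<Sum>i<k. Suc (b i))" for k
  have eS: "e (Suc k) = e k + Suc (b k)" for k by (simp add: e_def)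
  have em: "e k \<le> e l" if "k \<le> l" for k l
    using that by (rule lift_Suc_mono_le[rotated]) (simp add: eS)
  have ek: "k \<le> e k" for k by (induction k) (auto simp: eS)
  obtain y where y: "completes ?a (\<lambda>k. 1) e y" using star_completion[OF fg] by blast
  then have "y \<in> total R" unfolding completes_def by blast
  then obtain J where J: "\<And>j. j \<ge> J \<Longrightarrow> \<psi> y j = 0"
    using functional_polynomial unfolding level.polynomial_def by blast
  have "\<psi> (?a k) i = 0" if k: "J \<le> k" for k i
  proof (cases "b k \<le> i")
    case False
    define j where "j = e k + i"
    have j: "e k \<le> j" "j < e (Suc k)" using False by (auto simp: j_def eS)
    have small: "\<psi> ((D ^^ e l) (?a l)) j = 0" if l: "l < k" for l
    proof -
      have "e l + Suc (b l) \<le> j" using em[of "Suc l" k] l j eS[of l] by simp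
      then have "b l \<le> j - e l" by linarith
      then show ?thesis using functional_Dpow[OF a] b by simp
    qed
    have "0 = \<psi> y j" using J[of j] j ek[of k] k by simp
    also have "\<dots> = (\<Sum>l<Suc k. scaleq 1 (\<psi> ((D ^^ e l) (?a l)) j))"
    proof (rule functional_completes[OF fg y])
      fix l assume "Suc k \<le> l"
      then show "j < e l" using em[of "Suc k" l] j by linarith
    qed
    also have "\<dots> = \<psi> ((D ^^ e k) (?a k)) j" using small by simp
    also have "\<dots> = scaleq ((- 1) ^ e k) (\<psi> (?a k) i)"
      using functional_Dpow[OF a, of "e k" k j] j by (simp add: j_def)
    finally show ?thesis by simp
  qed (rule b)
  then show ?thesis by blast
qed

text \<open>
  As only finitely many terms contribute, the functional may be applied to \<open>f *\<^sub>-\<^sub>\<lambda>\<^sub>-\<^sub>\<partial> g\<close> term by term.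
  In the second variable \<open>\<mu>\<close> it turns \<open>\<partial>\<close> into \<open>- \<mu>\<close>, so that \<open>- \<lambda> - \<partial>\<close> becomes \<open>\<mu> - \<lambda>\<close>.
\<close>

lemma functional_dstar:
  assumes fg: "f \<in> total R" "g \<in> total R"
  shows "level.polynomial2 q (\<lambda>k. \<psi> (star f g k))" "level.polynomial2 q (\<lambda>k. \<psi> (dstar f g k))"
    and "level.ev2 q X Y (\<lambda>k. \<psi> (dstar f g k)) = level.ev2 q (Y - X) Y (\<lambda>k. \<psi> (star f g k))"
proof -
  let ?a = "star f g"
  have a: "?a k \<in> total R" for k using star_total fg by blast
  obtain K where K: "\<And>k j. k \<ge> K \<Longrightarrow> \<psi> (?a k) j = 0"
    using functional_star_eventually_0[OF fg] by blast
  have \<psi>d: "\<psi> (dstar f g m) j =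
      (\<Sum>k\<in>{m..<K}. scaleq ((- 1) ^ k * of_nat (k choose m)) (\<psi> ((D ^^ (k - m)) (?a k)) j))" for m j
  proof -
    have "\<psi> (dstar f g m) j = (\<Sum>k<Suc (K + m + j).
        scaleq ((- 1) ^ k * of_nat (k choose m)) (\<psi> ((D ^^ (k - m)) (?a k)) j))"
      by (rule functional_completes[OF fg dstar_completes[OF fg]]) simp
    also have "\<dots> = (\<Sum>k\<in>{m..<K}. scaleq ((- 1) ^ k * of_nat (k choose m)) (\<psi> ((D ^^ (k - m)) (?a k)) j))"
      by (rule sum.mono_neutral_right) (auto simp: functional_Dpow[OF a] K not_less)
    finally show ?thesis .
  qed
  show p: "level.polynomial2 q (\<lambda>k. \<psi> (?a k))"
    by (rule level.polynomial2I[of _ _ K])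
      (use a K functional_polynomial level.polynomial_total in auto)
  show "level.polynomial2 q (\<lambda>k. \<psi> (dstar f g k))"
  proof (rule level.polynomial2I[of _ _ K])
    show "\<psi> (dstar f g i) j \<in> total (Rq q)" for i j
      using level.polynomial_total functional_polynomial[OF dstar_total[OF fg]] by blast
    show "\<psi> (dstar f g i) j = 0" if "K \<le> i" for i j
      using that by (simp add: \<psi>d)
  qed (rule functional_polynomial[OF dstar_total[OF fg]])
  let ?A = "\<lambda>k. scaleq ((- 1) ^ k) (level.ev q Y (\<psi> (?a k)))"
  have t: "level.ev q Y (\<psi> (?a k)) \<in> total (Rq q)" for k
    by (intro level.ev_total level.polynomial_total functional_polynomial a)
  have z: "level.ev q Y (\<psi> (?a k)) = 0" if "k \<ge> K" for k
    using K[OF that] by (simp add: level.ev_def)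
  have ev_d: "level.ev q Y (\<psi> (dstar f g m)) =
      (\<Sum>k\<in>{m..<K}. level.pact q ([:of_nat (k choose m):] * (- Y) ^ (k - m)) (?A k))" for m
  proof -
    have fin: "level.ev q Y (\<lambda>j. \<Sum>k\<in>I. scaleq (c k) (\<psi> ((D ^^ (k - m)) (?a k)) j)) =
        (\<Sum>k\<in>I. scaleq (c k) (level.ev q Y (\<psi> ((D ^^ (k - m)) (?a k))))) \<and>
        level.polynomial q (\<lambda>j. \<Sum>k\<in>I. scaleq (c k) (\<psi> ((D ^^ (k - m)) (?a k)) j))"
      if "finite I" for I c
      using that
      by (induction I)
        (simp_all add: level.ev_zero level.polynomial_zero level.ev_add level.polynomial_add
          level.polynomial_scale level.ev_scale functional_polynomial Dpow_total a)
    have "level.ev q Y (\<psi> (dstar f g m)) =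
        (\<Sum>k\<in>{m..<K}. scaleq ((- 1) ^ k * of_nat (k choose m)) (level.ev q Y (\<psi> ((D ^^ (k - m)) (?a k)))))"
      using fin[of "{m..<K}"] by (subst \<psi>d[abs_def]) simp
    also have "\<dots> = (\<Sum>k\<in>{m..<K}. level.pact q ([:of_nat (k choose m):] * (- Y) ^ (k - m)) (?A k))"
      by (intro sum.cong refl)
        (simp add: functional_ev_Dpow a level.pact_smult level.pact_scale t mult.commute)
    finally show ?thesis .
  qed
  have "level.ev2 q X Y (\<lambda>k. \<psi> (dstar f g k)) = (\<Sum>k<K. level.pact q ((X + - Y) ^ k) (?A k))"
    unfolding level.ev2_def
    by (rule level.ev_binomial) (use z ev_d t level.total_scale in auto)
  also have "\<dots> = (\<Sum>k<K. level.pact q ((Y - X) ^ k) (level.ev q Y (\<psi> (?a k))))"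
  proof (intro sum.cong refl)
    fix k
    have "(Y - X) ^ k = smult ((- 1) ^ k) ((X + - Y) ^ k)"
      using smult_power[of "- 1" "X + - Y" k] by simp
    then show "level.pact q ((X + - Y) ^ k) (?A k) = level.pact q ((Y - X) ^ k) (level.ev q Y (\<psi> (?a k)))"
      by (simp add: level.pact_smult level.pact_scale t)
  qed
  also have "\<dots> = level.ev2 q (Y - X) Y (\<lambda>k. \<psi> (star f g k))"
    unfolding level.ev2_def by (subst level.ev_eq[of K]) (use z in auto)
  finally show "level.ev2 q X Y (\<lambda>k. \<psi> (dstar f g k)) = level.ev2 q (Y - X) Y (\<lambda>k. \<psi> (star f g k))" .
qed

end


section \<open>The bracket and the Jacobi identity\<close>

lemma pr_star_row_zero:
  assumes fg: "f \<in> total R" "g \<in> total R" and z: "\<And>j. pr q (dstar f g j) = 0"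
  shows "pr q (star f g j) = 0"
proof -
  have "(\<lambda>j. pr q (star f g j)) = (\<lambda>j. 0)"
  proof (rule level.polynomial_eqI[OF infinite_UNIV_char_0])
    fix s
    have "level.ev q [:s:] (\<lambda>j. pr q (star f g j)) = level.ev q (- [:s:] - del) (\<lambda>j. pr q (dstar f g j))"
      using fg by (simp add: ev_dstar)
    then show "level.ev q [:s:] (\<lambda>j. pr q (star f g j)) = level.ev q [:s:] (\<lambda>j. 0)"
      by (simp add: z level.ev_zero)
  qed (auto intro: pr_star_polynomial fg level.polynomial_zero)
  then show ?thesis by (rule fun_cong)
qed

text \<open>
  Uniform polynomiality passes between the two products in the outer position, because the substitution
  is an involution.
\<close>

lemma row_dual:
  assumes "\<And>i. u i \<in> total R" "\<And>i. v i \<in> total R"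
    and "level.polynomial2 q (\<lambda>i j. pr q (dstar (u i) (v i) j))"
  shows "level.polynomial2 q (\<lambda>i j. pr q (star (u i) (v i) j))"
proof -
  obtain K where K: "\<And>i j. K \<le> i \<Longrightarrow> pr q (dstar (u i) (v i) j) = 0"
    using assms(3) unfolding level.polynomial2_def by blast
  show ?thesis
    by (rule level.polynomial2I[of _ _ K])
      (use assms K pr_star_row_zero pr_total star_total pr_star_polynomial in auto)
qed

lemma row_dual':
  assumes "\<And>i. u i \<in> total R" "\<And>i. v i \<in> total R"
    and "level.polynomial2 q (\<lambda>i j. pr q (star (u i) (v i) j))"
  shows "level.polynomial2 q (\<lambda>i j. pr q (dstar (u i) (v i) j))"
proof -
  obtain K where K: "\<And>i j. K \<le> i \<Longrightarrow> pr q (star (u i) (v i) j) = 0"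
    using assms(3) unfolding level.polynomial2_def by blast
  show ?thesis
  proof (rule level.polynomial2I[of _ _ K])
    show "pr q (dstar (u i) (v i) j) = 0" if "K \<le> i" for i j
      using that assms(1,2) by (simp add: pr_dstar subst_poly_def K)
  qed (use assms pr_total dstar_total pr_dstar_polynomial in auto)
qed

lemma ev2_dstar:
  assumes "\<And>i. u i \<in> total R" "\<And>i. v i \<in> total R"
  shows "level.ev2 q X Y (\<lambda>i j. pr q (dstar (u i) (v i) j)) =
    level.ev2 q X (- Y - del) (\<lambda>i j. pr q (star (u i) (v i) j))"
  using assms by (simp add: level.ev2_def ev_dstar)

context
  fixes f g h
  assumes fgh: "f \<in> total R" "g \<in> total R" "h \<in> total R"
begin

lemma polynomial2_triple:
  shows "level.polynomial2 q (\<lambda>i j. pr q (star (star f g i) h j))"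
    and "level.polynomial2 q (\<lambda>i j. pr q (star (dstar f g i) h j))"
    and "level.polynomial2 q (\<lambda>i j. pr q (dstar (star f g i) h j))"
    and "level.polynomial2 q (\<lambda>i j. pr q (dstar (dstar f g i) h j))"
    and "level.polynomial2 q (\<lambda>i j. pr q (star f (star g h i) j))"
    and "level.polynomial2 q (\<lambda>i j. pr q (star f (dstar g h i) j))"
    and "level.polynomial2 q (\<lambda>i j. pr q (dstar f (star g h i) j))"
    and "level.polynomial2 q (\<lambda>i j. pr q (dstar f (dstar g h i) j))"
proof -
  show 1: "level.polynomial2 q (\<lambda>i j. pr q (dstar (star f g i) h j))"
    and 2: "level.polynomial2 q (\<lambda>i j. pr q (dstar (dstar f g i) h j))"
    by (rule functional_dstar(1,2)[OF conformal_functional_dstar[OF fgh(3)] fgh(1,2)])+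
  show 3: "level.polynomial2 q (\<lambda>i j. pr q (star f (star g h i) j))"
    and 4: "level.polynomial2 q (\<lambda>i j. pr q (star f (dstar g h i) j))"
    by (rule functional_dstar(1,2)[OF conformal_functional_star[OF fgh(1)] fgh(2,3)])+
  show "level.polynomial2 q (\<lambda>i j. pr q (star (star f g i) h j))"
    by (rule row_dual[OF _ _ 1]) (auto intro: fgh star_total)
  show "level.polynomial2 q (\<lambda>i j. pr q (star (dstar f g i) h j))"
    by (rule row_dual[OF _ _ 2]) (auto intro: fgh dstar_total)
  show "level.polynomial2 q (\<lambda>i j. pr q (dstar f (star g h i) j))"
    by (rule row_dual'[OF _ _ 3]) (auto intro: fgh star_total)
  show "level.polynomial2 q (\<lambda>i j. pr q (dstar f (dstar g h i) j))"
    by (rule row_dual'[OF _ _ 4]) (auto intro: fgh dstar_total)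
qed

text \<open>
  With \<open>X\<close> in the inner and \<open>Y\<close> in the outer product, every mixed triple product is the one made from
  \<open>*\<^sub>\<lambda>\<close> alone, evaluated at a different point.
\<close>

lemma ev2_left:
  shows "level.ev2 q X Y (\<lambda>i j. pr q (dstar (star f g i) h j)) =
      level.ev2 q X (- Y - del) (\<lambda>i j. pr q (star (star f g i) h j))"
    and "level.ev2 q X Y (\<lambda>i j. pr q (dstar (dstar f g i) h j)) =
      level.ev2 q (Y - X) (- Y - del) (\<lambda>i j. pr q (star (star f g i) h j))"
    and "level.ev2 q X Y (\<lambda>i j. pr q (star (dstar f g i) h j)) =
      level.ev2 q (- X - Y - del) Y (\<lambda>i j. pr q (star (star f g i) h j))"
proof -
  show 1: "level.ev2 q X Y (\<lambda>i j. pr q (dstar (star f g i) h j)) =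
      level.ev2 q X (- Y - del) (\<lambda>i j. pr q (star (star f g i) h j))" for X Y
    by (rule ev2_dstar) (auto intro: fgh star_total)
  show 2: "level.ev2 q X Y (\<lambda>i j. pr q (dstar (dstar f g i) h j)) =
      level.ev2 q (Y - X) (- Y - del) (\<lambda>i j. pr q (star (star f g i) h j))" for X Y
    using functional_dstar(3)[OF conformal_functional_dstar[OF fgh(3)] fgh(1,2)] 1 by simp
  have "level.ev2 q X (- Y - del) (\<lambda>i j. pr q (dstar (dstar f g i) h j)) =
      level.ev2 q X Y (\<lambda>i j. pr q (star (dstar f g i) h j))"
    using ev2_dstar[of "dstar f g" "\<lambda>_. h" q X "- Y - del"] fgh dstar_total by simp
  moreover have "- Y - del - X = - X - Y - del" by (simp only: diff_diff_eq diff_conv_add_uminus ac_simps)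
  ultimately show "level.ev2 q X Y (\<lambda>i j. pr q (star (dstar f g i) h j)) =
      level.ev2 q (- X - Y - del) Y (\<lambda>i j. pr q (star (star f g i) h j))"
    using 2[of X "- Y - del"] by simp
qed

lemma ev2_right:
  shows "level.ev2 q X Y (\<lambda>i j. pr q (star f (dstar g h i) j)) =
      level.ev2 q (Y - X) Y (\<lambda>i j. pr q (star f (star g h i) j))"
    and "level.ev2 q X Y (\<lambda>i j. pr q (dstar f (star g h i) j)) =
      level.ev2 q X (- Y - del) (\<lambda>i j. pr q (star f (star g h i) j))"
    and "level.ev2 q X Y (\<lambda>i j. pr q (dstar f (dstar g h i) j)) =
      level.ev2 q (- X - Y - del) (- Y - del) (\<lambda>i j. pr q (star f (star g h i) j))"
proof -
  show 1: "level.ev2 q X Y (\<lambda>i j. pr q (star f (dstar g h i) j)) =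
      level.ev2 q (Y - X) Y (\<lambda>i j. pr q (star f (star g h i) j))" for X Y
    by (rule functional_dstar(3)[OF conformal_functional_star[OF fgh(1)] fgh(2,3)])
  show "level.ev2 q X Y (\<lambda>i j. pr q (dstar f (star g h i) j)) =
      level.ev2 q X (- Y - del) (\<lambda>i j. pr q (star f (star g h i) j))"
    by (rule ev2_dstar) (auto intro: fgh star_total)
  have "level.ev2 q X Y (\<lambda>i j. pr q (dstar f (dstar g h i) j)) =
      level.ev2 q X (- Y - del) (\<lambda>i j. pr q (star f (dstar g h i) j))"
    by (rule ev2_dstar) (auto intro: fgh dstar_total)
  moreover have "- Y - del - X = - X - Y - del" by (simp only: diff_diff_eq diff_conv_add_uminus ac_simps)
  ultimately show "level.ev2 q X Y (\<lambda>i j. pr q (dstar f (dstar g h i) j)) =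
      level.ev2 q (- X - Y - del) (- Y - del) (\<lambda>i j. pr q (star f (star g h i) j))"
    using 1[of X "- Y - del"] by simp
qed

end

lemma pr_expand_sum:
  assumes "\<And>i j. c i j \<in> total R"
  shows "pr q (expand_sum scale c i j) = expand_sum scaleq (\<lambda>i j. pr q (c i j)) i j"
  unfolding expand_sum_def using assms by (simp add: pr_sum total_scale pr_scale)

lemma expand_sum_total: "(\<And>i j. c i j \<in> total R) \<Longrightarrow> expand_sum scale c i j \<in> total R"
  unfolding expand_sum_def by (intro total_sum total_scale)

text \<open>
  The right-symmetric identity at the point \<open>(X, Y)\<close>; the expansion of \<open>\<lambda> + \<mu>\<close> becomes evaluation at
  \<open>X + Y\<close>.
\<close>

lemma right_symmetric_ev:
  assumes f: "f \<in> total R" and g: "g \<in> R p" and h: "h \<in> R r"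
  shows "level.ev2 q X Y (\<lambda>i j. pr q (star (star f g i) h j))
      - level.ev2 q Y (X + Y) (\<lambda>i j. pr q (star f (star g h i) j)) =
    scaleq (koszul_sign p r) (level.ev2 q Y X (\<lambda>i j. pr q (star (star f h i) g j))
      - level.ev2 q X (X + Y) (\<lambda>i j. pr q (star f (star h g i) j)))"
proof -
  have gt: "g \<in> total R" "h \<in> total R" using g h in_total by blast+
  note t = f gt star_total
  let ?R = "\<lambda>g h i j. pr q (star f (star g h i) j)" and ?L = "\<lambda>g h i j. pr q (star (star f g i) h j)"
  note p = polynomial2_triple[OF f gt] polynomial2_triple[OF f gt(2,1)]
  note ps = p level.polynomial2_expand_sum[OF p(5)] level.polynomial2_expand_sum[OF p(13)]
  have e: "pr q (star (star f g a) h b) - expand_sum scaleq (?R g h) b a =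
      scaleq (koszul_sign p r) (pr q (star (star f h b) g a) - expand_sum scaleq (?R h g) a b)" for a b
    using arg_cong[OF right_symmetric[OF f g h, of a b], of "pr q"] t
    by (simp add: pr_diff pr_scale total_diff expand_sum_total pr_expand_sum)
  have "level.ev2 q X Y (?L g h) - level.ev2 q Y (X + Y) (?R g h) =
      level.ev2 q X Y (?L g h) - level.ev2 q X Y (\<lambda>a b. expand_sum scaleq (?R g h) b a)"
    using level.ev2_expand_sum[OF p(5), where X = X and Y = Y]
      level.ev2_swap[OF ps(17), where X = Y and Y = X] by simp
  also have "\<dots> = level.ev2 q X Y (\<lambda>a b. ?L g h a b - expand_sum scaleq (?R g h) b a)"
    using ps level.polynomial2_flip by (subst level.ev2_diff) auto
  also have "\<dots> = level.ev2 q X Y (\<lambda>a b. scaleq (koszul_sign p r) (?L h g b a - expand_sum scaleq (?R h g) a b))"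
    by (simp only: e)
  also have "\<dots> = scaleq (koszul_sign p r) (level.ev2 q X Y (\<lambda>a b. ?L h g b a) - level.ev2 q X Y (expand_sum scaleq (?R h g)))"
    using ps level.polynomial2_flip[OF p(9)]
    by (subst level.ev2_scale) (auto intro: level.polynomial2_diff simp: level.ev2_diff)
  also have "\<dots> = scaleq (koszul_sign p r) (level.ev2 q Y X (?L h g) - level.ev2 q X (X + Y) (?R h g))"
    using level.ev2_expand_sum[OF p(13), where X = Y and Y = X] level.ev2_swap[OF p(9), where X = Y and Y = X]
    by (simp add: add.commute)
  finally show ?thesis .
qed

text \<open>
  On homogeneous elements the last summand turns the sign of the middle one exactly when both
  arguments are odd, which is the Koszul sign.
\<close>

definition bracket :: "'r \<Rightarrow> 'r \<Rightarrow> nat \<Rightarrow> 'r" where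
  "bracket f g k = dstar f g k - star g f k + scale 2 (star (odd_part R g) (odd_part R f) k)"

lemma bracket_homogeneous:
  assumes f: "f \<in> R p" and g: "g \<in> R r"
  shows "bracket f g k = dstar f g k - scale (koszul_sign p r) (star g f k)"
proof -
  have t: "f \<in> total R" "g \<in> total R" using f g in_total by blast+
  have z: "star x 0 k = 0" "star 0 x k = 0" if "x \<in> total R" for x
    using star_scale_right[OF that total_0, of 0 k] star_scale_left[OF total_0 that, of 0 k] by simp_all
  have 2: "scale 2 x = x + x" for x
    using scale_left_distrib[of 1 1 x] by simp
  show ?thesis
    unfolding bracket_def odd_part_component[OF f] odd_part_component[OF g] koszul_sign_def
    using t z total_0 by (simp add: 2)
qed

lemma bracket_total: "f \<in> total R \<Longrightarrow> g \<in> total R \<Longrightarrow> bracket f g k \<in> total R"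
  unfolding bracket_def
  by (intro total_add total_diff total_scale dstar_total star_total odd_part_total)

lemma bracket_component: "f \<in> R p \<Longrightarrow> g \<in> R r \<Longrightarrow> bracket f g k \<in> R (p + r)"
  using bracket_homogeneous[of f p g r k] dstar_component[of f p g r k] star_component[of g r f p k]
  by (simp only: add.commute[of r p] component_diff component_scale)

lemma bracket_add_left:
  "f \<in> total R \<Longrightarrow> f' \<in> total R \<Longrightarrow> g \<in> total R \<Longrightarrow>
    bracket (f + f') g k = bracket f g k + bracket f' g k"
  by (simp add: bracket_def dstar_add_left star_add_right odd_part_add odd_part_total
      scale_right_distrib algebra_simps)

lemma bracket_add_right:
  "f \<in> total R \<Longrightarrow> g \<in> total R \<Longrightarrow> g' \<in> total R \<Longrightarrow>
    bracket f (g + g') k = bracket f g k + bracket f g' k"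
  by (simp add: bracket_def dstar_add_right star_add_left odd_part_add odd_part_total
      scale_right_distrib algebra_simps)

lemma bracket_scale_left:
  "f \<in> total R \<Longrightarrow> g \<in> total R \<Longrightarrow> bracket (scale c f) g k = scale c (bracket f g k)"
  by (simp add: bracket_def dstar_scale_left star_scale_right odd_part_scale odd_part_total
      scale_right_distrib scale_right_diff_distrib mult.commute)

lemma bracket_scale_right:
  "f \<in> total R \<Longrightarrow> g \<in> total R \<Longrightarrow> bracket f (scale c g) k = scale c (bracket f g k)"
  by (simp add: bracket_def dstar_scale_right star_scale_left odd_part_scale odd_part_total
      scale_right_distrib scale_right_diff_distrib mult.commute)

lemma odd_part_D:
  assumes "x \<in> total R"
  shows "odd_part R (D x) = D (odd_part R x)"
proof -
  have "D x = D (even_part R x) + D (odd_part R x)"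
    using parts[OF assms] D_add in_total by metis
  then show ?thesis
    using odd_part_sum[of "D (even_part R x)" "D (odd_part R x)"] parts[OF assms] D_component by metis
qed

lemma bracket_D_left:
  assumes "f \<in> total R" "g \<in> total R"
  shows "bracket (D f) g k = - times_var (bracket f g) k"
  using assms
  by (cases k) (simp_all add: bracket_def dstar_D_left star_D_right odd_part_D odd_part_total
      times_var_0 times_var_Suc)

lemma bracket_D_right:
  assumes "f \<in> total R" "g \<in> total R"
  shows "bracket f (D g) k = times_var (bracket f g) k + D (bracket f g k)"
proof -
  have "D (bracket f g k) = D (dstar f g k) - D (star g f k) + scale 2 (D (star (odd_part R g) (odd_part R f) k))"
  proof -
    have *: "D (x - y + z) = D x - D y + D z" if "x \<in> total R" "y \<in> total R" "z \<in> total R" for x y z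
      using that D_add[of "x - y" z] D_add[of "x - y" y] total_diff by simp
    show ?thesis using assms
      by (simp add: bracket_def * dstar_total star_total odd_part_total total_scale D_scale)
  qed
  then show ?thesis using assms
    by (cases k) (simp_all add: bracket_def dstar_D_right star_D_left odd_part_D odd_part_total
      times_var_0 times_var_Suc scale_right_distrib algebra_simps)
qed

lemma pr_bracket_polynomial:
  assumes "f \<in> total R" "g \<in> total R"
  shows "level.polynomial q (\<lambda>k. pr q (bracket f g k))"
  using assms
  by (simp add: bracket_def pr_add pr_diff pr_scale total_diff total_scale dstar_total star_total
      odd_part_total level.polynomial_add level.polynomial_diff level.polynomial_scale
      pr_dstar_polynomial pr_star_polynomial)

text \<open>
  Exchanging the two terms of the bracket is the substitution of \<open>- \<lambda> - \<partial>\<close>, an involution.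
\<close>

lemma bracket_skew:
  assumes f: "f \<in> R p" and g: "g \<in> R r"
  shows "pr q (bracket f g k) =
    - scaleq (koszul_sign p r) (subst_poly scaleq (Dq q) (\<lambda>k. pr q (bracket g f k)) k)"
proof -
  let ?e = "koszul_sign p r :: 'k"
  have t: "f \<in> total R" "g \<in> total R" using f g in_total by blast+
  note p = pr_bracket_polynomial[OF t] pr_bracket_polynomial[OF t(2,1)] pr_star_polynomial[OF t]
    pr_star_polynomial[OF t(2,1)] pr_dstar_polynomial[OF t] pr_dstar_polynomial[OF t(2,1)]
  have ev: "level.ev q X (\<lambda>k. pr q (bracket f g k)) =
      level.ev q (- X - del) (\<lambda>k. pr q (star f g k)) - scaleq ?e (level.ev q X (\<lambda>k. pr q (star g f k)))" for X
    using t p by (simp add: bracket_homogeneous[OF f g] pr_diff pr_scale dstar_total star_total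
      total_scale level.ev_diff level.ev_scale level.polynomial_scale ev_dstar)
  have ev': "level.ev q X (\<lambda>k. pr q (bracket g f k)) =
      level.ev q (- X - del) (\<lambda>k. pr q (star g f k)) - scaleq ?e (level.ev q X (\<lambda>k. pr q (star f g k)))" for X
    using t p by (simp add: bracket_homogeneous[OF g f] pr_diff pr_scale dstar_total star_total
      total_scale level.ev_diff level.ev_scale level.polynomial_scale ev_dstar koszul_sign_commute[of r p])
  have "(\<lambda>k. pr q (bracket f g k)) =
      (\<lambda>k. - scaleq ?e (subst_poly scaleq (Dq q) (\<lambda>k. pr q (bracket g f k)) k))"
  proof (rule level.polynomial_eqI[OF infinite_UNIV_char_0])
    fix s
    have "level.ev q [:s:] (\<lambda>k. - scaleq ?e (subst_poly scaleq (Dq q) (\<lambda>k. pr q (bracket g f k)) k)) =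
        - scaleq ?e (level.ev q (- [:s:] - del) (\<lambda>k. pr q (bracket g f k)))"
      using p by (simp add: level.ev_uminus level.ev_scale level.polynomial_scale
        level.polynomial_subst_poly level.ev_subst_poly)
    also have "\<dots> = level.ev q [:s:] (\<lambda>k. pr q (bracket f g k))"
      unfolding ev ev' by (simp add: level.scale_right_diff_distrib koszul_sign_square)
    finally show "level.ev q [:s:] (\<lambda>k. pr q (bracket f g k)) =
      level.ev q [:s:] (\<lambda>k. - scaleq ?e (subst_poly scaleq (Dq q) (\<lambda>k. pr q (bracket g f k)) k))" by simp
  qed (use p in \<open>auto intro!: level.polynomial_uminus level.polynomial_scale level.polynomial_subst_poly\<close>)
  then show ?thesis by (rule fun_cong)
qed


lemma expand_sum_add:
  "expand_sum scale (\<lambda>k l. c k l + d k l) i j = expand_sum scale c i j + expand_sum scale d i j"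
  by (simp add: expand_sum_def scale_right_distrib sum.distrib)

text \<open>
  At the point \<open>(X, Y)\<close> each of the twelve triple products in the identity is one made from \<open>*\<^sub>\<lambda>\<close> alone,
  at a point with coordinates among \<open>X\<close>, \<open>Y\<close> and \<open>Z = - X - Y - \<partial>\<close>, their sums in the case of the
  products nested on the right. Grouped by the element in the leftmost place they cancel by the
  right-symmetric identity: for \<open>h\<close> at \<open>(X, Y)\<close>, for \<open>f\<close> at \<open>(Y, Z)\<close>, for \<open>g\<close> at \<open>(X, Z)\<close>.
\<close>

lemma jacobi_homogeneous:
  assumes f: "f \<in> R p" and g: "g \<in> R r" and h: "h \<in> R s"
  shows "bracket f (bracket g h j) i - scale (koszul_sign p r) (bracket g (bracket f h i) j) =
    expand_sum scale (\<lambda>k. bracket (bracket f g k) h) i j"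
proof -
  let ?e = "koszul_sign :: bit \<Rightarrow> bit \<Rightarrow> 'k"
  have t: "f \<in> total R" "g \<in> total R" "h \<in> total R" using f g h in_total by blast+
  note tt = t star_total dstar_total bracket_total total_add total_diff total_scale
  note poly = polynomial2_triple[OF t(1,2,3)] polynomial2_triple[OF t(1,3,2)]
    polynomial2_triple[OF t(2,1,3)] polynomial2_triple[OF t(2,3,1)]
    polynomial2_triple[OF t(3,1,2)] polynomial2_triple[OF t(3,2,1)]
  note poly_flip = poly[THEN level.polynomial2_flip]
  have dd: "dstar x (a - scale c b) k = dstar x a k - scale c (dstar x b k)"
    "star (a - scale c b) x k = star a x k - scale c (star b x k)"
    "dstar (a - scale c b) x k = dstar a x k - scale c (dstar b x k)"
    "star x (a - scale c b) k = star x a k - scale c (star x b k)"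
    if "x \<in> total R" "a \<in> total R" "b \<in> total R" for x a b c k
  proof -
    have m: "a - scale c b = a + scale (- c) b" by simp
    show "dstar x (a - scale c b) k = dstar x a k - scale c (dstar x b k)"
      "star (a - scale c b) x k = star a x k - scale c (star b x k)"
      "dstar (a - scale c b) x k = dstar a x k - scale c (dstar b x k)"
      "star x (a - scale c b) k = star x a k - scale c (star x b k)"
      unfolding m using that
      by (simp_all only: dstar_add_right dstar_add_left star_add_left star_add_right total_scale
          dstar_scale_left dstar_scale_right star_scale_left star_scale_right) simp_all
  qed
  have nested: "bracket x (bracket y z j) i =
      dstar x (dstar y z j) i - scale (?e b c) (dstar x (star z y j) i)
      - scale (?e a (b + c)) (star (dstar y z j) x i - scale (?e b c) (star (star z y j) x i))"
    if "x \<in> R a" "y \<in> R b" "z \<in> R c" for x y z a b c i j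
    using that in_total[OF that(1)] in_total[OF that(2)] in_total[OF that(3)]
    unfolding bracket_homogeneous[OF that(1) bracket_component[OF that(2,3)]]
    unfolding bracket_homogeneous[OF that(2,3)]
    by (simp only: dd dstar_total star_total)
  have outer: "bracket (bracket f g k) h l =
      dstar (dstar f g k) h l - scale (?e p r) (dstar (star g f k) h l)
      - scale (?e (p + r) s) (star h (dstar f g k) l - scale (?e p r) (star h (star g f k) l))" for k l
    using t unfolding bracket_homogeneous[OF bracket_component[OF f g] h]
    unfolding bracket_homogeneous[OF f g]
    by (simp only: dd dstar_total star_total)
  show ?thesis
  proof (rule pr_injective)
    fix q
    let ?L = "\<lambda>f g h X Y. level.ev2 q X Y (\<lambda>i j. pr q (star (star f g i) h j))"
    let ?R = "\<lambda>f g h X Y. level.ev2 q X Y (\<lambda>i j. pr q (star f (star g h i) j))"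
    let ?s = scaleq
    define c1 where "c1 i j = pr q (bracket f (bracket g h j) i)" for i j
    define c2 where "c2 i j = pr q (bracket g (bracket f h i) j)" for i j
    define c3 where "c3 i j = pr q (bracket (bracket f g i) h j)" for i j
    have c1: "c1 = (\<lambda>i j.
        pr q (dstar f (dstar g h j) i) - ?s (?e r s) (pr q (dstar f (star h g j) i))
        - ?s (?e p (r + s)) (pr q (star (dstar g h j) f i) - ?s (?e r s) (pr q (star (star h g j) f i))))"
      unfolding c1_def[abs_def] nested[OF f g h] by (simp add: pr_diff pr_scale tt)
    have c2: "c2 = (\<lambda>i j.
        pr q (dstar g (dstar f h i) j) - ?s (?e p s) (pr q (dstar g (star h f i) j))
        - ?s (?e r (p + s)) (pr q (star (dstar f h i) g j) - ?s (?e p s) (pr q (star (star h f i) g j))))"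
      unfolding c2_def[abs_def] nested[OF g f h] by (simp add: pr_diff pr_scale tt)
    have c3: "c3 = (\<lambda>i j.
        pr q (dstar (dstar f g i) h j) - ?s (?e p r) (pr q (dstar (star g f i) h j))
        - ?s (?e (p + r) s) (pr q (star h (dstar f g i) j) - ?s (?e p r) (pr q (star h (star g f i) j))))"
      unfolding c3_def[abs_def] outer by (simp add: pr_diff pr_scale tt)
    have p1: "level.polynomial2 q c1" and p2: "level.polynomial2 q c2" and p3: "level.polynomial2 q c3"
      unfolding c1 c2 c3 by (intro level.polynomial2_diff level.polynomial2_scale poly poly_flip)+
    have e1: "level.ev2 q X Y c1 =
        ?R f g h (- X - Y - del) (- X - del) - ?s (?e r s) (?R f h g Y (- X - del))
        - ?s (?e p (r + s)) (?L g h f (- X - Y - del) X - ?s (?e r s) (?L h g f Y X))" for X Y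
    proof -
      have "level.ev2 q X Y c1 = level.ev2 q Y X (\<lambda>j i. c1 i j)" by (rule level.ev2_swap[OF p1])
      also have "\<dots> = ?R f g h (- Y - X - del) (- X - del) - ?s (?e r s) (?R f h g Y (- X - del))
        - ?s (?e p (r + s)) (?L g h f (- Y - X - del) X - ?s (?e r s) (?L h g f Y X))"
        unfolding c1
        by (simp only: level.ev2_diff level.ev2_scale level.polynomial2_diff level.polynomial2_scale poly
            ev2_left[OF t(2,3,1)] ev2_right[OF t(1,2,3)] ev2_right[OF t(1,3,2)])
      finally show ?thesis by (simp only: minus_diff_commute[of Y X])
    qed
    have e2: "level.ev2 q X Y c2 =
        ?R g f h (- X - Y - del) (- Y - del) - ?s (?e p s) (?R g h f X (- Y - del))
        - ?s (?e r (p + s)) (?L f h g (- X - Y - del) Y - ?s (?e p s) (?L h f g X Y))" for X Y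
      unfolding c2
      by (simp only: level.ev2_diff level.ev2_scale level.polynomial2_diff level.polynomial2_scale poly
          ev2_left[OF t(1,3,2)] ev2_right[OF t(2,1,3)] ev2_right[OF t(2,3,1)])
    have e3: "level.ev2 q X Y (expand_sum scaleq c3) =
        ?L f g h Y (- X - Y - del) - ?s (?e p r) (?L g f h X (- X - Y - del))
        - ?s (?e (p + r) s) (?R h f g Y (X + Y) - ?s (?e p r) (?R h g f X (X + Y)))" for X Y
    proof -
      have "level.ev2 q X Y (expand_sum scaleq c3) = level.ev2 q X (X + Y) c3"
        using level.ev2_expand_sum[OF p3, where X = Y and Y = X] by (simp only: add.commute[of Y X])
      also have "\<dots> = ?L f g h (X + Y - X) (- (X + Y) - del) - ?s (?e p r) (?L g f h X (- (X + Y) - del))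
        - ?s (?e (p + r) s) (?R h f g (X + Y - X) (X + Y) - ?s (?e p r) (?R h g f X (X + Y)))"
        unfolding c3
        by (simp only: level.ev2_diff level.ev2_scale level.polynomial2_diff level.polynomial2_scale poly
            ev2_left[OF t(1,2,3)] ev2_left[OF t(2,1,3)] ev2_right[OF t(3,1,2)])
      also have "X + Y - X = Y" by (rule add_diff_cancel_left')
      also have "- (X + Y) - del = - X - Y - del" by (simp only: minus_add_distrib diff_conv_add_uminus)
      finally show ?thesis .
    qed
    have "(\<lambda>i j. c1 i j - ?s (?e p r) (c2 i j)) = expand_sum scaleq c3"
    proof (rule level.polynomial2_eqI[OF infinite_UNIV_char_0])
      fix x y :: 'k
      define X where "X = [:x:]"
      define Y where "Y = [:y:]"
      define Z where "Z = - X - Y - del"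
      have z: "Y + Z = - X - del" "X + Z = - Y - del" unfolding Z_def by (simp_all only: algebra_simps) simp_all
      have s1: "?L h f g X Y = ?R h f g Y (X + Y) + ?s (?e p r) (?L h g f Y X - ?R h g f X (X + Y))"
        using right_symmetric_ev[OF t(3) f g, of q X Y] by (simp add: diff_eq_eq add.commute)
      have s2: "?L f g h Y Z = ?R f g h Z (- X - del) + ?s (?e r s) (?L f h g Z Y - ?R f h g Y (- X - del))"
        using right_symmetric_ev[OF t(1) g h, of q Y Z] by (simp add: diff_eq_eq add.commute z)
      have s3: "?L g f h X Z = ?R g f h Z (- Y - del) + ?s (?e p s) (?L g h f Z X - ?R g h f X (- Y - del))"
        using right_symmetric_ev[OF t(2) f h, of q X Z] by (simp add: diff_eq_eq add.commute z)
      have "level.ev2 q X Y (\<lambda>i j. c1 i j - ?s (?e p r) (c2 i j)) =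
          level.ev2 q X Y c1 - ?s (?e p r) (level.ev2 q X Y c2)"
        using p1 p2 by (simp add: level.ev2_diff level.ev2_scale level.polynomial2_scale)
      also have "\<dots> = level.ev2 q X Y (expand_sum scaleq c3)"
        unfolding e1 e2 e3 Z_def[symmetric] s1 s2 s3 koszul_sign_add_left koszul_sign_add_right
        using bit_cases[of p] bit_cases[of r] bit_cases[of s]
        by (elim disjE) (simp_all add: koszul_sign_def algebra_simps)
      finally show "level.ev2 q [:x:] [:y:] (\<lambda>i j. c1 i j - ?s (?e p r) (c2 i j)) =
          level.ev2 q [:x:] [:y:] (expand_sum scaleq c3)"
        unfolding X_def Y_def .
    qed (intro level.polynomial2_diff level.polynomial2_scale level.polynomial2_expand_sum p1 p2 p3)+
    then have "c1 i j - ?s (?e p r) (c2 i j) = expand_sum scaleq c3 i j" by (rule fun_cong[THEN fun_cong])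
    moreover have "pr q (expand_sum scale (\<lambda>k. bracket (bracket f g k) h) i j) = expand_sum scaleq c3 i j"
      unfolding c3_def[abs_def] by (intro pr_expand_sum tt)
    ultimately show "pr q (bracket f (bracket g h j) i - scale (koszul_sign p r) (bracket g (bracket f h i) j)) =
        pr q (expand_sum scale (\<lambda>k. bracket (bracket f g k) h) i j)"
      by (simp add: pr_diff pr_scale tt c1_def c2_def)
  qed (auto intro!: total_diff total_scale bracket_total expand_sum_total t)
qed

lemma jacobi:
  assumes f: "f \<in> R p" and g: "g \<in> R r" and h: "h \<in> total R"
  shows "bracket f (bracket g h j) i - scale (koszul_sign p r) (bracket g (bracket f h i) j) =
    expand_sum scale (\<lambda>k. bracket (bracket f g k) h) i j"
proof -
  obtain h0 h1 where hh: "h0 \<in> R 0" "h1 \<in> R 1" "h = h0 + h1" using h unfolding total_def by blast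
  have t: "f \<in> total R" "g \<in> total R" "h0 \<in> total R" "h1 \<in> total R" using f g hh in_total by blast+
  have "(\<lambda>k. bracket (bracket f g k) h) = (\<lambda>k l. bracket (bracket f g k) h0 l + bracket (bracket f g k) h1 l)"
    using t by (intro ext) (simp add: hh(3) bracket_add_right bracket_total)
  then show ?thesis
    using jacobi_homogeneous[OF f g hh(1), of j i] jacobi_homogeneous[OF f g hh(2), of j i] t
    by (simp add: hh(3) bracket_add_right bracket_total expand_sum_add scale_right_distrib
      algebra_simps)
qed

theorem pro_Lie_bracket_bracket:
  assumes "\<And>q. diff_hom scaleq (Rq (Suc q)) (Dq (Suc q)) scaleq (Rq q) (Dq q) (tr q)"
  shows "pro_Lie_bracket scale R D bracket scaleq Rq Dq tr pr"
proof unfold_locales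
  show "even_bilinear_series scale R R R bracket"
    unfolding even_bilinear_series_def
    by (intro conjI allI ballI; rule bracket_component bracket_add_left bracket_add_right
        bracket_scale_left bracket_scale_right; assumption)
  show "bracket (D a) b k = - times_var (bracket a b) k" if "a \<in> total R" "b \<in> total R" for a b k
    using that by (rule bracket_D_left)
  show "bracket a (D b) k = times_var (bracket a b) k + D (bracket a b k)"
    if "a \<in> total R" "b \<in> total R" for a b k
    using that by (rule bracket_D_right)
  show "bracket a (bracket b c j) i - scale (koszul_sign p r) (bracket b (bracket a c i) j) =
      expand_sum scale (\<lambda>k. bracket (bracket a b k) c) i j"
    if "a \<in> R p" "b \<in> R r" "c \<in> total R" for a b c p r i j
    using that by (rule jacobi)
  show "diff_hom scaleq (Rq (Suc q)) (Dq (Suc q)) scaleq (Rq q) (Dq q) (tr q)" for q by fact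
  show "diff_hom scale R D scaleq (Rq q) (Dq q) (pr q)" for q by (rule pr_diff_hom)
  show "finite {k. pr q (bracket a b k) \<noteq> 0}" if "a \<in> total R" "b \<in> total R" for a b q
    using pr_bracket_polynomial[OF that] by (simp add: level.polynomial_iff)
  show "pr q (bracket a b k) =
      - scaleq (koszul_sign p r) (subst_poly scaleq (Dq q) (\<lambda>k. pr q (bracket b a k)) k)"
    if "a \<in> R p" "b \<in> R r" for a b p r q k
    using that by (rule bracket_skew)
qed

end

section \<open>Permutations and shuffles\<close>

text \<open>
  At the least point where two such maps differ, the smaller of the two values would be missed by the
  map with the larger one.
\<close>

lemma strict_mono_on_image_unique:
  fixes f g :: "nat \<Rightarrow> nat"
  assumes f: "strict_mono_on A f" and g: "strict_mono_on A g" and im: "f ` A = g ` A"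
    and x: "x \<in> A"
  shows "f x = g x"
  using x
proof (induction x rule: less_induct)
  case (less x)
  have aux: "\<not> u x < v x"
    if u: "strict_mono_on A u" and v: "strict_mono_on A v" and im': "u ` A = v ` A"
      and IH: "\<And>y. y < x \<Longrightarrow> y \<in> A \<Longrightarrow> u y = v y" for u v :: "nat \<Rightarrow> nat"
  proof
    assume lt: "u x < v x"
    obtain y where y: "y \<in> A" "u x = v y" using im' less.prems by (metis imageE imageI)
    have "y < x"
    proof (rule ccontr)
      assume "\<not> y < x"
      then have "v x \<le> v y" using strict_mono_onD[OF v less.prems y(1)] by (cases "x = y") auto
      then show False using lt y by simp
    qed
    then have "u y = u x" using IH y by simp
    then show False using strict_mono_onD[OF u y(1) less.prems \<open>y < x\<close>] by simp
  qed
  show ?case using aux[OF f g im] aux[OF g f] im less.IH by (metis linorder_neqE_nat)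
qed

text \<open>
  The increasing enumerations of \<open>A\<close> and of its image are both indexed by the same initial segment; their
  composite is the required increasing map.
\<close>

lemma sorting_permutation:
  fixes f :: "nat \<Rightarrow> nat"
  assumes fin: "finite A" and inj: "inj_on f A"
  shows "\<exists>\<rho>. \<rho> permutes A \<and> strict_mono_on A (f \<circ> \<rho>)"
proof -
  obtain a where a: "bij_betw a {..<card A} A" "strict_mono_on {..<card A} a"
    using ex_bij_betw_strict_mono_card[OF fin] by blast
  obtain b where b: "bij_betw b {..<card (f ` A)} (f ` A)" "strict_mono_on {..<card (f ` A)} b"
    using ex_bij_betw_strict_mono_card[of "f ` A"] fin by blast
  have card: "card (f ` A) = card A" using inj by (rule card_image)
  let ?i = "inv_into {..<card A} a"
  define \<rho> where "\<rho> x = (if x \<in> A then inv_into A f (b (?i x)) else x)" for x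
  have i: "bij_betw ?i A {..<card A}" using a(1) by (rule bij_betw_inv_into)
  have "bij_betw (inv_into A f \<circ> (b \<circ> ?i)) A A"
    using i b(1) inj card by (metis bij_betw_trans bij_betw_inv_into bij_betw_imageI)
  then have "bij_betw \<rho> A A" by (rule bij_betw_cong[THEN iffD1, rotated]) (simp add: \<rho>_def)
  then have p: "\<rho> permutes A" by (rule bij_imp_permutes) (simp add: \<rho>_def)
  have f\<rho>: "f (\<rho> x) = b (?i x)" if "x \<in> A" for x
  proof -
    have "b (?i x) \<in> f ` A" using that i b(1) card by (metis bij_betwE)
    then show ?thesis using that by (simp add: \<rho>_def f_inv_into_f)
  qed
  have "strict_mono_on A (f \<circ> \<rho>)"
  proof (rule strict_mono_onI)
    fix x y assume xy: "x \<in> A" "y \<in> A" "x < y"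
    have ix: "?i x \<in> {..<card A}" "?i y \<in> {..<card A}" using xy i by (metis bij_betwE)+
    have ax: "a (?i x) = x" "a (?i y) = y" using xy a(1) by (metis bij_betw_inv_into_right)+
    have "?i x < ?i y"
    proof (rule ccontr)
      assume "\<not> ?i x < ?i y"
      then have "a (?i y) \<le> a (?i x)"
        using strict_mono_onD[OF a(2) ix(2,1)] by (cases "?i x = ?i y") auto
      then show False using ax xy by simp
    qed
    then show "(f \<circ> \<rho>) x < (f \<circ> \<rho>) y"
      using strict_mono_onD[OF b(2)] ix card xy by (simp add: f\<rho>)
  qed
  then show ?thesis using p by blast
qed

lemma mem_shuffles_iff:
  "\<sigma> \<in> shuffles (int m) (int n) \<longleftrightarrow>
    \<sigma> permutes {1..m + n} \<and> strict_mono_on {1..m} \<sigma> \<and> strict_mono_on {m + 1..m + n} \<sigma>"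
proof -
  have "nat (int m + int n) = m + n" by (simp add: nat_int_add)
  then show ?thesis by (simp only: shuffles_def nat_int) simp
qed

lemma young_permutes:
  fixes m n :: nat
  assumes 1: "\<rho>1 permutes {1..m}" and 2: "\<rho>2 permutes {m + 1..m + n}"
  shows "\<rho>1 \<circ> \<rho>2 permutes {1..m + n}" "(\<rho>1 \<circ> \<rho>2) ` {1..m} = {1..m}"
proof -
  have "\<rho>2 x = x" if "x \<in> {1..m}" for x
    using that by (intro permutes_not_in[OF 2]) auto
  then have "\<rho>2 ` {1..m} = {1..m}" by (simp only: image_cong[OF refl, of "{1..m}" \<rho>2 "\<lambda>x. x"] image_ident)
  then show "(\<rho>1 \<circ> \<rho>2) ` {1..m} = {1..m}" using permutes_image[OF 1] by (simp only: image_comp[symmetric])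
  have "\<rho>1 permutes {1..m + n}" by (rule permutes_subset[OF 1]) simp
  moreover have "\<rho>2 permutes {1..m + n}" by (rule permutes_subset[OF 2]) simp
  ultimately show "\<rho>1 \<circ> \<rho>2 permutes {1..m + n}" by (rule permutes_compose[rotated])
qed

lemma shuffle_unique:
  assumes s: "\<sigma> \<in> shuffles (int m) (int n)" "\<sigma>' \<in> shuffles (int m) (int n)"
    and im: "\<sigma> ` {1..m} = \<sigma>' ` {1..m}"
  shows "\<sigma> = \<sigma>'"
proof
  fix x
  let ?A = "{1..m}" and ?B = "{m + 1..m + n}" and ?C = "{1..m + n}"
  have p: "\<sigma> permutes ?C" "\<sigma>' permutes ?C" using s by (simp_all only: mem_shuffles_iff)
  have imB: "\<tau> ` ?B = ?C - \<tau> ` ?A" if "\<tau> permutes ?C" for \<tau>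
  proof -
    have "?B = ?C - ?A" by auto
    then have "\<tau> ` ?B = \<tau> ` ?C - \<tau> ` ?A"
      using image_set_diff[OF permutes_inj[OF that], of ?C ?A] by simp
    then show ?thesis using permutes_image[OF that] by simp
  qed
  have imB': "\<sigma> ` ?B = \<sigma>' ` ?B" using imB[OF p(1)] imB[OF p(2)] im by simp
  have "x \<in> ?A \<or> x \<in> ?B \<or> x \<notin> ?C" by auto
  then consider "x \<in> ?A" | "x \<in> ?B" | "x \<notin> ?C" by blast
  then show "\<sigma> x = \<sigma>' x"
  proof cases
    case 1
    show ?thesis by (rule strict_mono_on_image_unique[of ?A]) (use s 1 im in \<open>simp_all only: mem_shuffles_iff\<close>)
  next
    case 2
    show ?thesis by (rule strict_mono_on_image_unique[of ?B]) (use s 2 imB' in \<open>simp_all only: mem_shuffles_iff\<close>)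
  next
    case 3
    then show ?thesis using permutes_not_in[OF p(1) 3] permutes_not_in[OF p(2) 3] by simp
  qed
qed

lemma shuffle_factorization_unique:
  assumes s: "\<sigma> \<in> shuffles (int m) (int n)" "\<sigma>' \<in> shuffles (int m) (int n)"
    and r: "\<rho>1 permutes {1..m}" "\<rho>1' permutes {1..m}"
      "\<rho>2 permutes {m + 1..m + n}" "\<rho>2' permutes {m + 1..m + n}"
    and e: "\<sigma> \<circ> (\<rho>1 \<circ> \<rho>2) = \<sigma>' \<circ> (\<rho>1' \<circ> \<rho>2')"
  shows "\<sigma> = \<sigma>'" "\<rho>1 = \<rho>1'" "\<rho>2 = \<rho>2'"
proof -
  let ?A = "{1..m}" and ?B = "{m + 1..m + n}"
  have "\<sigma> ` ?A = \<sigma> ` ((\<rho>1 \<circ> \<rho>2) ` ?A)" by (simp only: young_permutes(2)[OF r(1,3)])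
  also have "\<dots> = \<sigma>' ` ((\<rho>1' \<circ> \<rho>2') ` ?A)" using e by (simp only: image_comp)
  also have "\<dots> = \<sigma>' ` ?A" by (simp only: young_permutes(2)[OF r(2,4)])
  finally show \<sigma>: "\<sigma> = \<sigma>'" by (rule shuffle_unique[OF s])
  have "inj \<sigma>'" using s(2) permutes_inj unfolding mem_shuffles_iff by blast
  then have rr: "\<rho>1 (\<rho>2 x) = \<rho>1' (\<rho>2' x)" for x
    using fun_cong[OF e, of x] unfolding \<sigma> by (simp add: inj_eq)
  have "\<rho>1 x = \<rho>1' x" for x
  proof (cases "x \<in> ?A")
    case True
    then have "x \<notin> ?B" by simp
    then show ?thesis using rr[of x] permutes_not_in[OF r(3)] permutes_not_in[OF r(4)] by simp
  next
    case False
    then show ?thesis using permutes_not_in[OF r(1) False] permutes_not_in[OF r(2) False] by simp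
  qed
  then show 1: "\<rho>1 = \<rho>1'" by blast
  show "\<rho>2 = \<rho>2'" using rr permutes_inj[OF r(2)] unfolding 1 by (simp add: inj_eq fun_eq_iff)
qed

lemma shuffle_factorization_exists:
  assumes \<pi>: "\<pi> permutes {1..m + n}"
  shows "\<exists>\<sigma>\<in>shuffles (int m) (int n). \<exists>\<rho>1 \<rho>2. \<rho>1 permutes {1..m} \<and> \<rho>2 permutes {m + 1..m + n} \<and>
    \<pi> = \<sigma> \<circ> (\<rho>1 \<circ> \<rho>2)"
proof -
  let ?A = "{1..m}" and ?B = "{m + 1..m + n}" and ?C = "{1..m + n}"
  obtain \<rho>1 where 1: "\<rho>1 permutes ?A" "strict_mono_on ?A (\<pi> \<circ> \<rho>1)"
    using sorting_permutation[of ?A \<pi>] permutes_inj_on[OF \<pi>] by blast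
  obtain \<rho>2 where 2: "\<rho>2 permutes ?B" "strict_mono_on ?B (\<pi> \<circ> \<rho>2)"
    using sorting_permutation[of ?B \<pi>] permutes_inj_on[OF \<pi>] by blast
  define \<sigma> where "\<sigma> = \<pi> \<circ> (\<rho>2 \<circ> \<rho>1)"
  have a: "\<sigma> x = (\<pi> \<circ> \<rho>1) x" if "x \<in> ?A" for x
  proof -
    have "\<rho>1 x \<in> ?A" using that permutes_in_image[OF 1(1)] by blast
    then have "\<rho>1 x \<notin> ?B" by simp
    then show ?thesis using permutes_not_in[OF 2(1)] by (simp add: \<sigma>_def)
  qed
  have b: "\<sigma> x = (\<pi> \<circ> \<rho>2) x" if "x \<in> ?B" for x
  proof -
    have "x \<notin> ?A" using that by simp
    then show ?thesis using permutes_not_in[OF 1(1)] by (simp add: \<sigma>_def)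
  qed
  have m1: "strict_mono_on ?A \<sigma>"
    by (rule strict_mono_onI) (simp only: a strict_mono_onD[OF 1(2)])
  have m2: "strict_mono_on ?B \<sigma>"
    by (rule strict_mono_onI) (simp only: b strict_mono_onD[OF 2(2)])
  have "\<rho>1 permutes ?C" by (rule permutes_subset[OF 1(1)]) simp
  moreover have "\<rho>2 permutes ?C" by (rule permutes_subset[OF 2(1)]) simp
  ultimately have "\<sigma> permutes ?C" unfolding \<sigma>_def by (intro permutes_compose \<pi>)
  then have s: "\<sigma> \<in> shuffles (int m) (int n)" using m1 m2 unfolding mem_shuffles_iff by blast
  have "\<pi> = \<sigma> \<circ> (inv \<rho>1 \<circ> inv \<rho>2)"
    using permutes_inverses(1)[OF 1(1)] permutes_inverses(1)[OF 2(1)] by (simp add: \<sigma>_def fun_eq_iff)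
  then show ?thesis using s permutes_inv[OF 1(1)] permutes_inv[OF 2(1)] by blast
qed

text \<open>
  Shuffles represent the cosets of the Young subgroup \<open>S\<^sub>m \<times> S\<^sub>n\<close> in \<open>S\<^sub>m\<^sub>+\<^sub>n\<close>: sorting the values of a
  permutation on the two blocks yields the factorisation, and the image of the first block determines
  the shuffle.
\<close>

lemma bij_betw_shuffles:
  "bij_betw (\<lambda>(\<sigma>, \<rho>1, \<rho>2). \<sigma> \<circ> (\<rho>1 \<circ> \<rho>2))
    (shuffles (int m) (int n) \<times> {\<rho>. \<rho> permutes {1..m}} \<times> {\<rho>. \<rho> permutes {m + 1..m + n}})
    {\<pi>. \<pi> permutes {1..m + n}}"
  (is "bij_betw ?f ?X ?Y")
proof (rule bij_betw_imageI)
  show "inj_on ?f ?X"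
  proof (rule inj_onI)
    fix u v assume uv: "u \<in> ?X" "v \<in> ?X" "?f u = ?f v"
    obtain \<sigma> \<rho>1 \<rho>2 \<sigma>' \<rho>1' \<rho>2' where e: "u = (\<sigma>, \<rho>1, \<rho>2)" "v = (\<sigma>', \<rho>1', \<rho>2')"
      by (metis prod_cases3)
    show "u = v"
      using shuffle_factorization_unique[of \<sigma> m n \<sigma>' \<rho>1 \<rho>1' \<rho>2 \<rho>2'] uv unfolding e by force
  qed
  show "?f ` ?X = ?Y"
  proof (intro equalityI subsetI)
    fix \<pi> assume "\<pi> \<in> ?f ` ?X"
    then obtain \<sigma> \<rho>1 \<rho>2 where *: "\<pi> = \<sigma> \<circ> (\<rho>1 \<circ> \<rho>2)" "\<sigma> \<in> shuffles (int m) (int n)"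
      "\<rho>1 permutes {1..m}" "\<rho>2 permutes {m + 1..m + n}" by auto
    have "\<sigma> permutes {1..m + n}" using *(2) unfolding mem_shuffles_iff by blast
    then show "\<pi> \<in> ?Y" using permutes_compose[OF young_permutes(1)[OF *(3,4)]] *(1) by blast
  next
    fix \<pi> assume "\<pi> \<in> ?Y"
    then obtain \<sigma> \<rho>1 \<rho>2 where "\<sigma> \<in> shuffles (int m) (int n)" "\<rho>1 permutes {1..m}"
      "\<rho>2 permutes {m + 1..m + n}" "\<pi> = \<sigma> \<circ> (\<rho>1 \<circ> \<rho>2)"
      using shuffle_factorization_exists[of \<pi> m n] by blast
    then show "\<pi> \<in> ?f ` ?X" by (intro image_eqI[of _ _ "(\<sigma>, \<rho>1, \<rho>2)"]) auto
  qed
qed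

text \<open>
  The long block is moved onto the places from \<open>\<sigma> i\<close> to \<open>\<sigma> i + m - 1\<close>; all other places go strictly below
  or strictly above it.
\<close>

lemma perm_circ_permutes:
  assumes i: "i \<in> {1..n}" and \<sigma>: "\<sigma> permutes {1..n}" and \<tau>: "\<tau> permutes {1..m}"
  shows "perm_circ m i \<sigma> \<tau> permutes {1..m + n - 1}"
proof -
  have \<sigma>r: "x \<in> {1..n} \<Longrightarrow> \<sigma> x \<in> {1..n}" for x using permutes_in_image[OF \<sigma>] by blast
  have \<tau>r: "x \<in> {1..m} \<Longrightarrow> \<tau> x \<in> {1..m}" for x using permutes_in_image[OF \<tau>] by blast
  have \<sigma>i: "\<sigma> x = \<sigma> y \<longleftrightarrow> x = y" and \<tau>i: "\<tau> x = \<tau> y \<longleftrightarrow> x = y" for x y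
    using permutes_inj[OF \<sigma>] permutes_inj[OF \<tau>] by (simp_all add: inj_eq)
  define pc where "pc = perm_circ m i \<sigma> \<tau>"
  define num where "num a = (if a < i then a else a + 1 - m)" for a
  have inb: "pc a = \<sigma> i - 1 + \<tau> (a - i + 1)" if "i \<le> a" "a < i + m" for a
    using that by (simp add: pc_def perm_circ_def)
  have out: "pc a = (if \<sigma> (num a) < \<sigma> i then \<sigma> (num a) else \<sigma> (num a) + m - 1)" if "\<not> (i \<le> a \<and> a < i + m)" for a
    using that by (auto simp: pc_def perm_circ_def num_def Let_def)
  have num: "num a \<noteq> i" if "\<not> (i \<le> a \<and> a < i + m)" for a
    using that by (auto simp: num_def)
  have inb': "\<sigma> i \<le> pc a \<and> pc a < \<sigma> i + m" if "i \<le> a" "a < i + m" for a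
  proof -
    have "a - i + 1 \<in> {1..m}" using that by auto
    then show ?thesis using \<tau>r[of "a - i + 1"] \<sigma>r[OF i] inb[OF that] by auto
  qed
  have out': "pc a < \<sigma> i \<or> \<sigma> i + m \<le> pc a" if "\<not> (i \<le> a \<and> a < i + m)" for a
    using out[OF that] \<sigma>i[of "num a" i] num[OF that] by auto
  show ?thesis unfolding pc_def[symmetric]
  proof (rule inj_imp_permutes)
    show "inj_on pc {1..m + n - 1}"
    proof (rule inj_onI)
      fix a b assume ab: "a \<in> {1..m + n - 1}" "b \<in> {1..m + n - 1}" "pc a = pc b"
      show "a = b"
      proof (cases "i \<le> a \<and> a < i + m")
        case True
        then have b: "i \<le> b \<and> b < i + m" using inb' out' ab(3) by (metis not_le)
        then have "\<tau> (a - i + 1) = \<tau> (b - i + 1)" using ab(3) inb True by simp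
        then show ?thesis using True b unfolding \<tau>i by linarith
      next
        case False
        then have b: "\<not> (i \<le> b \<and> b < i + m)" using inb' out' ab(3) by (metis not_le)
        have m0: "\<sigma> (num a) \<noteq> 0" "\<sigma> i \<noteq> 0"
          using \<sigma>r[OF i] \<sigma>i[of "num a" 0] permutes_not_in[OF \<sigma>, of 0] ab(1) False i
          by (auto simp: num_def)
        have "\<sigma> (num a) = \<sigma> (num b)"
          using out[OF False] out[OF b] ab(3) \<sigma>i[of "num a" i] \<sigma>i[of "num b" i] num[OF False] num[OF b]
          by (auto split: if_splits)
        then have "num a = num b" using \<sigma>i by simp
        then show ?thesis using False b i by (auto simp: num_def split: if_splits)
      qed
    qed
    show "pc a \<in> {1..m + n - 1}" if a: "a \<in> {1..m + n - 1}" for a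
    proof (cases "i \<le> a \<and> a < i + m")
      case True
      then show ?thesis using inb'[of a] \<sigma>r[OF i] by auto
    next
      case False
      then have "num a \<in> {1..n}" using a i by (auto simp: num_def)
      then show ?thesis using \<sigma>r[of "num a"] \<sigma>r[OF i] out[OF False]
          \<sigma>i[of "num a" i] num[OF False] by auto
    qed
    show "pc a = a" if a: "a \<notin> {1..m + n - 1}" for a
    proof (cases "a = 0")
      case True
      then have "\<not> (i \<le> a \<and> a < i + m)" "num a = 0" using i by (auto simp: num_def)
      moreover have "\<sigma> 0 = 0" using permutes_not_in[OF \<sigma>, of 0] by simp
      ultimately show ?thesis using out[of a] \<sigma>r[OF i] True by auto
    next
      case False
      then have b: "\<not> (i \<le> a \<and> a < i + m)" "num a = a + 1 - m" "n < num a" using a i by (auto simp: num_def)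
      then have "\<sigma> (num a) = num a" using permutes_not_in[OF \<sigma>, of "num a"] by simp
      then show ?thesis using out[OF b(1)] \<sigma>r[OF i] b by auto
    qed
  qed simp
qed

lemma perm_circ_id_left:
  assumes \<tau>: "\<tau> permutes {1..m}"
  shows "perm_circ m 1 id \<tau> = \<tau>"
proof
  fix a
  show "perm_circ m 1 id \<tau> a = \<tau> a"
    using permutes_not_in[OF \<tau>, of a] by (auto simp: perm_circ_def Let_def)
qed

text \<open>
  Every permutation of the inputs of \<open>f\<close> that remain after an insertion into the first one comes from
  a permutation of the inputs of \<open>f\<close> that fixes the first.
\<close>

lemma perm_circ_id_right:
  assumes \<rho>: "\<rho> permutes {m + 1..m + n - 1}" and n: "1 \<le> n"
  shows "\<exists>\<sigma>. \<sigma> permutes {1..n} \<and> \<sigma> 1 = 1 \<and> perm_circ m 1 \<sigma> id = \<rho>"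
proof -
  define \<sigma> where "\<sigma> c = (if c \<in> {2..n} then \<rho> (c + m - 1) + 1 - m else c)" for c
  have r: "\<rho> x \<in> {m + 1..m + n - 1}" if "x \<in> {m + 1..m + n - 1}" for x
    using that permutes_in_image[OF \<rho>] by blast
  have ri: "\<rho> x = \<rho> y \<longleftrightarrow> x = y" for x y using permutes_inj[OF \<rho>] by (simp_all add: inj_eq)
  have rng: "c + m - 1 \<in> {m + 1..m + n - 1}" if "c \<in> {2..n}" for c using that by auto
  have s: "\<sigma> c \<in> {2..n} \<and> \<sigma> c + m - 1 = \<rho> (c + m - 1)" if "c \<in> {2..n}" for c
    using r[OF rng[OF that]] that by (auto simp: \<sigma>_def)
  have "\<sigma> permutes {2..n}"
  proof (rule inj_imp_permutes)
    show "inj_on \<sigma> {2..n}"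
    proof (rule inj_onI)
      fix c d assume cd: "c \<in> {2..n}" "d \<in> {2..n}" "\<sigma> c = \<sigma> d"
      then have "\<rho> (c + m - 1) = \<rho> (d + m - 1)" using s by metis
      then show "c = d" using cd unfolding ri by auto
    qed
  qed (use s in \<open>auto simp: \<sigma>_def\<close>)
  then have "\<sigma> permutes {1..n}" by (rule permutes_subset) auto
  moreover have 1: "\<sigma> 1 = 1" by (simp add: \<sigma>_def)
  moreover have "perm_circ m 1 \<sigma> id a = \<rho> a" for a
  proof (cases "a \<in> {m + 1..m + n - 1}")
    case True
    then have c: "a + 1 - m \<in> {2..n}" "a + 1 - m + m - 1 = a" by auto
    have "perm_circ m 1 \<sigma> id a = \<sigma> (a + 1 - m) + m - 1"
      using True s[OF c(1)] 1 by (auto simp: perm_circ_def Let_def)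
    then show ?thesis using s[OF c(1)] c(2) by simp
  next
    case False
    then have e: "\<rho> a = a" by (rule permutes_not_in[OF \<rho>])
    show ?thesis
    proof (cases "a \<le> m")
      case True
      then show ?thesis using 1 e n by (auto simp: perm_circ_def Let_def \<sigma>_def)
    next
      case F: False
      then have "a + 1 - m \<notin> {2..n}" "1 < a + 1 - m" using False n by auto
      then show ?thesis using 1 e F by (auto simp: perm_circ_def Let_def \<sigma>_def)
    qed
  qed
  ultimately show ?thesis by blast
qed

lemma sum_permutations_value:
  fixes \<Phi> :: "nat \<Rightarrow> 'a::comm_monoid_add"
  assumes S: "finite S" "a \<in> S"
  shows "(\<Sum>\<pi> | \<pi> permutes S. \<Phi> (\<pi> a)) = (\<Sum>j\<in>S. \<Sum>\<pi> | \<pi> permutes (S - {a}). \<Phi> j)"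
proof -
  have I: "S = insert a (S - {a})" using S by blast
  have "(\<Sum>\<pi> | \<pi> permutes insert a (S - {a}). \<Phi> (\<pi> a)) =
      (\<Sum>b\<in>insert a (S - {a}). \<Sum>\<pi> | \<pi> permutes (S - {a}). \<Phi> ((transpose a b \<circ> \<pi>) a))"
    by (rule sum_over_permutations_insert) (use S in auto)
  also have "\<dots> = (\<Sum>b\<in>insert a (S - {a}). \<Sum>\<pi> | \<pi> permutes (S - {a}). \<Phi> b)"
  proof (intro sum.cong refl)
    fix b \<pi> assume "\<pi> \<in> {\<pi>. \<pi> permutes (S - {a})}"
    then have "\<pi> a = a" using permutes_not_in[of \<pi> "S - {a}" a] by simp
    then show "\<Phi> ((transpose a b \<circ> \<pi>) a) = \<Phi> b" by simp
  qed
  finally show ?thesis using I by simp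
qed

section \<open>The right-symmetric product of symmetric operations\<close>

locale pseudo_operad_char_0 = pro_conformal_pseudo_operad scale P D act circ scaleq Pq Dq actq tr pr
  for scale :: "'k::field_char_0 \<Rightarrow> 'a::ab_group_add \<Rightarrow> 'a" and P D act circ
    and scaleq :: "'k \<Rightarrow> 'b::ab_group_add \<Rightarrow> 'b" and Pq Dq actq tr pr
begin

sublocale P: sym_diff_superspace scale "P n" "D n" n "act n" for n
  by (rule space)

sublocale Pq: sym_diff_superspace scaleq "Pq q n" "Dq q n" n "actq q n" for q n
  by (rule spaceq)

(* Expressions such as m + n - 1 and circ n m 1 keep their form, to match the facts about them. *)
declare One_nat_def [simp del]

lemma act_total: "\<sigma> permutes {1..n} \<Longrightarrow> x \<in> total (P n) \<Longrightarrow> act n \<sigma> x \<in> total (P n)"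
  using even_linear_total[OF P.superspace_axioms P.superspace_axioms P.act_even_linear] .

lemma act_component: "\<sigma> permutes {1..n} \<Longrightarrow> x \<in> P n p \<Longrightarrow> act n \<sigma> x \<in> P n p"
  and act_add: "\<sigma> permutes {1..n} \<Longrightarrow> x \<in> total (P n) \<Longrightarrow> y \<in> total (P n) \<Longrightarrow>
    act n \<sigma> (x + y) = act n \<sigma> x + act n \<sigma> y"
  and act_scale: "\<sigma> permutes {1..n} \<Longrightarrow> x \<in> total (P n) \<Longrightarrow> act n \<sigma> (scale c x) = scale c (act n \<sigma> x)"
  using P.act_even_linear[of \<sigma> n] unfolding even_linear_def by blast+

lemma act_sum:
  "\<sigma> permutes {1..n} \<Longrightarrow> (\<And>i. i \<in> I \<Longrightarrow> h i \<in> total (P n)) \<Longrightarrow>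
    act n \<sigma> (sum h I) = (\<Sum>i\<in>I. act n \<sigma> (h i))"
  using even_linear_sum[OF P.superspace_axioms P.act_even_linear] by blast

lemma circ_component: "i \<in> {1..n} \<Longrightarrow> f \<in> P n p \<Longrightarrow> g \<in> P m r \<Longrightarrow> circ n m i f g k \<in> P (m + n - 1) (p + r)"
  and circ_add_left: "i \<in> {1..n} \<Longrightarrow> f \<in> total (P n) \<Longrightarrow> f' \<in> total (P n) \<Longrightarrow> g \<in> total (P m) \<Longrightarrow>
      circ n m i (f + f') g k = circ n m i f g k + circ n m i f' g k"
  and circ_add_right: "i \<in> {1..n} \<Longrightarrow> f \<in> total (P n) \<Longrightarrow> g \<in> total (P m) \<Longrightarrow> g' \<in> total (P m) \<Longrightarrow>
      circ n m i f (g + g') k = circ n m i f g k + circ n m i f g' k"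
  and circ_scale_left: "i \<in> {1..n} \<Longrightarrow> f \<in> total (P n) \<Longrightarrow> g \<in> total (P m) \<Longrightarrow>
      circ n m i (scale c f) g k = scale c (circ n m i f g k)"
  and circ_scale_right: "i \<in> {1..n} \<Longrightarrow> f \<in> total (P n) \<Longrightarrow> g \<in> total (P m) \<Longrightarrow>
      circ n m i f (scale c g) k = scale c (circ n m i f g k)"
  using circ_bilinear[of i n m] by (auto simp: even_bilinear_series_def)

lemma circ_total:
  assumes i: "i \<in> {1..n}" and "f \<in> total (P n)" "g \<in> total (P m)"
  shows "circ n m i f g k \<in> total (P (m + n - 1))"
proof -
  obtain f0 f1 g0 g1 where d: "f0 \<in> P n 0" "f1 \<in> P n 1" "f = f0 + f1" "g0 \<in> P m 0" "g1 \<in> P m 1" "g = g0 + g1"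
    using assms unfolding total_def by blast
  then have t: "f0 \<in> total (P n)" "f1 \<in> total (P n)" "g0 \<in> total (P m)" "g1 \<in> total (P m)"
    using P.in_total by blast+
  then have "circ n m i f g k = circ n m i f0 g0 k + circ n m i f0 g1 k + (circ n m i f1 g0 k + circ n m i f1 g1 k)"
    using i by (simp add: d(3,6) circ_add_left circ_add_right P.total_add)
  moreover have "circ n m i x y k \<in> total (P (m + n - 1))" if "x \<in> P n p" "y \<in> P m r" for x y p r
    using circ_component[OF i that] P.in_total by blast
  ultimately show ?thesis using d P.total_add by metis
qed

lemma circ_zero_left: "i \<in> {1..n} \<Longrightarrow> g \<in> total (P m) \<Longrightarrow> circ n m i 0 g k = 0"
  using circ_scale_left[of i n 0 g m 0 k] P.total_0 by simp

lemma circ_zero_right: "i \<in> {1..n} \<Longrightarrow> f \<in> total (P n) \<Longrightarrow> circ n m i f 0 k = 0"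
  using circ_scale_right[of i n f 0 m 0 k] P.total_0 by simp

lemma circ_sum_left:
  "i \<in> {1..n} \<Longrightarrow> g \<in> total (P m) \<Longrightarrow> (\<And>x. x \<in> I \<Longrightarrow> h x \<in> total (P n)) \<Longrightarrow>
    circ n m i (sum h I) g k = (\<Sum>x\<in>I. circ n m i (h x) g k)"
proof (induction I rule: infinite_finite_induct)
  case (insert x I)
  then show ?case using circ_add_left[of i n "h x" "sum h I" g m k] P.total_sum[of I h n] by simp
qed (simp_all add: circ_zero_left)

lemma circ_sum_right:
  "i \<in> {1..n} \<Longrightarrow> f \<in> total (P n) \<Longrightarrow> (\<And>x. x \<in> I \<Longrightarrow> h x \<in> total (P m)) \<Longrightarrow>
    circ n m i f (sum h I) k = (\<Sum>x\<in>I. circ n m i f (h x) k)"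
proof (induction I rule: infinite_finite_induct)
  case (insert x I)
  then show ?case using circ_add_right[of i n f "h x" m "sum h I" k] P.total_sum[of I h m] by simp
qed (simp_all add: circ_zero_right)

definition invariant :: "nat \<Rightarrow> 'a \<Rightarrow> bool" where
  "invariant n x \<longleftrightarrow> (\<forall>\<sigma>. \<sigma> permutes {1..n} \<longrightarrow> act n \<sigma> x = x)"

definition symmetrize :: "nat \<Rightarrow> 'a \<Rightarrow> 'a" where
  "symmetrize n x = (\<Sum>\<pi> | \<pi> permutes {1..n}. act n \<pi> x)"

lemma symmetrize_total: "x \<in> total (P n) \<Longrightarrow> symmetrize n x \<in> total (P n)"
  unfolding symmetrize_def by (intro P.total_sum act_total) auto

lemma symmetrize_component: "x \<in> P n p \<Longrightarrow> symmetrize n x \<in> P n p"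
  unfolding symmetrize_def by (intro P.component_sum act_component) auto

lemma symmetrize_add: "x \<in> total (P n) \<Longrightarrow> y \<in> total (P n) \<Longrightarrow> symmetrize n (x + y) = symmetrize n x + symmetrize n y"
  by (simp add: symmetrize_def act_add sum.distrib)

lemma symmetrize_scale: "x \<in> total (P n) \<Longrightarrow> symmetrize n (scale c x) = scale c (symmetrize n x)"
  by (simp add: symmetrize_def act_scale P.scale_sum_right)

lemma symmetrize_0: "symmetrize n 0 = 0"
  using symmetrize_scale[OF P.total_0, of n 0] by simp

lemma symmetrize_sum:
  "(\<And>i. i \<in> I \<Longrightarrow> h i \<in> total (P n)) \<Longrightarrow> symmetrize n (sum h I) = (\<Sum>i\<in>I. symmetrize n (h i))"
proof (induction I rule: infinite_finite_induct)
  case (insert i I)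
  then show ?case using symmetrize_add[of "h i" n "sum h I"] P.total_sum[of I h n] by simp
qed (simp_all add: symmetrize_0)

lemma symmetrize_D: "x \<in> total (P n) \<Longrightarrow> symmetrize n (D n x) = D n (symmetrize n x)"
  unfolding symmetrize_def by (subst P.D_sum) (auto simp: act_total P.act_D intro!: sum.cong)

lemma symmetrize_act:
  assumes "\<sigma> permutes {1..n}" "x \<in> total (P n)"
  shows "symmetrize n (act n \<sigma> x) = symmetrize n x"
proof -
  have "symmetrize n (act n \<sigma> x) = (\<Sum>\<pi> | \<pi> permutes {1..n}. act n (\<sigma> \<circ> \<pi>) x)"
    unfolding symmetrize_def using assms by (intro sum.cong refl) (simp add: P.act_comp)
  also have "\<dots> = symmetrize n x"
    unfolding symmetrize_def by (rule setum_permutations_compose_left[OF assms(1), symmetric])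
  finally show ?thesis .
qed

lemma invariant_symmetrize:
  assumes "x \<in> total (P n)"
  shows "invariant n (symmetrize n x)"
  unfolding invariant_def
proof (intro allI impI)
  fix \<sigma> assume \<sigma>: "\<sigma> permutes {1..n}"
  have "act n \<sigma> (symmetrize n x) = (\<Sum>\<pi> | \<pi> permutes {1..n}. act n \<sigma> (act n \<pi> x))"
    unfolding symmetrize_def using \<sigma> assms by (intro act_sum) (auto intro: act_total)
  also have "\<dots> = (\<Sum>\<pi> | \<pi> permutes {1..n}. act n (\<pi> \<circ> \<sigma>) x)"
    using \<sigma> assms by (intro sum.cong refl) (simp add: P.act_comp)
  also have "\<dots> = symmetrize n x"
    unfolding symmetrize_def by (rule sum_permutations_compose_right[OF \<sigma>, symmetric])
  finally show "act n \<sigma> (symmetrize n x) = symmetrize n x" .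
qed

lemma invariant_scale: "x \<in> total (P n) \<Longrightarrow> invariant n x \<Longrightarrow> invariant n (scale c x)"
  by (simp add: invariant_def act_scale)

text \<open>
  Equivariance in the only form that is used: after symmetrisation the permutation of the composite
  disappears, and the permutation of \<open>f\<close> merely selects the input.
\<close>

lemma symmetrize_circ:
  assumes i: "i \<in> {1..n}" and \<sigma>: "\<sigma> permutes {1..n}" and \<tau>: "\<tau> permutes {1..m}"
    and f: "f \<in> total (P n)" and g: "g \<in> total (P m)" and N: "N = m + n - 1"
  shows "symmetrize N (circ n m i (act n \<sigma> f) (act m \<tau> g) k) = symmetrize N (circ n m (\<sigma> i) f g k)"
proof -
  have "\<sigma> i \<in> {1..n}" using permutes_in_image[OF \<sigma>] i by blast
  then have "circ n m (\<sigma> i) f g k \<in> total (P N)" unfolding N using f g by (rule circ_total)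
  then show ?thesis
    using circ_equivariant[OF i \<sigma> \<tau> f g, of k] symmetrize_act perm_circ_permutes[OF i \<sigma> \<tau>]
    unfolding N by simp
qed

lemma symmetrize_circ_left:
  assumes i: "i \<in> {1..n}" and \<sigma>: "\<sigma> permutes {1..n}"
    and f: "f \<in> total (P n)" and g: "g \<in> total (P m)" and N: "N = m + n - 1"
  shows "symmetrize N (circ n m i (act n \<sigma> f) g k) = symmetrize N (circ n m (\<sigma> i) f g k)"
  using symmetrize_circ[OF i \<sigma> permutes_id f g N] P.act_id[OF g] by simp

lemma symmetrize_circ_right:
  assumes i: "i \<in> {1..n}" and \<tau>: "\<tau> permutes {1..m}"
    and f: "f \<in> total (P n)" and g: "g \<in> total (P m)" and N: "N = m + n - 1"
  shows "symmetrize N (circ n m i f (act m \<tau> g) k) = symmetrize N (circ n m i f g k)"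
  using symmetrize_circ[OF i permutes_id \<tau> f g N] P.act_id[OF f] by simp

text \<open>
  Symmetrising the outer operation spreads the insertion over all inputs, and each input is the
  image of the first one under \<open>(n - 1)!\<close> permutations.
\<close>

lemma symmetrize_circ_symmetrize_left:
  assumes n: "1 \<le> n" and x: "x \<in> total (P n)" and h: "h \<in> total (P l)" and N: "N = l + n - 1"
  shows "symmetrize N (circ n l 1 (symmetrize n x) h b) =
    scale (fact (n - 1)) (\<Sum>j=1..n. symmetrize N (circ n l j x h b))"
proof -
  have 1: "1 \<in> {1..n}" using n by simp
  have "symmetrize N (circ n l 1 (symmetrize n x) h b) =
      (\<Sum>\<pi> | \<pi> permutes {1..n}. symmetrize N (circ n l 1 (act n \<pi> x) h b))"
    unfolding N by (subst (2) symmetrize_def, subst circ_sum_left, rule 1, rule h)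
      (use 1 x h in \<open>auto simp: act_total intro!: symmetrize_sum circ_total\<close>)
  also have "\<dots> = (\<Sum>\<pi> | \<pi> permutes {1..n}. symmetrize N (circ n l (\<pi> 1) x h b))"
    using symmetrize_circ_left[OF 1 _ x h N] by (intro sum.cong refl) simp
  also have "\<dots> = (\<Sum>j\<in>{1..n}. \<Sum>\<pi> | \<pi> permutes ({1..n} - {1}). symmetrize N (circ n l j x h b))"
    by (rule sum_permutations_value) (use 1 in auto)
  also have "\<dots> = scale (fact (n - 1)) (\<Sum>j=1..n. symmetrize N (circ n l j x h b))"
  proof -
    have "card {\<pi>. \<pi> permutes ({1..n} - {1})} = fact (n - 1)"
      by (rule card_permutations) (use 1 in auto)
    then show ?thesis
      by (simp add: P.scale_sum_right P.sum_constant_scale)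
  qed
  finally show ?thesis .
qed

lemma symmetrize_circ_symmetrize_right:
  assumes n: "1 \<le> n" and f: "f \<in> total (P n)" and x: "x \<in> total (P m)" and N: "N = m + n - 1"
  shows "symmetrize N (circ n m 1 f (symmetrize m x) b) = scale (fact m) (symmetrize N (circ n m 1 f x b))"
proof -
  have 1: "1 \<in> {1..n}" using n by simp
  have "symmetrize N (circ n m 1 f (symmetrize m x) b) =
      (\<Sum>\<pi> | \<pi> permutes {1..m}. symmetrize N (circ n m 1 f (act m \<pi> x) b))"
    unfolding N by (subst (2) symmetrize_def, subst circ_sum_right, rule 1, rule f)
      (use 1 x f in \<open>auto simp: act_total intro!: symmetrize_sum circ_total\<close>)
  also have "\<dots> = (\<Sum>\<pi> | \<pi> permutes {1..m}. symmetrize N (circ n m 1 f x b))"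
    using symmetrize_circ_right[OF 1 _ f x N] by (intro sum.cong refl) simp
  also have "\<dots> = scale (fact m) (symmetrize N (circ n m 1 f x b))"
    using card_permutations[of "{1..m}" m] by (simp add: P.sum_constant_scale)
  finally show ?thesis .
qed

text \<open>
  The sum over shuffles, in the form of a normalised sum over all permutations. An operation without
  inputs admits no insertion, whence the value 0 in the case \<^term>\<open>n = (0::nat)\<close>.
\<close>

definition star :: "nat \<Rightarrow> nat \<Rightarrow> 'a \<Rightarrow> 'a \<Rightarrow> nat \<Rightarrow> 'a" where
  "star n m f g k = (if n = 0 then 0 else
     scale (1 / (fact m * fact (n - 1))) (symmetrize (m + n - 1) (circ n m 1 f g k)))"

lemma star_component:
  assumes f: "f \<in> P n p" and g: "g \<in> P m r"
  shows "star n m f g k \<in> P (m + n - 1) (p + r)"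
proof (cases "n = 0")
  case True
  then have "star n m f g k = 0" by (simp add: star_def)
  then show ?thesis by (simp only: P.component_0)
next
  case False
  then have "circ n m 1 f g k \<in> P (m + n - 1) (p + r)" by (intro circ_component f g) simp
  then have "scale c (symmetrize (m + n - 1) (circ n m 1 f g k)) \<in> P (m + n - 1) (p + r)" for c
    by (intro P.component_scale symmetrize_component)
  then show ?thesis using False unfolding star_def by (simp only: if_False)
qed

lemma invariant_star:
  "f \<in> total (P n) \<Longrightarrow> g \<in> total (P m) \<Longrightarrow> invariant (m + n - 1) (star n m f g k)"
proof (cases "n = 0")
  case True
  have "invariant N 0" for N
    using invariant_symmetrize[OF P.total_0, of N] by (simp add: symmetrize_0)
  then show ?thesis using True by (simp add: star_def)
next
  case False
  then show "f \<in> total (P n) \<Longrightarrow> g \<in> total (P m) \<Longrightarrow> ?thesis"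
    by (simp add: star_def invariant_scale invariant_symmetrize symmetrize_total circ_total Suc_le_eq)
qed


lemma star_D_left:
  assumes f: "f \<in> total (P n)" and g: "g \<in> total (P m)"
  shows "star n m (D n f) g k = times_var (star n m f g) k + D (m + n - 1) (star n m f g k)"
proof (cases "n = 0")
  case True
  then show ?thesis by (simp add: star_def P.D_0 times_var_def split: nat.split)
next
  case False
  then have 1: "1 \<in> {1..n}" by simp
  note t = circ_total[OF 1 f g]
  have tv: "times_var (circ n m 1 f g) k \<in> total (P (m + n - 1))"
    by (cases k) (simp_all add: times_var_0 times_var_Suc P.total_0 t)
  have "symmetrize (m + n - 1) (circ n m 1 (D n f) g k) =
      symmetrize (m + n - 1) (times_var (circ n m 1 f g) k) + D (m + n - 1) (symmetrize (m + n - 1) (circ n m 1 f g k))"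
    using circ_D_left[OF 1 f g, of k] tv t by (simp add: symmetrize_add P.D_total symmetrize_D)
  then show ?thesis using False t
    by (cases k) (simp_all add: star_def times_var_0 times_var_Suc symmetrize_0 P.D_scale
        symmetrize_total P.scale_right_distrib)
qed

lemma star_D_right:
  assumes f: "f \<in> total (P n)" and g: "g \<in> total (P m)"
  shows "star n m f (D m g) k = - times_var (star n m f g) k"
proof (cases "n = 0")
  case True
  then show ?thesis by (simp add: star_def times_var_def split: nat.split)
next
  case False
  then have 1: "1 \<in> {1..n}" by simp
  note t = circ_total[OF 1 f g]
  have "symmetrize N (- x) = - symmetrize N x" if "x \<in> total (P N)" for N x
    using symmetrize_scale[OF that, of "- 1"] by simp
  then show ?thesis using False t circ_D_right[OF 1 f g, of k]
    by (cases k) (simp_all add: star_def times_var_0 times_var_Suc symmetrize_0)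
qed

lemma star_add_left:
  "f \<in> total (P n) \<Longrightarrow> f' \<in> total (P n) \<Longrightarrow> g \<in> total (P m) \<Longrightarrow>
    star n m (f + f') g k = star n m f g k + star n m f' g k"
  by (simp add: star_def circ_add_left symmetrize_add circ_total P.scale_right_distrib)

lemma star_add_right:
  "f \<in> total (P n) \<Longrightarrow> g \<in> total (P m) \<Longrightarrow> g' \<in> total (P m) \<Longrightarrow>
    star n m f (g + g') k = star n m f g k + star n m f g' k"
  by (simp add: star_def circ_add_right symmetrize_add circ_total P.scale_right_distrib)

lemma star_scale_left:
  "f \<in> total (P n) \<Longrightarrow> g \<in> total (P m) \<Longrightarrow> star n m (scale c f) g k = scale c (star n m f g k)"
  by (simp add: star_def circ_scale_left symmetrize_scale circ_total mult.commute)

lemma star_scale_right: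
  "f \<in> total (P n) \<Longrightarrow> g \<in> total (P m) \<Longrightarrow> star n m f (scale c g) k = scale c (star n m f g k)"
  by (simp add: star_def circ_scale_right symmetrize_scale circ_total mult.commute)

lemma star_zero_left: "g \<in> total (P m) \<Longrightarrow> star n m 0 g k = 0"
  using star_scale_left[OF P.total_0, of g m n 0 k] by simp

lemma star_zero_right: "f \<in> total (P n) \<Longrightarrow> star n m f 0 k = 0"
  using star_scale_right[OF _ P.total_0, of f n m 0 k] by simp

text \<open>
  The contribution to the symmetrised iterated product in which \<open>h\<close> is inserted into input number \<open>j\<close> of the
  composite of \<open>f\<close> and \<open>g\<close>. The inputs \<open>1, \<dots>, m\<close> are those of \<open>g\<close>, the others are inputs \<open>2, \<dots>, n\<close> of \<open>f\<close>.
\<close>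

definition insertion_sum :: "nat \<Rightarrow> nat \<Rightarrow> nat \<Rightarrow> nat \<Rightarrow> 'a \<Rightarrow> 'a \<Rightarrow> 'a \<Rightarrow> nat \<Rightarrow> nat \<Rightarrow> 'a" where
  "insertion_sum n m l j f g h a b =
     symmetrize (l + m + n - 2) (circ (m + n - 1) l j (circ n m 1 f g a) h b)"

lemma star_star_left:
  assumes n: "1 \<le> n" and f: "f \<in> total (P n)" and g: "g \<in> total (P m)" and h: "h \<in> total (P l)"
  shows "star (m + n - 1) l (star n m f g a) h b =
    scale (1 / (fact m * fact (n - 1) * fact l)) (\<Sum>j=1..m + n - 1. insertion_sum n m l j f g h a b)"
proof (cases "m + n - 1 = 0")
  case True
  then show ?thesis by (simp add: star_def)
next
  case False
  let ?N = "m + n - 1"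
  have N: "1 \<le> ?N" "l + m + n - 2 = l + ?N - 1" using False n by auto
  have 1: "1 \<in> {1..n}" "1 \<in> {1..?N}" using n N by simp_all
  have x: "circ n m 1 f g a \<in> total (P ?N)" using circ_total[OF 1(1) f g] .
  let ?c = "1 / (fact m * fact (n - 1)) :: 'k"
  have "star ?N l (star n m f g a) h b =
      scale (1 / (fact l * fact (?N - 1))) (symmetrize (l + ?N - 1)
        (circ ?N l 1 (scale ?c (symmetrize ?N (circ n m 1 f g a))) h b))"
    using False n by (simp add: star_def)
  also have "\<dots> = scale (1 / (fact l * fact (?N - 1)) * ?c) (symmetrize (l + ?N - 1)
        (circ ?N l 1 (symmetrize ?N (circ n m 1 f g a)) h b))"
  proof -
    let ?y = "symmetrize ?N (circ n m 1 f g a)"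
    have y: "?y \<in> total (P ?N)" using x by (rule symmetrize_total)
    show ?thesis
      by (simp only: circ_scale_left[OF 1(2) y h] symmetrize_scale[OF circ_total[OF 1(2) y h]] P.scale_scale)
  qed
  also have "\<dots> = scale (1 / (fact l * fact (?N - 1)) * ?c * fact (?N - 1))
      (\<Sum>j=1..?N. insertion_sum n m l j f g h a b)"
    using symmetrize_circ_symmetrize_left[OF N(1) x h refl, of b]
    unfolding insertion_sum_def N(2) by simp
  also have "1 / (fact l * fact (?N - 1)) * ?c * fact (?N - 1) = 1 / (fact m * fact (n - 1) * fact l)"
    by (simp add: field_simps)
  finally show ?thesis .
qed

text \<open>
  The composite of \<open>f\<close> with a symmetric \<open>g\<close> is invariant under the transposition of two inputs of \<open>g\<close>.
\<close>

lemma insertion_sum_inner: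
  assumes n: "1 \<le> n" and f: "f \<in> total (P n)" and g: "g \<in> total (P m)" "invariant m g"
    and h: "h \<in> total (P l)" and j: "j \<in> {1..m}"
  shows "insertion_sum n m l j f g h a b = insertion_sum n m l 1 f g h a b"
proof -
  define \<tau> where "\<tau> = transpose 1 j"
  have 1: "1 \<in> {1..n}" using n by simp
  have \<tau>: "\<tau> permutes {1..m}" unfolding \<tau>_def by (rule permutes_swap_id) (use j in auto)
  let ?x = "circ n m 1 f g a"
  have x: "?x \<in> total (P (m + n - 1))" by (rule circ_total[OF 1 f g(1)])
  have "circ n m 1 (act n id f) (act m \<tau> g) a = act (m + n - 1) (perm_circ m 1 id \<tau>) ?x"
    using circ_equivariant[OF 1 permutes_id \<tau> f g(1)] by simp
  then have inv: "act (m + n - 1) \<tau> ?x = ?x"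
    using g(2) \<tau> by (simp add: P.act_id[OF f] invariant_def perm_circ_id_left[OF \<tau>])
  have \<tau>N: "\<tau> permutes {1..m + n - 1}" by (rule permutes_subset[OF \<tau>]) (use n in auto)
  have jN: "j \<in> {1..m + n - 1}" and N: "l + m + n - 2 = l + (m + n - 1) - 1" using j n by auto
  have "\<tau> j = 1" by (simp add: \<tau>_def)
  then show ?thesis
    using symmetrize_circ_left[OF jN \<tau>N x h N, of b] unfolding inv insertion_sum_def by simp
qed

text \<open>
  By associativity the product nested on the right inserts \<open>h\<close> into the first input of \<open>g\<close>.
\<close>

lemma star_star_right:
  assumes n: "1 \<le> n" and m: "1 \<le> m"
    and f: "f \<in> total (P n)" and g: "g \<in> total (P m)" and h: "h \<in> total (P l)"
  shows "expand_sum scale (\<lambda>k. star n (l + m - 1) f (star m l g h k)) b a =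
    scale (1 / (fact (m - 1) * fact (n - 1) * fact l)) (insertion_sum n m l 1 f g h a b)"
proof -
  have 1: "1 \<in> {1..n}" "1 \<in> {1..m}" using n m by simp_all
  let ?M = "l + m - 1" let ?N = "?M + n - 1"
  let ?c = "1 / (fact (m - 1) * fact (n - 1) * fact l) :: 'k"
  let ?y = "\<lambda>k. circ m l 1 g h k"
  have N: "l + m + n - 2 = ?N" "l + (m + n - 1) - 1 = ?N" using n m by auto
  have y: "?y k \<in> total (P ?M)" for k by (rule circ_total[OF 1(2) g h])
  have z: "circ n ?M 1 f (?y k) j \<in> total (P ?N)" for k j by (rule circ_total[OF 1(1) f y])
  have s: "star n ?M f (star m l g h k) j = scale ?c (symmetrize ?N (circ n ?M 1 f (?y k) j))" for k j
  proof -
    have "star n ?M f (star m l g h k) j =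
        scale (1 / (fact ?M * fact (n - 1))) (symmetrize ?N
          (circ n ?M 1 f (scale (1 / (fact l * fact (m - 1))) (symmetrize ?M (?y k))) j))"
      using n m by (simp add: star_def)
    also have "\<dots> = scale (1 / (fact ?M * fact (n - 1)) * (1 / (fact l * fact (m - 1))))
        (symmetrize ?N (circ n ?M 1 f (symmetrize ?M (?y k)) j))"
    proof -
      have sy: "symmetrize ?M (?y k) \<in> total (P ?M)" using y by (rule symmetrize_total)
      show ?thesis
        by (simp only: circ_scale_right[OF 1(1) f sy] symmetrize_scale[OF circ_total[OF 1(1) f sy]] P.scale_scale)
    qed
    also have "\<dots> = scale (1 / (fact ?M * fact (n - 1)) * (1 / (fact l * fact (m - 1))) * fact ?M)
        (symmetrize ?N (circ n ?M 1 f (?y k) j))"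
      using symmetrize_circ_symmetrize_right[OF n f y refl, of k j] by simp
    also have "1 / (fact ?M * fact (n - 1)) * (1 / (fact l * fact (m - 1))) * fact ?M = ?c"
      by (simp add: field_simps)
    finally show ?thesis .
  qed
  have "expand_sum scale (\<lambda>k. star n ?M f (star m l g h k)) b a =
      scale ?c (symmetrize ?N (expand_sum scale (\<lambda>k. circ n ?M 1 f (?y k)) b a))"
    unfolding expand_sum_def s using z
    by (simp add: symmetrize_sum symmetrize_scale P.total_scale P.scale_sum_right mult.commute)
  also have "expand_sum scale (\<lambda>k. circ n ?M 1 f (?y k)) b a = circ (m + n - 1) l 1 (circ n m 1 f g a) h b"
    using circ_assoc[of 1 n 1 m f g h l a b] n m f g h by simp
  finally show ?thesis unfolding insertion_sum_def N(1) .
qed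

text \<open>
  Two insertions into different inputs of \<open>f\<close> commute. This exchanges the roles of \<open>g\<close> and \<open>h\<close>, but
  leaves \<open>h\<close> in input \<open>i\<close> and \<open>g\<close> in the first one; as \<open>f\<close> is symmetric, the transposition \<open>(1 i)\<close>
  exchanges these places.
\<close>

lemma insertion_sum_outer:
  assumes i: "i \<in> {2..n}" and f: "f \<in> total (P n)" "invariant n f" and g: "g \<in> P m p" and h: "h \<in> P l r"
  shows "insertion_sum n m l (m + i - 1) f g h a b =
    scale (koszul_sign p r) (insertion_sum n l m (l + i - 1) f h g b a)"
proof -
  have gh: "g \<in> total (P m)" "h \<in> total (P l)" using g h P.in_total by blast+
  have n: "1 \<le> n" and i1: "i \<in> {1..n}" "1 \<in> {1..n}" "1 < i" "i \<le> n" using i by auto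
  let ?e = "koszul_sign p r :: 'k"
  let ?N = "l + m + n - 2"
  define t where "t = transpose 1 i"
  have t: "t permutes {1..n}" unfolding t_def by (rule permutes_swap_id) (use i in auto)
  let ?\<rho> = "perm_circ l i t id"
  have \<rho>: "?\<rho> permutes {1..l + n - 1}" by (rule perm_circ_permutes[OF i1(1) t permutes_id])
  have \<rho>1: "?\<rho> 1 = l + i - 1" using i1 by (auto simp: perm_circ_def t_def Let_def)
  let ?y = "circ n l 1 f h b"
  have y: "?y \<in> total (P (l + n - 1))" by (rule circ_total[OF i1(2) f(1) gh(2)])
  have "circ n l i (act n t f) (act l id h) b = act (l + n - 1) ?\<rho> (circ n l (t i) f h b)"
    by (rule circ_equivariant[OF i1(1) t permutes_id f(1) gh(2)])
  then have fh: "circ n l i f h b = act (l + n - 1) ?\<rho> ?y"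
    using f(2) t by (simp add: invariant_def P.act_id[OF gh(2)] t_def)
  have 1: "1 \<in> {1..l + n - 1}" using i by auto
  have N: "?N = m + (l + n - 1) - 1" "?N = l + (m + n - 1) - 1" "m + l + n - 2 = ?N" using i by auto
  have z: "circ (m + n - 1) l (m + i - 1) (circ n m 1 f g a) h b \<in> total (P ?N)"
    unfolding N(2) by (rule circ_total[OF _ circ_total[OF i1(2) f(1) gh(1)] gh(2)]) (use i in auto)
  have "circ (l + n - 1) m 1 (circ n l i f h b) g a =
      scale (koszul_sign r p) (circ (m + n - 1) l (m + i - 1) (circ n m 1 f g a) h b)"
    by (rule circ_commute[OF order.refl i1(3,4) f(1) h g])
  then have "circ (m + n - 1) l (m + i - 1) (circ n m 1 f g a) h b =
      scale ?e (circ (l + n - 1) m 1 (circ n l i f h b) g a)"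
    by (simp add: koszul_sign_commute[of r p] koszul_sign_square)
  then have "insertion_sum n m l (m + i - 1) f g h a b =
      symmetrize ?N (scale ?e (circ (l + n - 1) m 1 (act (l + n - 1) ?\<rho> ?y) g a))"
    by (simp only: insertion_sum_def fh)
  also have "\<dots> = scale ?e (symmetrize ?N (circ (l + n - 1) m 1 (act (l + n - 1) ?\<rho> ?y) g a))"
    unfolding N(1) by (intro symmetrize_scale circ_total[OF 1] act_total \<rho> y gh)
  also have "symmetrize ?N (circ (l + n - 1) m 1 (act (l + n - 1) ?\<rho> ?y) g a) =
      symmetrize ?N (circ (l + n - 1) m (l + i - 1) ?y g a)"
    using symmetrize_circ_left[OF 1 \<rho> y gh(1) N(1)] unfolding \<rho>1 .
  finally show ?thesis unfolding insertion_sum_def N(3) .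
qed

text \<open>
  The \<open>m\<close> equal contributions of the inputs of \<open>g\<close> cancel against the product nested on the right, since
  \<open>m / m! = 1 / (m - 1)!\<close>. The remaining ones are matched in pairs by \<open>insertion_sum_outer\<close>.
\<close>

lemma right_symmetric_star:
  assumes f: "f \<in> total (P n)" "invariant n f"
    and g: "g \<in> P m p" "invariant m g" and h: "h \<in> P l r" "invariant l h"
  shows "star (m + n - 1) l (star n m f g a) h b
      - expand_sum scale (\<lambda>k. star n (l + m - 1) f (star m l g h k)) b a =
    scale (koszul_sign p r) (star (l + n - 1) m (star n l f h b) g a
      - expand_sum scale (\<lambda>k. star n (m + l - 1) f (star l m h g k)) a b)"
proof (cases "n = 0")
  case True
  have "star N l 0 h b = 0" "star N m 0 g a = 0" for N
    using star_zero_left P.in_total g h by blast+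
  then show ?thesis using True by (simp add: star_def[of 0] expand_sum_def)
next
  case False
  then have n: "1 \<le> n" by simp
  let ?e = "koszul_sign p r :: 'k"
  have gh: "g \<in> total (P m)" "h \<in> total (P l)" using g h P.in_total by blast+
  have associator: "star (m + n - 1) l (star n m f g a) h b
      - expand_sum scale (\<lambda>k. star n (l + m - 1) f (star m l g h k)) b a =
    scale (1 / (fact m * fact (n - 1) * fact l)) (\<Sum>i=2..n. insertion_sum n m l (m + i - 1) f g h a b)"
    if g: "g \<in> total (P m)" "invariant m g" and h: "h \<in> total (P l)" for m l g h a b
  proof -
    let ?I = "\<lambda>j. insertion_sum n m l j f g h a b"
    let ?K = "1 / (fact m * fact (n - 1) * fact l) :: 'k"
    have split: "(\<Sum>j=1..m + n - 1. ?I j) = (\<Sum>j=1..m. ?I j) + (\<Sum>i=2..n. ?I (m + i - 1))"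
    proof -
      have "(\<Sum>j=1..m + n - 1. ?I j) = (\<Sum>j=1..m. ?I j) + (\<Sum>j=m + 1..m + n - 1. ?I j)"
        using sum.ub_add_nat[of 1 m ?I "n - 1"] n by simp
      also have "(\<Sum>j=m + 1..m + n - 1. ?I j) = (\<Sum>i=2..n. ?I (m + i - 1))"
        by (rule sum.reindex_bij_witness[of _ "\<lambda>i. m + i - 1" "\<lambda>j. j + 1 - m"]) auto
      finally show ?thesis .
    qed
    have inner: "(\<Sum>j=1..m. ?I j) = scale (of_nat m) (?I 1)"
    proof -
      have "(\<Sum>j=1..m. ?I j) = (\<Sum>j=1..m. ?I 1)"
        by (intro sum.cong refl insertion_sum_inner[OF n f(1) g h])
      then show ?thesis by (simp add: P.sum_constant_scale)
    qed
    have "scale ?K (\<Sum>j=1..m. ?I j) = expand_sum scale (\<lambda>k. star n (l + m - 1) f (star m l g h k)) b a"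
    proof (cases "m = 0")
      case True
      then show ?thesis
        using star_zero_right[OF f(1)] by (simp add: star_def[of 0] expand_sum_def)
    next
      case False
      then have m: "1 \<le> m" by simp
      have "?K * of_nat m = 1 / (fact (m - 1) * fact (n - 1) * fact l)"
        using fact_reduce[of m, where ?'a = 'k] m by (simp add: field_simps)
      then show ?thesis unfolding star_star_right[OF n m f(1) g(1) h] inner by simp
    qed
    then show ?thesis
      unfolding star_star_left[OF n f(1) g(1) h] split by (simp add: P.scale_right_distrib)
  qed
  have "(\<Sum>i=2..n. insertion_sum n m l (m + i - 1) f g h a b) =
      scale ?e (\<Sum>i=2..n. insertion_sum n l m (l + i - 1) f h g b a)"
    using insertion_sum_outer[OF _ f g(1) h(1)] by (simp add: P.scale_sum_right)
  then show ?thesis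
    unfolding associator[OF gh(1) g(2) gh(2)] associator[OF gh(2) h(2) gh(1)]
    by (simp add: mult_ac)
qed

text \<open>
  The composite of two symmetric operations is invariant under the Young subgroup, of order
  \<open>m! (n - 1)!\<close>, and shuffles represent its cosets. The inverses turn left cosets into right ones.
\<close>

lemma star_eq_sum_shuffles:
  assumes n: "1 \<le> n" and f: "f \<in> total (P n)" "invariant n f" and g: "g \<in> total (P m)" "invariant m g"
  shows "star n m f g k =
    (\<Sum>\<sigma>\<in>shuffles (int m) (int (n - 1)). act (m + n - 1) (inv \<sigma>) (circ n m 1 f g k))"
proof -
  let ?N = "m + n - 1"
  let ?S = "shuffles (int m) (int (n - 1))"
  let ?A = "{\<rho>. \<rho> permutes {1..m}}" and ?B = "{\<rho>. \<rho> permutes {m + 1..m + (n - 1)}}"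
  let ?x = "circ n m 1 f g k"
  have 1: "1 \<in> {1..n}" using n by simp
  have N: "m + (n - 1) = ?N" using n by simp
  have x: "?x \<in> total (P ?N)" by (rule circ_total[OF 1 f(1) g(1)])
  have inv1: "act ?N \<rho> ?x = ?x" if \<rho>: "\<rho> permutes {1..m}" for \<rho>
    using circ_equivariant[OF 1 permutes_id \<rho> f(1) g(1), of k] g(2) \<rho>
    by (simp add: P.act_id[OF f(1)] invariant_def perm_circ_id_left[OF \<rho>])
  have inv2: "act ?N \<rho> ?x = ?x" if \<rho>: "\<rho> permutes {m + 1..?N}" for \<rho>
  proof -
    obtain \<sigma> where \<sigma>: "\<sigma> permutes {1..n}" "\<sigma> 1 = 1" "perm_circ m 1 \<sigma> id = \<rho>"
      using perm_circ_id_right[OF \<rho> n] by blast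
    show ?thesis
      using circ_equivariant[OF 1 \<sigma>(1) permutes_id f(1) g(1), of k] f(2) \<sigma>
      by (simp add: P.act_id[OF g(1)] invariant_def)
  qed
  have young: "act ?N (inv (\<sigma> \<circ> (\<rho>1 \<circ> \<rho>2))) ?x = act ?N (inv \<sigma>) ?x"
    if \<sigma>: "\<sigma> \<in> ?S" and 1: "\<rho>1 permutes {1..m}" and 2: "\<rho>2 permutes {m + 1..?N}" for \<sigma> \<rho>1 \<rho>2
  proof -
    have s: "\<sigma> permutes {1..?N}" using \<sigma> unfolding mem_shuffles_iff N by blast
    have p1: "\<rho>1 permutes {1..?N}" by (rule permutes_subset[OF 1]) (use n in auto)
    have p2: "\<rho>2 permutes {1..?N}" by (rule permutes_subset[OF 2]) auto
    have "inv (\<sigma> \<circ> (\<rho>1 \<circ> \<rho>2)) = inv \<rho>2 \<circ> inv \<rho>1 \<circ> inv \<sigma>"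
      using s p1 p2 by (simp add: o_inv_distrib permutes_bij bij_comp)
    then have "act ?N (inv (\<sigma> \<circ> (\<rho>1 \<circ> \<rho>2))) ?x = act ?N (inv \<sigma>) (act ?N (inv \<rho>1) (act ?N (inv \<rho>2) ?x))"
      using s p1 p2 x by (simp add: P.act_comp permutes_inv permutes_compose)
    then show ?thesis using inv1[OF permutes_inv[OF 1]] inv2[OF permutes_inv[OF 2]] by simp
  qed
  have card: "card ?A = fact m" "card ?B = fact (n - 1)"
    by (auto intro!: card_permutations)
  have "symmetrize ?N ?x = (\<Sum>\<pi> | \<pi> permutes {1..m + (n - 1)}. act ?N (inv \<pi>) ?x)"
    unfolding symmetrize_def N by (rule sum_permutations_inverse)
  also have "\<dots> = (\<Sum>(\<sigma>, \<rho>1, \<rho>2)\<in>?S \<times> ?A \<times> ?B. act ?N (inv (\<sigma> \<circ> (\<rho>1 \<circ> \<rho>2))) ?x)"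
    by (subst sum.reindex_bij_betw[OF bij_betw_shuffles, symmetric]) (simp add: case_prod_unfold)
  also have "\<dots> = (\<Sum>(\<sigma>, \<rho>1, \<rho>2)\<in>?S \<times> ?A \<times> ?B. act ?N (inv \<sigma>) ?x)"
    by (intro sum.cong refl) (use young N in auto)
  also have "\<dots> = (\<Sum>\<sigma>\<in>?S. \<Sum>\<rho>\<in>?A \<times> ?B. act ?N (inv \<sigma>) ?x)"
    by (simp add: sum.cartesian_product case_prod_unfold)
  also have "\<dots> = scale (fact m * fact (n - 1)) (\<Sum>\<sigma>\<in>?S. act ?N (inv \<sigma>) ?x)"
    using card by (simp add: P.sum_constant_scale P.scale_sum_right card_cartesian_product)
  finally show ?thesis using n by (simp add: star_def)
qed

end

section \<open>Direct sums\<close>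

abbreviation scale_family :: "('k \<Rightarrow> 'v \<Rightarrow> 'v) \<Rightarrow> 'k \<Rightarrow> ('i \<Rightarrow>\<^sub>0 'v) \<Rightarrow> ('i \<Rightarrow>\<^sub>0 'v::zero)" where
  "scale_family s \<equiv> (\<lambda>c. Poly_Mapping.mapp (\<lambda>_. s c))"

lemma lookup_mapp_0:
  assumes "\<And>i. f i 0 = 0"
  shows "Poly_Mapping.lookup (Poly_Mapping.mapp f x) i = f i (Poly_Mapping.lookup x i)"
  using assms by (simp add: lookup_mapp in_keys_iff when_def)

lemma mapp_single:
  assumes "\<And>i. f i 0 = 0"
  shows "Poly_Mapping.mapp f (Poly_Mapping.single i v) = Poly_Mapping.single i (f i v)"
  by (rule poly_mapping_eqI) (use assms in \<open>simp add: lookup_mapp_0 lookup_single when_def\<close>)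

lemma single_sum: "Poly_Mapping.single d (sum h A) = (\<Sum>a\<in>A. Poly_Mapping.single d (h a))"
  by (induction A rule: infinite_finite_induct) (simp_all add: single_add)

lemma sum_single:
  fixes x :: "'i \<Rightarrow>\<^sub>0 'v::comm_monoid_add"
  assumes "finite A" "Poly_Mapping.keys x \<subseteq> A"
  shows "(\<Sum>i\<in>A. Poly_Mapping.single i (Poly_Mapping.lookup x i)) = x"
proof (rule poly_mapping_eqI)
  fix j
  have "(\<Sum>i\<in>A. Poly_Mapping.lookup (Poly_Mapping.single i (Poly_Mapping.lookup x i)) j) =
      (\<Sum>i\<in>A. if i = j then Poly_Mapping.lookup x j else 0)"
    by (intro sum.cong refl) (simp add: lookup_single when_def)
  also have "\<dots> = Poly_Mapping.lookup x j"
    using assms by (auto simp: in_keys_iff)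
  finally show "Poly_Mapping.lookup (\<Sum>i\<in>A. Poly_Mapping.single i (Poly_Mapping.lookup x i)) j = Poly_Mapping.lookup x j"
    by (simp add: lookup_sum)
qed

lemma direct_sum_induct [consumes 1, case_names zero_mem zero single add]:
  assumes x: "x \<in> direct_sum V p" and zero: "\<And>i. 0 \<in> V i p" and Q0: "Q 0"
    and Q1: "\<And>i v. v \<in> V i p \<Longrightarrow> Q (Poly_Mapping.single i v)"
    and Q2: "\<And>x y. x \<in> direct_sum V p \<Longrightarrow> y \<in> direct_sum V p \<Longrightarrow> Q x \<Longrightarrow> Q y \<Longrightarrow> Q (x + y)"
  shows "Q (x :: 'i \<Rightarrow>\<^sub>0 'v::comm_monoid_add)"
proof -
  have xi: "Poly_Mapping.lookup x i \<in> V i p" for i using x by (simp add: direct_sum_def)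
  have mem: "(\<Sum>i\<in>A. Poly_Mapping.single i (Poly_Mapping.lookup x i)) \<in> direct_sum V p" if "finite A" for A
  proof -
    have "Poly_Mapping.lookup (\<Sum>i\<in>A. Poly_Mapping.single i (Poly_Mapping.lookup x i)) j =
        (if j \<in> A then Poly_Mapping.lookup x j else 0)" for j
      using that by (simp add: lookup_sum lookup_single when_def)
    then show ?thesis using xi zero by (simp add: direct_sum_def)
  qed
  have single: "Poly_Mapping.single i (Poly_Mapping.lookup x i) \<in> direct_sum V p" for i
    using mem[of "{i}"] by simp
  have "Q (\<Sum>i\<in>A. Poly_Mapping.single i (Poly_Mapping.lookup x i))" if "finite A" for A
    using that
  proof (induction A)
    case (insert i A)
    then show ?case using Q2[OF single mem] Q1[OF xi] by simp
  qed (simp add: Q0)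
  from this[of "Poly_Mapping.keys x"] show ?thesis by (simp add: sum_single)
qed

locale superspace_family =
  fixes scale :: "'k::field \<Rightarrow> 'v::ab_group_add \<Rightarrow> 'v" and V :: "'i \<Rightarrow> bit \<Rightarrow> 'v set"
  assumes family: "superspace scale (V i)"
begin

sublocale comp: superspace scale "V i" for i
  by (rule family)

lemma even_part_0: "even_part (V i) 0 = 0"
  using comp.parts(3)[OF comp.total_0, of i] comp.odd_part_component[OF comp.component_0, of i 0] by simp

lemma odd_part_0: "odd_part (V i) 0 = 0"
  using comp.odd_part_component[OF comp.component_0, of i 0] by simp

text \<open>
  The pointwise even and odd parts of a finitely supported family are again finitely supported.
\<close>

lemma total_direct_sum_iff: "x \<in> total (direct_sum V) \<longleftrightarrow> (\<forall>i. Poly_Mapping.lookup x i \<in> total (V i))"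
proof
  assume "x \<in> total (direct_sum V)"
  then obtain y z where yz: "y \<in> direct_sum V 0" "z \<in> direct_sum V 1" "x = y + z"
    unfolding total_def by blast
  then have "Poly_Mapping.lookup y i \<in> total (V i)" "Poly_Mapping.lookup z i \<in> total (V i)" for i
    using comp.in_total unfolding direct_sum_def by blast+
  then show "\<forall>i. Poly_Mapping.lookup x i \<in> total (V i)"
    unfolding yz(3) lookup_add using comp.total_add by blast
next
  assume t: "\<forall>i. Poly_Mapping.lookup x i \<in> total (V i)"
  let ?y = "Poly_Mapping.mapp (\<lambda>i. even_part (V i)) x" and ?z = "Poly_Mapping.mapp (\<lambda>i. odd_part (V i)) x"
  have "?y \<in> direct_sum V 0" "?z \<in> direct_sum V 1"
    using t comp.parts by (auto simp: direct_sum_def lookup_mapp_0 even_part_0 odd_part_0)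
  moreover have "x = ?y + ?z"
    by (rule poly_mapping_eqI)
      (use t comp.parts(3) in \<open>simp add: lookup_add lookup_mapp_0 even_part_0 odd_part_0\<close>)
  ultimately show "x \<in> total (direct_sum V)" unfolding total_def by blast
qed

text \<open>
  In this form \<open>direct_sum_induct\<close> applies to elements without a parity; \<open>p\<close> is a dummy.
\<close>

lemma total_direct_sum: "total (direct_sum V) = direct_sum (\<lambda>i _. total (V i)) p"
  by (auto simp: total_direct_sum_iff) (auto simp: direct_sum_def)

lemma single_component: "v \<in> V i p \<Longrightarrow> Poly_Mapping.single i v \<in> direct_sum V p"
  by (auto simp: direct_sum_def lookup_single when_def comp.component_0)

lemma single_total: "v \<in> total (V i) \<Longrightarrow> Poly_Mapping.single i v \<in> total (direct_sum V)"
  by (auto simp: total_direct_sum_iff lookup_single when_def comp.total_0)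

lemma lookup_total: "x \<in> total (direct_sum V) \<Longrightarrow> Poly_Mapping.lookup x i \<in> total (V i)"
  by (simp add: total_direct_sum_iff)

lemma superspace_direct_sum: "superspace (scale_family scale) (direct_sum V)"
proof -
  have l: "Poly_Mapping.lookup (scale_family scale c x) i = scale c (Poly_Mapping.lookup x i)" for c x i
    by (rule lookup_mapp_0) simp
  interpret vector_space "scale_family scale :: 'k \<Rightarrow> ('i \<Rightarrow>\<^sub>0 'v) \<Rightarrow> _"
    by unfold_locales
      (rule poly_mapping_eqI; simp add: l lookup_add comp.scale_right_distrib comp.scale_left_distrib)+
  show ?thesis
  proof
    show "subspace (direct_sum V p)" for p
      by (rule subspaceI)
        (auto simp: direct_sum_def l lookup_add comp.component_0 comp.component_add comp.component_scale)
    show "direct_sum V 0 \<inter> direct_sum V 1 = {0}"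
    proof (intro equalityI subsetI)
      fix x assume "x \<in> direct_sum V 0 \<inter> direct_sum V 1"
      then have "Poly_Mapping.lookup x i \<in> V i 0 \<inter> V i 1" for i by (simp add: direct_sum_def)
      then have "Poly_Mapping.lookup x i = 0" for i using comp.independent_components by blast
      then show "x \<in> {0}" by (simp add: poly_mapping_eqI)
    qed (simp add: direct_sum_def comp.component_0)
  qed
qed

sublocale sum: superspace "scale_family scale" "direct_sum V"
  by (rule superspace_direct_sum)

lemma lookup_scale: "Poly_Mapping.lookup (scale_family scale c x) i = scale c (Poly_Mapping.lookup x i)"
  by (rule lookup_mapp_0) simp

lemma scale_single: "scale_family scale c (Poly_Mapping.single i v) = Poly_Mapping.single i (scale c v)"
  by (rule mapp_single) simp

end

lemma even_linear_direct_sum: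
  assumes V: "superspace_family s V" and s': "vector_space s'"
    and \<phi>: "\<And>i. even_linear s (V i) s' (V' i) (\<phi> i)"
  shows "even_linear (scale_family s) (direct_sum V) (scale_family s') (direct_sum V') (Poly_Mapping.mapp \<phi>)"
proof -
  interpret superspace_family s V by fact
  interpret s': vector_space s' by fact
  have l: "Poly_Mapping.lookup (Poly_Mapping.mapp \<phi> x) i = \<phi> i (Poly_Mapping.lookup x i)" for x i
    by (rule lookup_mapp_0) (rule even_linear_0[OF family \<phi>])
  have l': "Poly_Mapping.lookup (scale_family s' c x) i = s' c (Poly_Mapping.lookup x i)" for c x i
    by (rule lookup_mapp_0) simp
  show ?thesis
    unfolding even_linear_def
  proof (intro conjI allI ballI)
    show "Poly_Mapping.mapp \<phi> x \<in> direct_sum V' p" if "x \<in> direct_sum V p" for p x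
      using that \<phi> by (auto simp: direct_sum_def l even_linear_def)
    show "Poly_Mapping.mapp \<phi> (x + y) = Poly_Mapping.mapp \<phi> x + Poly_Mapping.mapp \<phi> y"
      if "x \<in> total (direct_sum V)" "y \<in> total (direct_sum V)" for x y
      by (rule poly_mapping_eqI)
        (use that[THEN lookup_total] \<phi> in \<open>simp add: l lookup_add even_linear_def\<close>)
    show "Poly_Mapping.mapp \<phi> (scale_family s c x) = scale_family s' c (Poly_Mapping.mapp \<phi> x)"
      if "x \<in> total (direct_sum V)" for c x
      by (rule poly_mapping_eqI)
        (use that[THEN lookup_total] \<phi> in \<open>simp add: l l' lookup_scale even_linear_def\<close>)
  qed
qed

lemma diff_superspace_direct_sum:
  assumes "\<And>i. diff_superspace s (V i) (D i)"
  shows "diff_superspace (scale_family s) (direct_sum V) (Poly_Mapping.mapp D)"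
proof -
  have V: "superspace_family s V"
    using assms by (intro superspace_family.intro diff_superspace.axioms(1))
  interpret superspace_family s V by fact
  have "even_linear s (V i) s (V i) (D i)" for i
    using assms by (simp add: diff_superspace_def diff_superspace_axioms_def)
  then have "even_linear (scale_family s) (direct_sum V) (scale_family s) (direct_sum V) (Poly_Mapping.mapp D)"
    by (intro even_linear_direct_sum V) (rule comp.vector_space_axioms)
  then show ?thesis
    by (intro diff_superspace.intro diff_superspace_axioms.intro superspace_direct_sum)
qed

lemma diff_hom_direct_sum:
  assumes V: "\<And>i. diff_superspace s (V i) (D i)" and V': "\<And>i. diff_superspace s' (V' i) (D' i)"
    and \<phi>: "\<And>i. diff_hom s (V i) (D i) s' (V' i) (D' i) (\<phi> i)"
  shows "diff_hom (scale_family s) (direct_sum V) (Poly_Mapping.mapp D)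
    (scale_family s') (direct_sum V') (Poly_Mapping.mapp D') (Poly_Mapping.mapp \<phi>)"
proof -
  have F: "superspace_family s V"
    using V by (intro superspace_family.intro diff_superspace.axioms(1))
  have F': "superspace_family s' V'"
    using V' by (intro superspace_family.intro diff_superspace.axioms(1))
  interpret V: superspace_family s V by fact
  interpret V': superspace_family s' V' by (rule F')
  have e: "even_linear s (V i) s' (V' i) (\<phi> i)" for i using \<phi> by (simp add: diff_hom_def)
  have z: "D i 0 = 0" "D' i 0 = 0" "\<phi> i 0 = 0" for i
    using diff_superspace.D_0[OF V] diff_superspace.D_0[OF V'] even_linear_0[OF V.family e] by auto
  show ?thesis
    unfolding diff_hom_def
  proof (intro conjI ballI)
    show "even_linear (scale_family s) (direct_sum V) (scale_family s') (direct_sum V') (Poly_Mapping.mapp \<phi>)"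
      by (intro even_linear_direct_sum F e) (rule V'.comp.vector_space_axioms)
    fix x assume "x \<in> total (direct_sum V)"
    then have "Poly_Mapping.lookup x i \<in> total (V i)" for i by (rule V.lookup_total)
    then show "Poly_Mapping.mapp \<phi> (Poly_Mapping.mapp D x) = Poly_Mapping.mapp D' (Poly_Mapping.mapp \<phi> x)"
      using \<phi> by (intro poly_mapping_eqI) (simp add: lookup_mapp_0 z diff_hom_def)
  qed
qed

lemma mapp_power:
  fixes \<phi> :: "'i \<Rightarrow> 'v::zero \<Rightarrow> 'v"
  shows "(\<And>i. \<phi> i 0 = 0) \<Longrightarrow> (Poly_Mapping.mapp \<phi> ^^ d) x = Poly_Mapping.mapp (\<lambda>i. \<phi> i ^^ d) x"
proof (induction d)
  case 0
  then show ?case by (intro poly_mapping_eqI) (subst lookup_mapp_0, simp_all)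
next
  case (Suc d)
  have "(\<phi> i ^^ d) 0 = 0" for i by (induction d) (simp_all add: Suc.prems)
  then show ?case using Suc by (intro poly_mapping_eqI) (simp add: lookup_mapp_0)
qed

definition bilinear_sum ::
  "(int \<Rightarrow> int \<Rightarrow> 'v \<Rightarrow> 'v \<Rightarrow> nat \<Rightarrow> 'v) \<Rightarrow> (int \<Rightarrow>\<^sub>0 'v) \<Rightarrow> (int \<Rightarrow>\<^sub>0 'v) \<Rightarrow> nat \<Rightarrow> (int \<Rightarrow>\<^sub>0 'v::ab_group_add)" where
  "bilinear_sum \<beta> x y k = (\<Sum>i\<in>Poly_Mapping.keys x. \<Sum>j\<in>Poly_Mapping.keys y.
     Poly_Mapping.single (i + j) (\<beta> i j (Poly_Mapping.lookup x i) (Poly_Mapping.lookup y j) k))"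

locale graded_product = superspace_family scale V
  for scale :: "'k::field \<Rightarrow> 'v::ab_group_add \<Rightarrow> 'v" and V :: "int \<Rightarrow> bit \<Rightarrow> 'v set" +
  fixes \<beta> :: "int \<Rightarrow> int \<Rightarrow> 'v \<Rightarrow> 'v \<Rightarrow> nat \<Rightarrow> 'v"
  assumes product_bilinear: "even_bilinear_series scale (V i) (V j) (V (i + j)) (\<beta> i j)"
begin

lemma product_component: "f \<in> V i p \<Longrightarrow> g \<in> V j r \<Longrightarrow> \<beta> i j f g k \<in> V (i + j) (p + r)"
  and product_add_left: "f \<in> total (V i) \<Longrightarrow> f' \<in> total (V i) \<Longrightarrow> g \<in> total (V j) \<Longrightarrow>
      \<beta> i j (f + f') g k = \<beta> i j f g k + \<beta> i j f' g k"
  and product_add_right: "f \<in> total (V i) \<Longrightarrow> g \<in> total (V j) \<Longrightarrow> g' \<in> total (V j) \<Longrightarrow>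
      \<beta> i j f (g + g') k = \<beta> i j f g k + \<beta> i j f g' k"
  and product_scale_left: "f \<in> total (V i) \<Longrightarrow> g \<in> total (V j) \<Longrightarrow> \<beta> i j (scale c f) g k = scale c (\<beta> i j f g k)"
  and product_scale_right: "f \<in> total (V i) \<Longrightarrow> g \<in> total (V j) \<Longrightarrow> \<beta> i j f (scale c g) k = scale c (\<beta> i j f g k)"
  using product_bilinear[of i j] by (auto simp: even_bilinear_series_def)

lemma product_total:
  assumes "f \<in> total (V i)" "g \<in> total (V j)"
  shows "\<beta> i j f g k \<in> total (V (i + j))"
proof -
  obtain f0 f1 g0 g1 where d: "f0 \<in> V i 0" "f1 \<in> V i 1" "f = f0 + f1" "g0 \<in> V j 0" "g1 \<in> V j 1" "g = g0 + g1"
    using assms unfolding total_def by blast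
  then have t: "f0 \<in> total (V i)" "f1 \<in> total (V i)" "g0 \<in> total (V j)" "g1 \<in> total (V j)"
    using comp.in_total by blast+
  then have "\<beta> i j f g k = \<beta> i j f0 g0 k + \<beta> i j f0 g1 k + (\<beta> i j f1 g0 k + \<beta> i j f1 g1 k)"
    by (simp add: d(3,6) product_add_left product_add_right comp.total_add)
  moreover have "\<beta> i j x y k \<in> total (V (i + j))" if "x \<in> V i p" "y \<in> V j r" for x y p r
    using product_component[OF that] comp.in_total by blast
  ultimately show ?thesis using d comp.total_add by metis
qed

lemma product_zero_left: "g \<in> total (V j) \<Longrightarrow> \<beta> i j 0 g k = 0"
  using product_scale_left[OF comp.total_0, of g j i 0 k] by simp

lemma product_zero_right: "f \<in> total (V i) \<Longrightarrow> \<beta> i j f 0 k = 0"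
  using product_scale_right[OF _ comp.total_0, of f i j 0 k] by simp

lemma bilinear_sum_eq:
  assumes x: "x \<in> total (direct_sum V)" and y: "y \<in> total (direct_sum V)"
    and A: "finite A" "Poly_Mapping.keys x \<subseteq> A" and B: "finite B" "Poly_Mapping.keys y \<subseteq> B"
  shows "bilinear_sum \<beta> x y k = (\<Sum>i\<in>A. \<Sum>j\<in>B.
    Poly_Mapping.single (i + j) (\<beta> i j (Poly_Mapping.lookup x i) (Poly_Mapping.lookup y j) k))"
proof -
  have "bilinear_sum \<beta> x y k = (\<Sum>i\<in>Poly_Mapping.keys x. \<Sum>j\<in>B.
    Poly_Mapping.single (i + j) (\<beta> i j (Poly_Mapping.lookup x i) (Poly_Mapping.lookup y j) k))"
    unfolding bilinear_sum_def
    by (intro sum.cong refl sum.mono_neutral_left)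
      (use B lookup_total[OF x] in \<open>auto simp: in_keys_iff product_zero_right\<close>)
  also have "\<dots> = (\<Sum>i\<in>A. \<Sum>j\<in>B.
    Poly_Mapping.single (i + j) (\<beta> i j (Poly_Mapping.lookup x i) (Poly_Mapping.lookup y j) k))"
    by (rule sum.mono_neutral_left)
      (use A lookup_total[OF y] in \<open>auto simp: in_keys_iff product_zero_left\<close>)
  finally show ?thesis .
qed

lemma bilinear_sum_single:
  assumes "f \<in> total (V i)" "g \<in> total (V j)"
  shows "bilinear_sum \<beta> (Poly_Mapping.single i f) (Poly_Mapping.single j g) k = Poly_Mapping.single (i + j) (\<beta> i j f g k)"
  by (subst bilinear_sum_eq[of _ _ "{i}" "{j}"]) (use assms in \<open>simp_all add: single_total\<close>)

lemma even_bilinear_sum: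
  "even_bilinear_series (scale_family scale) (direct_sum V) (direct_sum V) (direct_sum V) (bilinear_sum \<beta>)"
  unfolding even_bilinear_series_def
proof (intro conjI allI ballI)
  let ?T = "total (direct_sum V)"
  let ?s = "scale_family scale :: 'k \<Rightarrow> (int \<Rightarrow>\<^sub>0 'v) \<Rightarrow> _"
  let ?l = "Poly_Mapping.lookup :: (int \<Rightarrow>\<^sub>0 'v) \<Rightarrow> _"
  show "bilinear_sum \<beta> x y k \<in> direct_sum V (p + r)" if "x \<in> direct_sum V p" "y \<in> direct_sum V r" for p r x y k
    unfolding bilinear_sum_def
    by (intro sum.component_sum single_component product_component)
      (use that in \<open>auto simp: direct_sum_def\<close>)
  have keys: "Poly_Mapping.keys (x + x') \<subseteq> Poly_Mapping.keys x \<union> Poly_Mapping.keys x'" for x x' :: "int \<Rightarrow>\<^sub>0 'v"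
    by (auto simp: in_keys_iff lookup_add)
  have keys': "Poly_Mapping.keys (?s c x) \<subseteq> Poly_Mapping.keys x" for c x by (rule keys_mapp_subset)
  show "bilinear_sum \<beta> (x + x') y k = bilinear_sum \<beta> x y k + bilinear_sum \<beta> x' y k"
    if "x \<in> ?T" "x' \<in> ?T" "y \<in> ?T" for x x' y k
  proof -
    let ?A = "Poly_Mapping.keys x \<union> Poly_Mapping.keys x'"
    note e = bilinear_sum_eq[of _ _ ?A "Poly_Mapping.keys y" k]
    show ?thesis
      using that that[THEN lookup_total] keys[of x x']
      by (simp add: e sum.total_add lookup_add product_add_left single_add sum.distrib)
  qed
  show "bilinear_sum \<beta> x (y + y') k = bilinear_sum \<beta> x y k + bilinear_sum \<beta> x y' k"
    if "x \<in> ?T" "y \<in> ?T" "y' \<in> ?T" for x y y' k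
  proof -
    let ?A = "Poly_Mapping.keys y \<union> Poly_Mapping.keys y'"
    note e = bilinear_sum_eq[of _ _ "Poly_Mapping.keys x" ?A k]
    show ?thesis
      using that that[THEN lookup_total] keys[of y y']
      by (simp add: e sum.total_add lookup_add product_add_right single_add sum.distrib)
  qed
  have scale_sum: "?s c (\<Sum>i\<in>A. \<Sum>j\<in>B. Poly_Mapping.single (i + j) (h i j)) =
      (\<Sum>i\<in>A. \<Sum>j\<in>B. Poly_Mapping.single (i + j) (scale c (h i j)))" for c A B h
    by (simp add: sum.scale_sum_right scale_single)
  show "bilinear_sum \<beta> (?s c x) y k = ?s c (bilinear_sum \<beta> x y k)" if "x \<in> ?T" "y \<in> ?T" for c x y k
  proof -
    note e = bilinear_sum_eq[of _ _ "Poly_Mapping.keys x" "Poly_Mapping.keys y" k]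
    show ?thesis
      using that that[THEN lookup_total] keys'[of c x]
      by (simp add: e sum.total_scale lookup_scale product_scale_left scale_sum)
  qed
  show "bilinear_sum \<beta> x (?s c y) k = ?s c (bilinear_sum \<beta> x y k)" if "x \<in> ?T" "y \<in> ?T" for c x y k
  proof -
    note e = bilinear_sum_eq[of _ _ "Poly_Mapping.keys x" "Poly_Mapping.keys y" k]
    show ?thesis
      using that that[THEN lookup_total] keys'[of c y]
      by (simp add: e sum.total_scale lookup_scale product_scale_right scale_sum)
  qed
qed

end

section \<open>Completeness of projective limits\<close>

lemma limit_injective:
  assumes lim: "is_projective_limit T Tq tr pr"
    and mem: "\<And>q x. x \<in> T \<Longrightarrow> pr q x \<in> Tq q"
    and xy: "x \<in> T" "y \<in> T" "\<And>q. pr q x = pr q y"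
  shows "x = y"
proof -
  have "\<exists>!z. z \<in> T \<and> (\<forall>q. pr q z = pr q x)"
    using conjunct2[OF lim[unfolded is_projective_limit_def], THEN spec, of "\<lambda>q. pr q x"]
      conjunct1[OF lim[unfolded is_projective_limit_def]] mem xy(1) by blast
  then show ?thesis using xy by metis
qed

text \<open>
  At each level the series is a finite sum, and the transition maps are compatible with these sums
  because they commute with the endomorphisms. The series converges for arbitrary coefficients and
  exponents, and the slenderness argument relies on this freedom.
\<close>

lemma limit_completion:
  assumes V: "diff_superspace s V D" and Vq: "\<And>q. diff_superspace s' (Vq q) (Dq q)"
    and tr: "\<And>q. diff_hom s' (Vq (Suc q)) (Dq (Suc q)) s' (Vq q) (Dq q) (tr q)"
    and pr: "\<And>q. diff_hom s V D s' (Vq q) (Dq q) (pr q)"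
    and lim: "is_projective_limit (total V) (\<lambda>q. total (Vq q)) tr pr"
    and a: "\<And>k. a k \<in> total V" and fin: "\<And>q. finite {k. pr q (a k) \<noteq> 0}"
  shows "\<exists>!y. y \<in> total V \<and>
    (\<forall>q. pr q y = (\<Sum>k | pr q (a k) \<noteq> 0. s' (c k) ((Dq q ^^ e k) (pr q (a k)))))"
proof -
  interpret V: diff_superspace s V D by fact
  interpret Vq: diff_superspace s' "Vq q" "Dq q" for q by (rule Vq)
  have pr_lin: "even_linear s V s' (Vq q) (pr q)" and tr_lin: "even_linear s' (Vq (Suc q)) s' (Vq q) (tr q)" for q
    using pr tr unfolding diff_hom_def by blast+
  have at: "pr q (a k) \<in> total (Vq q)" for q k
    by (rule even_linear_total[OF V.superspace_axioms Vq.superspace_axioms pr_lin a])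
  have tra: "tr q (pr (Suc q) (a k)) = pr q (a k)" for q k
    using lim a unfolding is_projective_limit_def by blast
  have trD: "tr q ((Dq (Suc q) ^^ d) x) = (Dq q ^^ d) (tr q x)" if "x \<in> total (Vq (Suc q))" for q d x
    using that tr[of q] by (induction d) (simp_all add: diff_hom_def Vq.Dpow_total)
  have tr_scale: "tr q (s' r x) = s' r (tr q x)" if "x \<in> total (Vq (Suc q))" for q r x
    using that tr_lin[of q] unfolding even_linear_def by blast
  let ?y = "\<lambda>q. \<Sum>k | pr q (a k) \<noteq> 0. s' (c k) ((Dq q ^^ e k) (pr q (a k)))"
  have "?y q \<in> total (Vq q)" for q
    by (intro Vq.total_sum Vq.total_scale Vq.Dpow_total at)
  moreover have "tr q (?y (Suc q)) = ?y q" for q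
  proof -
    have "tr q (?y (Suc q)) = (\<Sum>k | pr (Suc q) (a k) \<noteq> 0. tr q (s' (c k) ((Dq (Suc q) ^^ e k) (pr (Suc q) (a k)))))"
      by (intro even_linear_sum[OF Vq.superspace_axioms tr_lin] Vq.total_scale Vq.Dpow_total at)
    also have "\<dots> = (\<Sum>k | pr (Suc q) (a k) \<noteq> 0. s' (c k) ((Dq q ^^ e k) (pr q (a k))))"
      by (intro sum.cong refl) (simp add: tr_scale trD tra at Vq.Dpow_total)
    also have "\<dots> = ?y q"
    proof (rule sum.mono_neutral_right[OF fin])
      have "tr q 0 = 0" by (rule even_linear_0[OF Vq.superspace_axioms tr_lin])
      then show "{k. pr q (a k) \<noteq> 0} \<subseteq> {k. pr (Suc q) (a k) \<noteq> 0}"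
        using tra[of q] by (metis (mono_tags, lifting) mem_Collect_eq subsetI)
    qed (auto simp: Vq.Dpow_0)
    finally show ?thesis .
  qed
  ultimately show ?thesis
    using conjunct2[OF lim[unfolded is_projective_limit_def], THEN spec, of ?y] by blast
qed


section \<open>Spaces of invariants\<close>

lemma W_space_iff:
  assumes "n \<ge> -1"
  shows "x \<in> W_space V act n p \<longleftrightarrow>
    x \<in> V (arity n) p \<and> (\<forall>\<sigma>. \<sigma> permutes {1..arity n} \<longrightarrow> act (arity n) \<sigma> x = x)"
  using assms by (simp add: W_space_def)

lemma W_space_degenerate: "n < -1 \<Longrightarrow> W_space V act n = (\<lambda>p. {0})"
  by (simp add: W_space_def fun_eq_iff)

lemma total_W_space_degenerate: "n < -1 \<Longrightarrow> total (W_space V act n) = {0 :: 'v::ab_group_add}"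
  by (auto simp: W_space_degenerate total_def)

locale sym_diff_family =
  fixes scale :: "'k::field \<Rightarrow> 'v::ab_group_add \<Rightarrow> 'v"
    and V :: "nat \<Rightarrow> bit \<Rightarrow> 'v set" and D :: "nat \<Rightarrow> 'v \<Rightarrow> 'v" and act :: "nat \<Rightarrow> (nat \<Rightarrow> nat) \<Rightarrow> 'v \<Rightarrow> 'v"
  assumes sym_family: "sym_diff_superspace scale (V n) (D n) n (act n)"
begin

sublocale arity: sym_diff_superspace scale "V n" "D n" n "act n" for n
  by (rule sym_family)

(* The index set {1..arity n} keeps its form, to match the facts about it. *)
declare One_nat_def [simp del]

text \<open>
  The group preserves parity, so the even and odd parts of an invariant element are invariant.
\<close>

lemma total_W_space_iff:
  assumes n: "n \<ge> -1"
  shows "x \<in> total (W_space V act n) \<longleftrightarrow>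
    x \<in> total (V (arity n)) \<and> (\<forall>\<sigma>. \<sigma> permutes {1..arity n} \<longrightarrow> act (arity n) \<sigma> x = x)"
proof
  assume "x \<in> total (W_space V act n)"
  then obtain y z where yz: "y \<in> W_space V act n 0" "z \<in> W_space V act n 1" "x = y + z"
    unfolding total_def by blast
  then have t: "y \<in> total (V (arity n))" "z \<in> total (V (arity n))"
    using arity.in_total unfolding W_space_iff[OF n] by blast+
  have "act (arity n) \<sigma> x = x" if "\<sigma> permutes {1..arity n}" for \<sigma>
    using that yz t arity.act_even_linear[OF that] unfolding W_space_iff[OF n] even_linear_def by simp
  then show "x \<in> total (V (arity n)) \<and> (\<forall>\<sigma>. \<sigma> permutes {1..arity n} \<longrightarrow> act (arity n) \<sigma> x = x)"
    using t yz(3) arity.total_add by blast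
next
  assume x: "x \<in> total (V (arity n)) \<and> (\<forall>\<sigma>. \<sigma> permutes {1..arity n} \<longrightarrow> act (arity n) \<sigma> x = x)"
  then obtain y z where yz: "y \<in> V (arity n) 0" "z \<in> V (arity n) 1" "x = y + z"
    unfolding total_def by blast
  have "act (arity n) \<sigma> y = y \<and> act (arity n) \<sigma> z = z" if \<sigma>: "\<sigma> permutes {1..arity n}" for \<sigma>
  proof (rule arity.decompose_unique)
    note lin = arity.act_even_linear[OF \<sigma>]
    show "act (arity n) \<sigma> y \<in> V (arity n) 0" "act (arity n) \<sigma> z \<in> V (arity n) 1"
      using lin yz unfolding even_linear_def by blast+
    have "act (arity n) \<sigma> (y + z) = act (arity n) \<sigma> y + act (arity n) \<sigma> z"
      using lin yz arity.in_total unfolding even_linear_def by blast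
    then show "act (arity n) \<sigma> y + act (arity n) \<sigma> z = y + z" using x \<sigma> yz(3) by simp
  qed (rule yz)+
  then have "y \<in> W_space V act n 0" "z \<in> W_space V act n 1" using yz unfolding W_space_iff[OF n] by blast+
  then show "x \<in> total (W_space V act n)" using yz(3) unfolding total_def by blast
qed

lemma total_W_space_subset: "x \<in> total (W_space V act n) \<Longrightarrow> x \<in> total (V (arity n))"
proof (cases "n \<ge> -1")
  case False
  then show "x \<in> total (W_space V act n) \<Longrightarrow> ?thesis"
    using total_W_space_degenerate[of n V act] arity.total_0 by simp
qed (simp add: total_W_space_iff)

lemma W_space_diff_superspace: "diff_superspace scale (W_space V act n) (D (arity n))"
proof (cases "n \<ge> -1")
  case False
  then show ?thesis
    using total_W_space_degenerate[of n V act]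
    by unfold_locales (auto simp: W_space_degenerate even_linear_def arity.D_0)
next
  case True
  note iff = W_space_iff[OF True]
  let ?N = "arity n"
  have lin: "act ?N \<sigma> (x + y) = act ?N \<sigma> x + act ?N \<sigma> y" "act ?N \<sigma> (scale c x) = scale c (act ?N \<sigma> x)"
    if "\<sigma> permutes {1..?N}" "x \<in> V ?N p" "y \<in> V ?N p" for \<sigma> x y c p
    using arity.act_even_linear[OF that(1)] that(2,3)[THEN arity.in_total] unfolding even_linear_def by blast+
  have z: "act ?N \<sigma> 0 = 0" if "\<sigma> permutes {1..?N}" for \<sigma>
    using even_linear_0[OF arity.superspace_axioms arity.act_even_linear[OF that]] .
  show ?thesis
  proof
    show "arity.subspace (W_space V act n p)" for p
    proof (rule arity.subspaceI)
      show "0 \<in> W_space V act n p" using z by (simp add: iff arity.component_0)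
    next
      fix x y assume "x \<in> W_space V act n p" "y \<in> W_space V act n p"
      then show "x + y \<in> W_space V act n p" using lin(1)[where p = p] unfolding iff by (simp add: arity.component_add)
    next
      fix x c assume "x \<in> W_space V act n p"
      then show "scale c x \<in> W_space V act n p" using lin(2)[where p = p and x = x and y = x] unfolding iff by (simp add: arity.component_scale)
    qed
    show "W_space V act n 0 \<inter> W_space V act n 1 = {0}"
      using arity.independent_components[of ?N] z by (auto simp: iff arity.component_0)
    show "even_linear scale (W_space V act n) scale (W_space V act n) (D ?N)"
      unfolding even_linear_def
    proof (intro conjI allI ballI)
      show "D ?N x \<in> W_space V act n p" if "x \<in> W_space V act n p" for p x
        using that arity.D_component arity.act_D arity.in_total unfolding iff by metis
    qed (use total_W_space_subset arity.D_add arity.D_scale in blast)+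
  qed
qed

lemma W_space_family: "superspace_family scale (W_space V act)"
  by (intro superspace_family.intro diff_superspace.axioms(1)[OF W_space_diff_superspace])

end

lemma diff_hom_W_space:
  assumes V: "sym_diff_family s V D act" and V': "sym_diff_family s' V' D' act'"
    and \<phi>: "\<And>n. sym_diff_hom n s (V n) (D n) (act n) s' (V' n) (D' n) (act' n) (\<phi> n)"
  shows "diff_hom s (W_space V act n) (D (arity n)) s' (W_space V' act' n) (D' (arity n)) (\<phi> (arity n))"
proof -
  interpret V: sym_diff_family s V D act by fact
  interpret V': sym_diff_family s' V' D' act' by fact
  have lin: "even_linear s (V N) s' (V' N) (\<phi> N)" for N using \<phi> unfolding sym_diff_hom_def diff_hom_def by blast
  have eq: "\<phi> N (act N \<sigma> x) = act' N \<sigma> (\<phi> N x)" if "\<sigma> permutes {1..N}" "x \<in> total (V N)" for N \<sigma> x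
    using \<phi> that unfolding sym_diff_hom_def by blast
  have D: "\<phi> N (D N x) = D' N (\<phi> N x)" if "x \<in> total (V N)" for N x
    using \<phi> that unfolding sym_diff_hom_def diff_hom_def by blast
  have comp: "\<phi> (arity n) x \<in> W_space V' act' n p" if x: "x \<in> W_space V act n p" for x p
  proof (cases "n \<ge> -1")
    case True
    then show ?thesis
      using x lin[of "arity n"] eq[of _ "arity n" x] V.arity.in_total
      unfolding W_space_iff[OF True] even_linear_def by metis
  next
    case False
    then show ?thesis
      using x even_linear_0[OF V.arity.superspace_axioms lin] by (simp add: W_space_degenerate)
  qed
  show ?thesis
    unfolding diff_hom_def even_linear_def
  proof (intro conjI allI ballI)
    show "\<phi> (arity n) x \<in> W_space V' act' n p" if "x \<in> W_space V act n p" for p x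
      using that by (rule comp)
  next
    fix x y assume "x \<in> total (W_space V act n)" "y \<in> total (W_space V act n)"
    then have "x \<in> total (V (arity n))" "y \<in> total (V (arity n))" by (auto dest: V.total_W_space_subset)
    then show "\<phi> (arity n) (x + y) = \<phi> (arity n) x + \<phi> (arity n) y"
      using lin[of "arity n"] unfolding even_linear_def by blast
  next
    fix c x assume "x \<in> total (W_space V act n)"
    then have "x \<in> total (V (arity n))" by (rule V.total_W_space_subset)
    then show "\<phi> (arity n) (s c x) = s' c (\<phi> (arity n) x)"
      using lin[of "arity n"] unfolding even_linear_def by blast
  next
    fix x assume "x \<in> total (W_space V act n)"
    then have "x \<in> total (V (arity n))" by (rule V.total_W_space_subset)
    then show "\<phi> (arity n) (D (arity n) x) = D' (arity n) (\<phi> (arity n) x)" by (rule D)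
  qed
qed


section \<open>The superalgebra of a pseudo operad\<close>

context pseudo_operad_char_0
begin

abbreviation W :: "int \<Rightarrow> bit \<Rightarrow> 'a set" where "W \<equiv> W_space P act"
abbreviation Wq :: "nat \<Rightarrow> int \<Rightarrow> bit \<Rightarrow> 'b set" where "Wq q \<equiv> W_space (Pq q) (actq q)"

sublocale W: sym_diff_family scale P D act
  by unfold_locales

sublocale Wq: sym_diff_family scaleq "Pq q" "Dq q" "actq q" for q
  by unfold_locales

lemma pr_diff_hom: "diff_hom scale (P n) (D n) scaleq (Pq q n) (Dq q n) (pr q n)"
  and tr_diff_hom: "diff_hom scaleq (Pq (Suc q) n) (Dq (Suc q) n) scaleq (Pq q n) (Dq q n) (tr q n)"
  using pr_hom tr_hom unfolding sym_diff_hom_def by blast+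

lemma pr_even_linear: "even_linear scale (P n) scaleq (Pq q n) (pr q n)"
  using pr_diff_hom unfolding diff_hom_def by blast

lemma pr_total: "x \<in> total (P n) \<Longrightarrow> pr q n x \<in> total (Pq q n)"
  using even_linear_total[OF P.superspace_axioms Pq.superspace_axioms pr_even_linear] .

lemma pr_0: "pr q n 0 = 0"
  using even_linear_0[OF P.superspace_axioms pr_even_linear] .

lemma pr_sum: "(\<And>i. i \<in> I \<Longrightarrow> h i \<in> total (P n)) \<Longrightarrow> pr q n (sum h I) = (\<Sum>i\<in>I. pr q n (h i))"
  using even_linear_sum[OF P.superspace_axioms pr_even_linear] .

lemma pr_act: "\<sigma> permutes {1..n} \<Longrightarrow> x \<in> total (P n) \<Longrightarrow> pr q n (act n \<sigma> x) = actq q n \<sigma> (pr q n x)"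
  using pr_hom unfolding sym_diff_hom_def by blast

lemma pr_scale: "x \<in> total (P n) \<Longrightarrow> pr q n (scale c x) = scaleq c (pr q n x)"
  using pr_even_linear unfolding even_linear_def by blast

lemma pr_injective:
  assumes "x \<in> total (P n)" "y \<in> total (P n)" "\<And>q. pr q n x = pr q n y"
  shows "x = y"
  by (rule limit_injective[OF limit _ assms]) (rule pr_total)

lemma pr_W_diff_hom: "diff_hom scale (W n) (D (arity n)) scaleq (Wq q n) (Dq q (arity n)) (pr q (arity n))"
  by (rule diff_hom_W_space[OF W.sym_diff_family_axioms Wq.sym_diff_family_axioms pr_hom])

lemma tr_W_diff_hom:
  "diff_hom scaleq (Wq (Suc q) n) (Dq (Suc q) (arity n)) scaleq (Wq q n) (Dq q (arity n)) (tr q (arity n))"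
  by (rule diff_hom_W_space[OF Wq.sym_diff_family_axioms Wq.sym_diff_family_axioms tr_hom])

text \<open>
  An element all of whose projections are invariant is invariant, as the projections separate points.
\<close>

lemma W_limit:
  "is_projective_limit (total (W n)) (\<lambda>q. total (Wq q n)) (\<lambda>q. tr q (arity n)) (\<lambda>q. pr q (arity n))"
  unfolding is_projective_limit_def
proof (intro conjI allI ballI impI)
  let ?N = "arity n"
  show "tr q ?N (pr (Suc q) ?N x) = pr q ?N x" if "x \<in> total (W n)" for x q
    using limit[of ?N] W.total_W_space_subset[OF that] unfolding is_projective_limit_def by blast
  fix y assume y: "\<forall>q. y q \<in> total (Wq q n) \<and> tr q ?N (y (Suc q)) = y q"
  show "\<exists>!x. x \<in> total (W n) \<and> (\<forall>q. pr q ?N x = y q)"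
  proof (cases "n \<ge> -1")
    case False
    then have t: "total (W n) = {0}" "total (Wq q n) = {0}" for q
      using total_W_space_degenerate[of n] by auto
    then have "pr q ?N 0 = y q" for q using y pr_0 by simp
    then show ?thesis unfolding t by blast
  next
    case True
    have "\<forall>q. y q \<in> total (Pq q ?N) \<and> tr q ?N (y (Suc q)) = y q"
      using y Wq.total_W_space_subset by blast
    then obtain x where x: "x \<in> total (P ?N)" "\<And>q. pr q ?N x = y q"
      using limit[of ?N] unfolding is_projective_limit_def by blast
    have "act ?N \<sigma> x = x" if \<sigma>: "\<sigma> permutes {1..?N}" for \<sigma>
    proof (rule pr_injective)
      show "pr q ?N (act ?N \<sigma> x) = pr q ?N x" for q
        using y Wq.total_W_space_iff[OF True, of "y q" q] \<sigma> by (simp add: pr_act x)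
    qed (use x act_total \<sigma> in auto)
    then have "x \<in> total (W n)" using x W.total_W_space_iff[OF True] by blast
    then show ?thesis
    proof (intro ex1I[of _ x])
      fix z assume z: "z \<in> total (W n) \<and> (\<forall>q. pr q ?N z = y q)"
      show "z = x" by (rule pr_injective) (use z x W.total_W_space_subset in auto)
    qed (use x in auto)
  qed
qed

lemma arity_add: "0 \<le> i \<Longrightarrow> -1 \<le> j \<Longrightarrow> arity (i + j) = arity j + arity i - 1"
  by (simp add: arity_def nat_add_distrib[symmetric] nat_diff_distrib')

abbreviation degree_star :: "int \<Rightarrow> int \<Rightarrow> 'a \<Rightarrow> 'a \<Rightarrow> nat \<Rightarrow> 'a" where
  "degree_star i j \<equiv> star (arity i) (arity j)"

text \<open>
  Outside the degrees where \<open>arity_add\<close> holds, either there is no input to insert into, or the second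
  factor lies in a zero space.
\<close>

lemma degree_star_0:
  assumes "i < 0 \<or> j < -1" "f \<in> total (W i)" "g \<in> total (W j)"
  shows "degree_star i j f g k = 0"
proof (cases "i < 0")
  case True
  then show ?thesis by (simp add: arity_def star_def)
next
  case False
  then have "g = 0" using assms total_W_space_degenerate[of j P act] by simp
  then show ?thesis using star_zero_right W.total_W_space_subset assms by simp
qed

lemma invariant_iff: "n \<ge> -1 \<Longrightarrow> x \<in> total (W n) \<longleftrightarrow> x \<in> total (P (arity n)) \<and> invariant (arity n) x"
  by (simp add: W.total_W_space_iff invariant_def)

lemma component_iff: "n \<ge> -1 \<Longrightarrow> x \<in> W n p \<longleftrightarrow> x \<in> P (arity n) p \<and> invariant (arity n) x"
  by (simp add: W_space_iff invariant_def)

sublocale family: superspace_family scale W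
  by (rule W.W_space_family)

lemma degree_star_bilinear: "even_bilinear_series scale (W i) (W j) (W (i + j)) (degree_star i j)"
  unfolding even_bilinear_series_def
proof (intro conjI allI ballI)
  show "degree_star i j f g k \<in> W (i + j) (p + r)" if f: "f \<in> W i p" and g: "g \<in> W j r" for p r f g k
  proof (cases "0 \<le> i \<and> -1 \<le> j")
    case True
    then have f': "f \<in> P (arity i) p" and g': "g \<in> P (arity j) r"
      using f g component_iff by auto
    have "i + j \<ge> -1" using True by linarith
    then show ?thesis
      using True star_component[OF f' g', of k] invariant_star[OF P.in_total[OF f'] P.in_total[OF g'], of k]
      by (simp only: component_iff arity_add)
  next
    case False
    then have "degree_star i j f g k = 0"
      using f g by (intro degree_star_0 family.comp.in_total) auto
    then show ?thesis by (simp only: family.comp.component_0)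
  qed
qed (simp_all add: W.total_W_space_subset star_add_left star_add_right star_scale_left star_scale_right)

sublocale graded_product scale W degree_star
  by unfold_locales (rule degree_star_bilinear)

lemma degree_star_D_left:
  assumes f: "f \<in> total (W i)" and g: "g \<in> total (W j)"
  shows "degree_star i j (D (arity i) f) g k =
    times_var (degree_star i j f g) k + D (arity (i + j)) (degree_star i j f g k)"
proof (cases "0 \<le> i \<and> -1 \<le> j")
  case True
  then show ?thesis
    using star_D_left[OF f[THEN W.total_W_space_subset] g[THEN W.total_W_space_subset]] by (simp add: arity_add)
next
  case False
  have "D (arity i) f \<in> total (W i)"
    using diff_superspace.D_total[OF W.W_space_diff_superspace f] .
  then have "degree_star i j (D (arity i) f) g k = 0" "degree_star i j f g l = 0" for l
    using f g False by (auto intro!: degree_star_0)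
  then show ?thesis by (cases k) (simp_all add: times_var_0 times_var_Suc P.D_0)
qed

lemma degree_star_right_symmetric:
  assumes f: "f \<in> total (W i)" and g: "g \<in> W j p" and h: "h \<in> W l r"
  shows "degree_star (i + j) l (degree_star i j f g a) h b
      - expand_sum scale (\<lambda>k. degree_star i (j + l) f (degree_star j l g h k)) b a =
    scale (koszul_sign p r) (degree_star (i + l) j (degree_star i l f h b) g a
      - expand_sum scale (\<lambda>k. degree_star i (l + j) f (degree_star l j h g k)) a b)"
proof (cases "0 \<le> i \<and> -1 \<le> j \<and> -1 \<le> l")
  case True
  have gh: "g \<in> P (arity j) p" "invariant (arity j) g" "h \<in> P (arity l) r" "invariant (arity l) h"
    using g h True component_iff by auto
  have ff: "f \<in> total (P (arity i))" "invariant (arity i) f"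
    using f True invariant_iff by auto
  have e: "arity (j + l) = arity l + arity j - 1" "arity (l + j) = arity j + arity l - 1"
    using True by (auto simp: arity_def)
  show ?thesis
    using right_symmetric_star[OF ff gh] True by (simp only: arity_add e)
next
  case False
  have t: "g \<in> total (W j)" "h \<in> total (W l)" using g h family.comp.in_total by blast+
  have gh: "degree_star j l g h k \<in> total (W (j + l))" "degree_star l j h g k \<in> total (W (l + j))" for k
    using product_component[OF g h] product_component[OF h g] family.comp.in_total by blast+
  have z: "degree_star i j f g a = 0 \<or> h = 0" "degree_star i l f h b = 0 \<or> g = 0"
    using False degree_star_0[OF _ f t(1)] degree_star_0[OF _ f t(2)] t
      total_W_space_degenerate[of j P act] total_W_space_degenerate[of l P act] by auto
  have u: "i < 0 \<or> g = 0 \<or> h = 0"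
    using False t total_W_space_degenerate[of j P act] total_W_space_degenerate[of l P act] by auto
  have fg: "degree_star i j f g a \<in> total (W (i + j))" "degree_star i l f h b \<in> total (W (i + l))"
    by (rule product_total[OF f t(1)], rule product_total[OF f t(2)])
  have 1: "degree_star (i + j) l (degree_star i j f g a) h b = 0"
    using z(1) fg(1) t(2) product_zero_left[OF t(2)] product_zero_right[OF fg(1)] by auto
  have 2: "degree_star (i + l) j (degree_star i l f h b) g a = 0"
    using z(2) fg(2) t(1) product_zero_left[OF t(1)] product_zero_right[OF fg(2)] by auto
  have 3: "degree_star i (j + l) f (degree_star j l g h k) b' = 0" for k b'
  proof (cases "i < 0")
    case True
    then show ?thesis using degree_star_0 f gh by blast
  next
    case False
    then have "degree_star j l g h k = 0"
      using u product_zero_left[OF t(2)] product_zero_right[OF t(1)] by auto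
    then show ?thesis using product_zero_right[OF f] by simp
  qed
  have 4: "degree_star i (l + j) f (degree_star l j h g k) b' = 0" for k b'
  proof (cases "i < 0")
    case True
    then show ?thesis using degree_star_0 f gh by blast
  next
    case False
    then have "degree_star l j h g k = 0"
      using u product_zero_left[OF t(1)] product_zero_right[OF t(2)] by auto
    then show ?thesis using product_zero_right[OF f] by simp
  qed
  show ?thesis unfolding 1 2 by (simp add: expand_sum_def 3 4)
qed

abbreviation "algebra \<equiv> direct_sum W"
abbreviation "algebra_D \<equiv> Poly_Mapping.mapp (\<lambda>i. D (arity i))"
abbreviation "algebra_q q \<equiv> direct_sum (Wq q)"
abbreviation "algebra_Dq q \<equiv> Poly_Mapping.mapp (\<lambda>i. Dq q (arity i))"
abbreviation "algebra_pr q \<equiv> Poly_Mapping.mapp (\<lambda>i. pr q (arity i))"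
abbreviation "algebra_star \<equiv> bilinear_sum degree_star"

lemma algebra_diff_superspace: "diff_superspace (scale_family scale) algebra algebra_D"
  by (intro diff_superspace_direct_sum W.W_space_diff_superspace)

lemma algebra_q_diff_superspace: "diff_superspace (scale_family scaleq) (algebra_q q) (algebra_Dq q)"
  by (intro diff_superspace_direct_sum Wq.W_space_diff_superspace)

sublocale algebra: diff_superspace "scale_family scale" algebra algebra_D
  by (rule algebra_diff_superspace)

lemma lookup_algebra_D: "Poly_Mapping.lookup (algebra_D x) i = D (arity i) (Poly_Mapping.lookup x i)"
  by (rule lookup_mapp_0) (rule P.D_0)

lemma lookup_algebra_Dq: "Poly_Mapping.lookup ((algebra_Dq q ^^ d) x) i = (Dq q (arity i) ^^ d) (Poly_Mapping.lookup x i)"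
  by (simp add: mapp_power Pq.D_0 lookup_mapp_0 Pq.Dpow_0)

lemma lookup_algebra_pr: "Poly_Mapping.lookup (algebra_pr q x) i = pr q (arity i) (Poly_Mapping.lookup x i)"
  by (rule lookup_mapp_0) (rule pr_0)

lemma lookup_scaleq: "Poly_Mapping.lookup (scale_family scaleq c x) i = scaleq c (Poly_Mapping.lookup x i)"
  by (rule lookup_mapp_0) simp

lemma algebra_pr_diff_hom:
  "diff_hom (scale_family scale) algebra algebra_D (scale_family scaleq) (algebra_q q) (algebra_Dq q) (algebra_pr q)"
  by (intro diff_hom_direct_sum W.W_space_diff_superspace Wq.W_space_diff_superspace pr_W_diff_hom)

lemma algebra_tr_diff_hom:
  "diff_hom (scale_family scaleq) (algebra_q (Suc q)) (algebra_Dq (Suc q))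
    (scale_family scaleq) (algebra_q q) (algebra_Dq q) (Poly_Mapping.mapp (\<lambda>i. tr q (arity i)))"
  by (intro diff_hom_direct_sum Wq.W_space_diff_superspace tr_W_diff_hom)

lemma algebra_star_D_left:
  assumes x: "x \<in> total algebra" and y: "y \<in> total algebra"
  shows "algebra_star (algebra_D x) y k = times_var (algebra_star x y) k + algebra_D (algebra_star x y k)"
proof -
  let ?A = "Poly_Mapping.keys x" and ?B = "Poly_Mapping.keys y"
  let ?x = "Poly_Mapping.lookup x" and ?y = "Poly_Mapping.lookup y"
  note xy = family.lookup_total[OF x] family.lookup_total[OF y]
  have "algebra_star (algebra_D x) y k =
      (\<Sum>i\<in>?A. \<Sum>j\<in>?B. Poly_Mapping.single (i + j) (degree_star i j (D (arity i) (?x i)) (?y j) k))"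
    by (subst bilinear_sum_eq[of _ _ ?A ?B])
      (use x y in \<open>simp_all add: algebra.D_total lookup_algebra_D keys_mapp_subset\<close>)
  also have "\<dots> = (\<Sum>i\<in>?A. \<Sum>j\<in>?B. Poly_Mapping.single (i + j) (times_var (degree_star i j (?x i) (?y j)) k))
      + (\<Sum>i\<in>?A. \<Sum>j\<in>?B. Poly_Mapping.single (i + j) (D (arity (i + j)) (degree_star i j (?x i) (?y j) k)))"
    using xy by (simp add: degree_star_D_left single_add sum.distrib)
  also have "(\<Sum>i\<in>?A. \<Sum>j\<in>?B. Poly_Mapping.single (i + j) (times_var (degree_star i j (?x i) (?y j)) k)) =
      times_var (algebra_star x y) k"
    by (cases k) (simp_all add: times_var_0 times_var_Suc bilinear_sum_def)
  also have "(\<Sum>i\<in>?A. \<Sum>j\<in>?B. Poly_Mapping.single (i + j) (D (arity (i + j)) (degree_star i j (?x i) (?y j) k))) =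
      algebra_D (algebra_star x y k)"
  proof -
    have t: "Poly_Mapping.single (i + j) (degree_star i j (?x i) (?y j) k) \<in> total algebra" for i j
      by (intro family.single_total product_total xy)
    show ?thesis
      unfolding bilinear_sum_def using t
      by (simp add: algebra.D_sum family.sum.total_sum mapp_single P.D_0)
  qed
  finally show ?thesis .
qed

lemma algebra_star_D_right:
  assumes x: "x \<in> total algebra" and y: "y \<in> total algebra"
  shows "algebra_star x (algebra_D y) k = - times_var (algebra_star x y) k"
proof -
  let ?A = "Poly_Mapping.keys x" and ?B = "Poly_Mapping.keys y"
  let ?x = "Poly_Mapping.lookup x" and ?y = "Poly_Mapping.lookup y"
  note xy = family.lookup_total[OF x, THEN W.total_W_space_subset] family.lookup_total[OF y, THEN W.total_W_space_subset]
  have "algebra_star x (algebra_D y) k =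
      (\<Sum>i\<in>?A. \<Sum>j\<in>?B. Poly_Mapping.single (i + j) (degree_star i j (?x i) (D (arity j) (?y j)) k))"
    by (subst bilinear_sum_eq[of _ _ ?A ?B])
      (use x y in \<open>simp_all add: algebra.D_total lookup_algebra_D keys_mapp_subset\<close>)
  also have "\<dots> = - times_var (algebra_star x y) k"
    using xy by (cases k)
      (simp_all add: star_D_right times_var_0 times_var_Suc bilinear_sum_def single_uminus sum_negf)
  finally show ?thesis .
qed

lemma algebra_star_add:
  assumes "x \<in> total algebra" "x' \<in> total algebra" "y \<in> total algebra"
  shows "algebra_star (x + x') y k = algebra_star x y k + algebra_star x' y k"
    and "algebra_star y (x + x') k = algebra_star y x k + algebra_star y x' k"
  using even_bilinear_sum assms by (auto simp: even_bilinear_series_def)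

lemma algebra_star_total:
  assumes x: "x \<in> total algebra" and y: "y \<in> total algebra"
  shows "algebra_star x y k \<in> total algebra"
  unfolding bilinear_sum_def
  by (intro family.sum.total_sum family.single_total product_total family.lookup_total x y)

lemma algebra_star_0:
  "algebra_star 0 y k = 0" "algebra_star x 0 k = 0"
  by (simp_all add: bilinear_sum_def)

definition associator :: "(int \<Rightarrow>\<^sub>0 'a) \<Rightarrow> (int \<Rightarrow>\<^sub>0 'a) \<Rightarrow> (int \<Rightarrow>\<^sub>0 'a) \<Rightarrow> nat \<Rightarrow> nat \<Rightarrow> (int \<Rightarrow>\<^sub>0 'a)" where
  "associator x y z a b = algebra_star (algebra_star x y a) z b
     - expand_sum (scale_family scale) (\<lambda>k. algebra_star x (algebra_star y z k)) b a"

lemma associator_0: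
  "associator 0 y z a b = 0" "associator x 0 z a b = 0" "associator x y 0 a b = 0"
  by (simp_all add: associator_def expand_sum_def algebra_star_0)

lemma associator_add:
  assumes "u \<in> total algebra" "u' \<in> total algebra" "x \<in> total algebra" "y \<in> total algebra"
  shows "associator (u + u') x y a b = associator u x y a b + associator u' x y a b"
    and "associator x (u + u') y a b = associator x u y a b + associator x u' y a b"
    and "associator x y (u + u') a b = associator x y u a b + associator x y u' a b"
  using assms
  by (simp_all add: associator_def expand_sum_def algebra_star_add algebra_star_total
      family.sum.scale_right_distrib sum.distrib family.sum.total_add)

lemma associator_single:
  assumes f: "f \<in> total (W i)" and g: "g \<in> total (W j)" and h: "h \<in> total (W l)"
  shows "associator (Poly_Mapping.single i f) (Poly_Mapping.single j g) (Poly_Mapping.single l h) a b =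
    Poly_Mapping.single (i + j + l) (degree_star (i + j) l (degree_star i j f g a) h b
      - expand_sum scale (\<lambda>k. degree_star i (j + l) f (degree_star j l g h k)) b a)"
proof -
  have "expand_sum (scale_family scale) (\<lambda>k. algebra_star (Poly_Mapping.single i f)
      (algebra_star (Poly_Mapping.single j g) (Poly_Mapping.single l h) k)) b a =
      Poly_Mapping.single (i + j + l) (expand_sum scale (\<lambda>k. degree_star i (j + l) f (degree_star j l g h k)) b a)"
    unfolding expand_sum_def
    by (simp add: bilinear_sum_single f g h product_total family.scale_single single_sum add.assoc)
  then show ?thesis
    by (simp add: associator_def bilinear_sum_single f g h product_total single_diff)
qed

text \<open>
  Both sides are additive in each argument, so the identity reduces to elements concentrated in a
  single degree.
\<close>

lemma algebra_right_symmetric: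
  assumes x: "x \<in> total algebra" and y: "y \<in> algebra p" and z: "z \<in> algebra r"
  shows "associator x y z a b = scale_family scale (koszul_sign p r) (associator x z y b a)"
proof -
  let ?s = "scale_family scale (koszul_sign p r) :: (int \<Rightarrow>\<^sub>0 'a) \<Rightarrow> _"
  have single: "associator x y z a b = ?s (associator x z y b a)"
    if "f \<in> total (W i)" "g \<in> W j p" "h \<in> W l r" "x = Poly_Mapping.single i f"
      "y = Poly_Mapping.single j g" "z = Poly_Mapping.single l h" for i j l f g h x y z
    using degree_star_right_symmetric[OF that(1-3), of a b] that(1) that(2,3)[THEN family.comp.in_total]
    unfolding that(4-6) by (simp add: associator_single family.scale_single add.assoc add.commute[of l j])
  note dist = family.sum.scale_right_distrib
  have 1: "associator x y z a b = ?s (associator x z y b a)"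
    if "f \<in> total (W i)" "g \<in> W j p" and x: "x = Poly_Mapping.single i f" and y: "y = Poly_Mapping.single j g"
      and z: "z \<in> algebra r" for i j f g x y z
  proof -
    have t: "x \<in> total algebra" "y \<in> total algebra"
      using that family.comp.in_total family.single_total by blast+
    show ?thesis using z
    proof (induction z rule: direct_sum_induct)
      case (add u v)
      then have "u \<in> total algebra" "v \<in> total algebra" using family.sum.in_total by blast+
      then show ?case using add t by (simp add: associator_add dist)
    qed (use that single in \<open>auto simp: associator_0 family.comp.component_0\<close>)
  qed
  have 2: "associator x y z a b = ?s (associator x z y b a)"
    if "f \<in> total (W i)" and x: "x = Poly_Mapping.single i f" and y: "y \<in> algebra p" and z: "z \<in> algebra r" for i f x y z
  proof -
    have t: "x \<in> total algebra" "z \<in> total algebra"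
      using that family.single_total family.sum.in_total by blast+
    show ?thesis using y
    proof (induction y rule: direct_sum_induct)
      case (add u v)
      then have "u \<in> total algebra" "v \<in> total algebra" using family.sum.in_total by blast+
      then show ?case using add t by (simp add: associator_add dist)
    qed (use that 1 in \<open>auto simp: associator_0 family.comp.component_0\<close>)
  qed
  have t: "y \<in> total algebra" "z \<in> total algebra" using y z family.sum.in_total by blast+
  have tx: "u \<in> total algebra" if "u \<in> direct_sum (\<lambda>i _. total (W i)) 0" for u
    using that family.total_direct_sum[of 0] by simp
  have "x \<in> direct_sum (\<lambda>i _. total (W i)) 0" using x family.total_direct_sum[of 0] by simp
  then show ?thesis
  proof (induction x rule: direct_sum_induct)
    case (add u v)
    then show ?case using add tx t by (simp add: associator_add dist)
  qed (use y z 2 in \<open>auto simp: associator_0 family.comp.total_0\<close>)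
qed

lemma algebra_pr_star_single:
  assumes x: "x \<in> total algebra" and y: "y \<in> total algebra"
  shows "algebra_pr q (algebra_star x y k) = (\<Sum>i\<in>Poly_Mapping.keys x. \<Sum>j\<in>Poly_Mapping.keys y.
    Poly_Mapping.single (i + j) (pr q (arity (i + j)) (degree_star i j (Poly_Mapping.lookup x i) (Poly_Mapping.lookup y j) k)))"
proof -
  have lin: "even_linear (scale_family scale) algebra (scale_family scaleq) (algebra_q q) (algebra_pr q)"
    using algebra_pr_diff_hom unfolding diff_hom_def by blast
  have t: "Poly_Mapping.single (i + j) (degree_star i j (Poly_Mapping.lookup x i) (Poly_Mapping.lookup y j) k) \<in> total algebra" for i j
    by (intro family.single_total product_total family.lookup_total x y)
  show ?thesis
    unfolding bilinear_sum_def using t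
    by (simp add: even_linear_sum[OF family.sum.superspace_axioms lin] family.sum.total_sum mapp_single pr_0)
qed

lemma degree_star_polynomial:
  assumes f: "f \<in> total (W i)" and g: "g \<in> total (W j)"
  shows "finite {k. pr q (arity (i + j)) (degree_star i j f g k) \<noteq> 0}"
proof (cases "0 \<le> i \<and> -1 \<le> j")
  case False
  then have "degree_star i j f g k = 0" for k using degree_star_0 f g by auto
  then show ?thesis by (simp add: pr_0)
next
  case True
  let ?n = "arity i" and ?m = "arity j" and ?N = "arity (i + j)"
  have n: "1 \<in> {1..?n}" using True by (simp add: arity_def le_nat_iff)
  have N: "?N = ?m + ?n - 1" using True by (simp add: arity_add)
  have ft: "f \<in> total (P ?n)" "g \<in> total (P ?m)" using f g W.total_W_space_subset by blast+
  note ct = circ_total[OF n ft, folded N]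
  have "pr q ?N (degree_star i j f g k) = 0" if "pr q ?N (circ ?n ?m 1 f g k) = 0" for k
  proof -
    have "pr q ?N (symmetrize ?N (circ ?n ?m 1 f g k)) = (\<Sum>\<pi> | \<pi> permutes {1..?N}. actq q ?N \<pi> (pr q ?N (circ ?n ?m 1 f g k)))"
      unfolding symmetrize_def using ct by (subst pr_sum) (auto simp: act_total pr_act)
    also have "\<dots> = 0"
      unfolding that using even_linear_0[OF Pq.superspace_axioms Pq.act_even_linear] by simp
    finally show ?thesis
      using ct by (simp add: star_def pr_0 pr_scale symmetrize_total N[symmetric])
  qed
  then have "{k. pr q ?N (degree_star i j f g k) \<noteq> 0} \<subseteq> {k. pr q ?N (circ ?n ?m 1 f g k) \<noteq> 0}" by blast
  then show ?thesis using circ_polynomial[OF n ft, of q, folded N] finite_subset by blast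
qed

lemma algebra_star_polynomial:
  assumes x: "x \<in> total algebra" and y: "y \<in> total algebra"
  shows "finite {k. algebra_pr q (algebra_star x y k) \<noteq> 0}"
proof (rule finite_subset)
  let ?S = "\<lambda>i j. {k. pr q (arity (i + j)) (degree_star i j (Poly_Mapping.lookup x i) (Poly_Mapping.lookup y j) k) \<noteq> 0}"
  show "finite (\<Union>i\<in>Poly_Mapping.keys x. \<Union>j\<in>Poly_Mapping.keys y. ?S i j)"
    by (intro finite_UN_I finite_keys degree_star_polynomial family.lookup_total x y)
  show "{k. algebra_pr q (algebra_star x y k) \<noteq> 0} \<subseteq> (\<Union>i\<in>Poly_Mapping.keys x. \<Union>j\<in>Poly_Mapping.keys y. ?S i j)"
  proof (rule subsetI, rule ccontr)
    fix k assume k: "k \<in> {k. algebra_pr q (algebra_star x y k) \<noteq> 0}"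
      and "k \<notin> (\<Union>i\<in>Poly_Mapping.keys x. \<Union>j\<in>Poly_Mapping.keys y. ?S i j)"
    then have "algebra_pr q (algebra_star x y k) = 0"
      unfolding algebra_pr_star_single[OF x y] by (intro sum.neutral ballI) auto
    then show False using k by simp
  qed
qed

text \<open>
  A product of two finitely supported families has coefficients in finitely many fixed degrees, so the
  series may be summed degree by degree.
\<close>

lemma algebra_star_complete:
  assumes x: "x \<in> total algebra" and y: "y \<in> total algebra"
  shows "\<exists>u\<in>total algebra. \<forall>q. algebra_pr q u =
    (\<Sum>k | algebra_pr q (algebra_star x y k) \<noteq> 0.
      scale_family scaleq (c k) ((algebra_Dq q ^^ e k) (algebra_pr q (algebra_star x y k))))"
proof -
  let ?a = "\<lambda>k. algebra_star x y k"
  let ?l = "Poly_Mapping.lookup"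
  have a: "?a k \<in> total algebra" for k by (rule algebra_star_total[OF x y])
  have l: "?l (?a k) d \<in> total (W d)" for k d by (rule family.lookup_total[OF a])
  have fin: "finite {k. pr q (arity d) (?l (?a k) d) \<noteq> 0}" for q d
    by (rule finite_subset[OF _ algebra_star_polynomial[OF x y, of q]])
      (auto simp: lookup_algebra_pr[symmetric])
  have "\<exists>u. u \<in> total (W d) \<and> (\<forall>q. pr q (arity d) u = (\<Sum>k | pr q (arity d) (?l (?a k) d) \<noteq> 0.
      scaleq (c k) ((Dq q (arity d) ^^ e k) (pr q (arity d) (?l (?a k) d)))))" for d
    by (rule ex1_implies_ex, rule limit_completion[OF W.W_space_diff_superspace Wq.W_space_diff_superspace
        tr_W_diff_hom pr_W_diff_hom W_limit l fin])
  then obtain u where u: "\<And>d. u d \<in> total (W d)" "\<And>d q. pr q (arity d) (u d) =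
      (\<Sum>k | pr q (arity d) (?l (?a k) d) \<noteq> 0.
        scaleq (c k) ((Dq q (arity d) ^^ e k) (pr q (arity d) (?l (?a k) d))))" by metis
  define S where "S = (\<lambda>(i, j). i + j) ` (Poly_Mapping.keys x \<times> Poly_Mapping.keys y)"
  have S: "finite S" by (simp add: S_def)
  have out: "?l (?a k) d = 0" if "d \<notin> S" for k d
  proof -
    have "i + j \<noteq> d" if "i \<in> Poly_Mapping.keys x" "j \<in> Poly_Mapping.keys y" for i j
      using that \<open>d \<notin> S\<close> by (auto simp: S_def)
    then show ?thesis
      unfolding bilinear_sum_def lookup_sum by (intro sum.neutral ballI) (simp add: lookup_single when_def)
  qed
  define v where "v = (\<Sum>d\<in>S. Poly_Mapping.single d (u d))"
  have lv: "?l v d = (if d \<in> S then u d else 0)" for d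
    using S by (simp add: v_def lookup_sum lookup_single when_def)
  have "v \<in> total algebra"
    unfolding v_def by (intro family.sum.total_sum family.single_total u)
  moreover have "algebra_pr q v = (\<Sum>k | algebra_pr q (?a k) \<noteq> 0.
      scale_family scaleq (c k) ((algebra_Dq q ^^ e k) (algebra_pr q (?a k))))" for q
  proof (rule poly_mapping_eqI)
    fix d
    let ?t = "\<lambda>k. scaleq (c k) ((Dq q (arity d) ^^ e k) (pr q (arity d) (?l (?a k) d)))"
    have "?l (\<Sum>k | algebra_pr q (?a k) \<noteq> 0.
        scale_family scaleq (c k) ((algebra_Dq q ^^ e k) (algebra_pr q (?a k)))) d =
        (\<Sum>k | algebra_pr q (?a k) \<noteq> 0. ?t k)"
      by (simp add: lookup_sum lookup_scaleq lookup_algebra_Dq lookup_algebra_pr)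
    also have "\<dots> = (\<Sum>k | pr q (arity d) (?l (?a k) d) \<noteq> 0. ?t k)"
    proof (rule sum.mono_neutral_right[OF algebra_star_polynomial[OF x y]])
      show "{k. pr q (arity d) (?l (?a k) d) \<noteq> 0} \<subseteq> {k. algebra_pr q (?a k) \<noteq> 0}"
        by (auto simp: lookup_algebra_pr[symmetric])
    qed (auto simp: Pq.Dpow_0)
    also have "\<dots> = ?l (algebra_pr q v) d"
      using u(2)[of q d] out[of d] by (simp add: lookup_algebra_pr lv pr_0)
    finally show "?l (algebra_pr q v) d = ?l (\<Sum>k | algebra_pr q (?a k) \<noteq> 0.
        scale_family scaleq (c k) ((algebra_Dq q ^^ e k) (algebra_pr q (?a k)))) d" by simp
  qed
  ultimately show ?thesis by blast
qed

sublocale rs: pro_right_symmetric "scale_family scale" algebra algebra_D algebra_star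
  "scale_family scaleq" algebra_q algebra_Dq algebra_pr
proof (intro pro_right_symmetric.intro pro_right_symmetric_axioms.intro)
  show "diff_superspace (scale_family scale) algebra algebra_D"
    by (rule algebra_diff_superspace)
  show "even_bilinear_series (scale_family scale) algebra algebra algebra algebra_star"
    by (rule even_bilinear_sum)
  show "algebra_star (algebra_D f) g k = times_var (algebra_star f g) k + algebra_D (algebra_star f g k)"
    if "f \<in> total algebra" "g \<in> total algebra" for f g k
    using that by (rule algebra_star_D_left)
  show "algebra_star f (algebra_D g) k = - times_var (algebra_star f g) k"
    if "f \<in> total algebra" "g \<in> total algebra" for f g k
    using that by (rule algebra_star_D_right)
  show "algebra_star (algebra_star f g a) h b -
      expand_sum (scale_family scale) (\<lambda>k. algebra_star f (algebra_star g h k)) b a =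
    scale_family scale (koszul_sign p r) (algebra_star (algebra_star f h b) g a -
      expand_sum (scale_family scale) (\<lambda>k. algebra_star f (algebra_star h g k)) a b)"
    if "f \<in> total algebra" "g \<in> algebra p" "h \<in> algebra r" for f g p h r a b
    using algebra_right_symmetric[OF that] unfolding associator_def .
  show "diff_superspace (scale_family scaleq) (algebra_q q) (algebra_Dq q)" for q
    by (rule algebra_q_diff_superspace)
  show "diff_hom (scale_family scale) algebra algebra_D (scale_family scaleq) (algebra_q q) (algebra_Dq q) (algebra_pr q)" for q
    by (rule algebra_pr_diff_hom)
  show "x = 0" if x: "x \<in> total algebra" and z: "\<And>q. algebra_pr q x = 0" for x
  proof (rule poly_mapping_eqI)
    fix i
    have "Poly_Mapping.lookup x i = 0"
    proof (rule pr_injective)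
      show "Poly_Mapping.lookup x i \<in> total (P (arity i))"
        using family.lookup_total[OF x] W.total_W_space_subset by blast
      show "pr q (arity i) (Poly_Mapping.lookup x i) = pr q (arity i) 0" for q
        using arg_cong[OF z[of q], of "\<lambda>x. Poly_Mapping.lookup x i"] by (simp add: lookup_algebra_pr pr_0)
    qed (rule P.total_0)
    then show "Poly_Mapping.lookup x i = Poly_Mapping.lookup 0 i" by simp
  qed
  show "finite {k. algebra_pr q (algebra_star f g k) \<noteq> 0}"
    if "f \<in> total algebra" "g \<in> total algebra" for f g q
    using that by (rule algebra_star_polynomial)
  show "\<exists>y\<in>total algebra. \<forall>q. algebra_pr q y = (\<Sum>k | algebra_pr q (algebra_star f g k) \<noteq> 0.
      scale_family scaleq (c k) ((algebra_Dq q ^^ e k) (algebra_pr q (algebra_star f g k))))"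
    if "f \<in> total algebra" "g \<in> total algebra" for f g c e
    using that by (rule algebra_star_complete)
qed

lemma subst_series_spec:
  fixes j :: nat
  assumes a: "\<And>k. a k \<in> total (P n)" and fin: "\<And>q. finite {k. pr q n (a k) \<noteq> 0}"
  defines "s \<equiv> subst_series (total (P n)) scaleq (\<lambda>q. Dq q n) (\<lambda>q. pr q n) a j"
  shows "s \<in> total (P n)" "pr q n s = subst_poly scaleq (Dq q n) (\<lambda>k. pr q n (a k)) j"
proof -
  have eq: "(\<Sum>k | pr q n (a k) \<noteq> 0. scaleq ((- 1) ^ k * of_nat (k choose j)) ((Dq q n ^^ (k - j)) (pr q n (a k)))) =
      subst_poly scaleq (Dq q n) (\<lambda>k. pr q n (a k)) j" for q
    unfolding subst_poly_def by (rule sum.mono_neutral_right[OF fin]) (auto simp: not_le)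
  have "\<exists>!y. y \<in> total (P n) \<and> (\<forall>q. pr q n y = subst_poly scaleq (Dq q n) (\<lambda>k. pr q n (a k)) j)"
    unfolding eq[symmetric]
    by (rule limit_completion[OF P.diff_superspace_axioms Pq.diff_superspace_axioms tr_diff_hom pr_diff_hom limit a fin])
  from theI'[OF this] show "s \<in> total (P n)" "pr q n s = subst_poly scaleq (Dq q n) (\<lambda>k. pr q n (a k)) j"
    unfolding s_def subst_series_def by blast+
qed

context
  fixes n m :: int and f g :: 'a
  assumes nm: "n \<ge> -1" "m \<ge> -1" and f: "f \<in> total (W n)" and g: "g \<in> total (W m)"
begin

text \<open>
  The substitution of \<open>- \<lambda> - \<partial>\<close> commutes with the sum over shuffles, because the group action commutes
  with the endomorphisms at each level.
\<close>

lemma pr_box: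
  shows "box P act circ scaleq Dq pr n m f g k \<in> total (P (arity (n + m)))"
    and "pr q (arity (n + m)) (box P act circ scaleq Dq pr n m f g k) =
      subst_poly scaleq (Dq q (arity (n + m))) (\<lambda>k. pr q (arity (n + m)) (degree_star n m f g k)) k"
proof -
  let ?N = "arity (n + m)" and ?c = "circ (arity n) (arity m) 1 f g"
  let ?s = "\<lambda>k. subst_series (total (P ?N)) scaleq (\<lambda>q. Dq q ?N) (\<lambda>q. pr q ?N) ?c k"
  have "box P act circ scaleq Dq pr n m f g k \<in> total (P ?N) \<and>
    pr q ?N (box P act circ scaleq Dq pr n m f g k) =
      subst_poly scaleq (Dq q ?N) (\<lambda>k. pr q ?N (degree_star n m f g k)) k"
  proof (cases "0 \<le> n")
    case False
    then have "box P act circ scaleq Dq pr n m f g k = 0" by (simp add: box_def shuffles_def)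
    moreover have "degree_star n m f g k = 0" for k using False f g by (intro degree_star_0) auto
    ultimately show ?thesis by (simp add: pr_0 P.total_0 subst_poly_def)
  next
    case True
    have n: "1 \<in> {1..arity n}" using True by (simp add: arity_def le_nat_iff)
    have N: "?N = arity m + arity n - 1" using True nm by (simp add: arity_add)
    have ft: "f \<in> total (P (arity n))" "g \<in> total (P (arity m))" using f g W.total_W_space_subset by blast+
    have inv: "invariant (arity n) f" "invariant (arity m) g" using f g nm by (simp_all add: invariant_iff)
    have ct: "?c k \<in> total (P ?N)" for k unfolding N by (rule circ_total[OF n ft])
    have cf: "finite {k. pr q ?N (?c k) \<noteq> 0}" for q unfolding N by (rule circ_polynomial[OF n ft])
    note spec = subst_series_spec[OF ct cf]
    have sh: "shuffles (m + 1) n = shuffles (int (arity m)) (int (arity n - 1))"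
      using True nm by (simp add: arity_def)
    have perm: "inv \<sigma> permutes {1..?N}" if "\<sigma> \<in> shuffles (m + 1) n" for \<sigma>
    proof -
      have "\<sigma> permutes {1..?N}" using that True nm by (simp add: shuffles_def arity_def add.commute add.left_commute)
      then show ?thesis by (rule permutes_inv)
    qed
    have star: "degree_star n m f g k = (\<Sum>\<sigma>\<in>shuffles (m + 1) n. act ?N (inv \<sigma>) (?c k))" for k
      using star_eq_sum_shuffles[where n = "arity n" and f = f and m = "arity m" and g = g and k = k] n ft inv unfolding sh N by simp
    have box: "box P act circ scaleq Dq pr n m f g k = (\<Sum>\<sigma>\<in>shuffles (m + 1) n. act ?N (inv \<sigma>) (?s k))"
      by (simp add: box_def Let_def)
    have mem: "box P act circ scaleq Dq pr n m f g k \<in> total (P ?N)"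
      unfolding box by (intro P.total_sum act_total perm spec)
    obtain K where K: "\<And>k. K \<le> k \<Longrightarrow> pr q ?N (?c k) = 0"
      using Pq.polynomial_iff[of q ?N "\<lambda>k. pr q ?N (?c k)"] cf[of q] pr_total ct
      unfolding Pq.polynomial_def by blast
    have star_pr: "pr q ?N (degree_star n m f g k) = (\<Sum>\<sigma>\<in>shuffles (m + 1) n. actq q ?N (inv \<sigma>) (pr q ?N (?c k)))" for k
      unfolding star by (subst pr_sum) (auto simp: act_total perm ct pr_act intro!: sum.cong)
    have a0: "actq q ?N (inv \<sigma>) 0 = 0" if "\<sigma> \<in> shuffles (m + 1) n" for \<sigma>
      using even_linear_0[OF Pq.superspace_axioms Pq.act_even_linear[OF perm[OF that]]] .
    have K': "pr q ?N (degree_star n m f g k) = 0" if "K \<le> k" for k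
      unfolding star_pr using K[OF that] a0 by simp
    have actq_term: "actq q ?N (inv \<sigma>) (scaleq c ((Dq q ?N ^^ d) x)) = scaleq c ((Dq q ?N ^^ d) (actq q ?N (inv \<sigma>) x))"
      if s: "\<sigma> \<in> shuffles (m + 1) n" and x: "x \<in> total (Pq q ?N)" for \<sigma> c d x
    proof -
      note lin = Pq.act_even_linear[OF perm[OF s], of q]
      have "actq q ?N (inv \<sigma>) ((Dq q ?N ^^ d) x) = (Dq q ?N ^^ d) (actq q ?N (inv \<sigma>) x)"
        using x by (induction d) (simp_all add: Pq.act_D[OF perm[OF s]] Pq.Dpow_total)
      then show ?thesis using lin Pq.Dpow_total[OF x] unfolding even_linear_def by simp
    qed
    have act_t: "actq q ?N (inv \<sigma>) x \<in> total (Pq q ?N)" if "\<sigma> \<in> shuffles (m + 1) n" "x \<in> total (Pq q ?N)" for \<sigma> x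
      using even_linear_total[OF Pq.superspace_axioms Pq.superspace_axioms Pq.act_even_linear[OF perm[OF that(1)]] that(2)] .
    have pct: "pr q ?N (?c k) \<in> total (Pq q ?N)" for k by (rule pr_total[OF ct])
    have "pr q ?N (box P act circ scaleq Dq pr n m f g k) =
        (\<Sum>\<sigma>\<in>shuffles (m + 1) n. actq q ?N (inv \<sigma>) (pr q ?N (?s k)))"
      unfolding box by (subst pr_sum) (auto simp: act_total perm spec(1) pr_act intro!: sum.cong)
    also have "\<dots> = (\<Sum>\<sigma>\<in>shuffles (m + 1) n. \<Sum>i\<in>{k..<K}.
        scaleq ((- 1) ^ i * of_nat (i choose k)) ((Dq q ?N ^^ (i - k)) (actq q ?N (inv \<sigma>) (pr q ?N (?c i)))))"
    proof (intro sum.cong refl)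
      fix \<sigma> assume s: "\<sigma> \<in> shuffles (m + 1) n"
      have "pr q ?N (?s k) = (\<Sum>i\<in>{k..<K}. scaleq ((- 1) ^ i * of_nat (i choose k)) ((Dq q ?N ^^ (i - k)) (pr q ?N (?c i))))"
        unfolding spec(2) by (rule Pq.subst_poly_eq) (rule K)
      then show "actq q ?N (inv \<sigma>) (pr q ?N (?s k)) = (\<Sum>i\<in>{k..<K}.
          scaleq ((- 1) ^ i * of_nat (i choose k)) ((Dq q ?N ^^ (i - k)) (actq q ?N (inv \<sigma>) (pr q ?N (?c i)))))"
        using even_linear_sum[OF Pq.superspace_axioms Pq.act_even_linear[OF perm[OF s]], of "{k..<K}"
            "\<lambda>i. scaleq ((- 1) ^ i * of_nat (i choose k)) ((Dq q ?N ^^ (i - k)) (pr q ?N (?c i)))" q]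
        by (simp add: actq_term[OF s] pct Pq.total_scale Pq.Dpow_total)
    qed
    also have "\<dots> = (\<Sum>i\<in>{k..<K}. scaleq ((- 1) ^ i * of_nat (i choose k))
        ((Dq q ?N ^^ (i - k)) (pr q ?N (degree_star n m f g i))))"
      unfolding star_pr
      by (subst sum.swap) (simp add: Pq.Dpow_sum act_t pct Pq.scale_sum_right)
    also have "\<dots> = subst_poly scaleq (Dq q ?N) (\<lambda>k. pr q ?N (degree_star n m f g k)) k"
      by (rule Pq.subst_poly_eq[symmetric]) (rule K')
    finally show ?thesis using mem by blast
  qed
  then show "box P act circ scaleq Dq pr n m f g k \<in> total (P ?N)"
    "pr q ?N (box P act circ scaleq Dq pr n m f g k) =
      subst_poly scaleq (Dq q ?N) (\<lambda>k. pr q ?N (degree_star n m f g k)) k" by blast+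
qed

lemma degree_star_pr_polynomial:
  "Pq.polynomial q (arity (n + m)) (\<lambda>k. pr q (arity (n + m)) (degree_star n m f g k))"
  unfolding Pq.polynomial_iff
  using degree_star_polynomial[OF f g] product_total[OF f g] W.total_W_space_subset pr_total by blast

lemma box_subst_eq: "box_subst P act circ scaleq Dq pr n m f g k = degree_star n m f g k"
proof -
  let ?N = "arity (n + m)" and ?b = "box P act circ scaleq Dq pr n m f g"
  have b: "(\<lambda>k. pr q ?N (?b k)) = subst_poly scaleq (Dq q ?N) (\<lambda>k. pr q ?N (degree_star n m f g k))" for q
    using pr_box(2) by blast
  have fin: "finite {k. pr q ?N (?b k) \<noteq> 0}" for q
    using Pq.polynomial_subst_poly[OF degree_star_pr_polynomial, of q] unfolding Pq.polynomial_iff b[symmetric] by blast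
  note spec = subst_series_spec[OF pr_box(1) fin]
  show ?thesis
  proof (rule pr_injective)
    show "box_subst P act circ scaleq Dq pr n m f g k \<in> total (P ?N)"
      using spec(1) by (simp add: box_subst_def Let_def)
    show "degree_star n m f g k \<in> total (P ?N)"
      using product_total[OF f g] W.total_W_space_subset by blast
    show "pr q ?N (box_subst P act circ scaleq Dq pr n m f g k) = pr q ?N (degree_star n m f g k)" for q
    proof -
      have "pr q ?N (box_subst P act circ scaleq Dq pr n m f g k) =
          subst_poly scaleq (Dq q ?N) (subst_poly scaleq (Dq q ?N) (\<lambda>k. pr q ?N (degree_star n m f g k))) k"
        using spec(2) by (simp add: box_subst_def Let_def b)
      then show ?thesis
        by (simp add: Pq.subst_poly_involution[OF infinite_UNIV_char_0 degree_star_pr_polynomial])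
    qed
  qed
qed

lemma lookup_subst_poly:
  assumes fin: "finite {k. a k \<noteq> 0}"
  shows "Poly_Mapping.lookup (subst_poly (scale_family scaleq) (algebra_Dq q) a j) d =
    subst_poly scaleq (Dq q (arity d)) (\<lambda>k. Poly_Mapping.lookup (a k) d) j"
proof -
  have "Poly_Mapping.lookup (subst_poly (scale_family scaleq) (algebra_Dq q) a j) d =
      (\<Sum>k | j \<le> k \<and> a k \<noteq> 0. scaleq ((- 1) ^ k * of_nat (k choose j)) ((Dq q (arity d) ^^ (k - j)) (Poly_Mapping.lookup (a k) d)))"
    unfolding subst_poly_def by (simp add: lookup_sum lookup_scaleq lookup_algebra_Dq)
  also have "\<dots> = subst_poly scaleq (Dq q (arity d)) (\<lambda>k. Poly_Mapping.lookup (a k) d) j"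
    unfolding subst_poly_def
    by (rule sum.mono_neutral_right) (use fin in \<open>auto simp: Pq.Dpow_0\<close>)
  finally show ?thesis .
qed

text \<open>
  Both sides have the same projections in each degree, and the projections separate points.
\<close>

lemma dstar_single:
  "rs.dstar (Poly_Mapping.single n f) (Poly_Mapping.single m g) k =
    Poly_Mapping.single (n + m) (box P act circ scaleq Dq pr n m f g k)"
proof (rule poly_mapping_eqI)
  fix d
  let ?x = "Poly_Mapping.single n f" and ?y = "Poly_Mapping.single m g"
  let ?b = "box P act circ scaleq Dq pr n m f g k"
  let ?z = "rs.dstar ?x ?y k"
  have t: "?x \<in> total algebra" "?y \<in> total algebra" using f g family.single_total by blast+
  have z: "Poly_Mapping.lookup ?z d \<in> total (P (arity d))"
    using family.lookup_total[OF rs.dstar_total[OF t]] W.total_W_space_subset by blast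
  have prz: "pr q (arity d) (Poly_Mapping.lookup ?z d) = subst_poly scaleq (Dq q (arity d))
      (\<lambda>k. pr q (arity d) (Poly_Mapping.lookup (Poly_Mapping.single (n + m) (degree_star n m f g k)) d)) k" for q
  proof -
    have "pr q (arity d) (Poly_Mapping.lookup ?z d) = Poly_Mapping.lookup (algebra_pr q ?z) d"
      by (simp only: lookup_algebra_pr)
    also have "\<dots> = subst_poly scaleq (Dq q (arity d)) (\<lambda>k. Poly_Mapping.lookup (algebra_pr q (algebra_star ?x ?y k)) d) k"
      unfolding rs.pr_dstar[OF t] by (rule lookup_subst_poly) (rule algebra_star_polynomial[OF t])
    finally show ?thesis by (simp only: lookup_algebra_pr bilinear_sum_single[OF f g])
  qed
  show "Poly_Mapping.lookup ?z d = Poly_Mapping.lookup (Poly_Mapping.single (n + m) ?b) d"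
  proof (rule pr_injective[OF z])
    show "Poly_Mapping.lookup (Poly_Mapping.single (n + m) ?b) d \<in> total (P (arity d))"
      using pr_box(1) P.total_0 by (cases "d = n + m") (simp_all add: lookup_single when_def)
    show "pr q (arity d) (Poly_Mapping.lookup ?z d) =
        pr q (arity d) (Poly_Mapping.lookup (Poly_Mapping.single (n + m) ?b) d)" for q
      unfolding prz by (cases "d = n + m") (simp_all add: lookup_single when_def pr_box(2) pr_0 subst_poly_def)
  qed
qed

end

lemma bracket_single:
  assumes nm: "n \<ge> -1" "m \<ge> -1" and f: "f \<in> W n p" and g: "g \<in> W m r"
  shows "rs.bracket (Poly_Mapping.single n f) (Poly_Mapping.single m g) k =
    Poly_Mapping.single (n + m) (box P act circ scaleq Dq pr n m f g k -
      scale (koszul_sign p r) (box_subst P act circ scaleq Dq pr m n g f k))"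
proof -
  have t: "f \<in> total (W n)" "g \<in> total (W m)" using f g family.comp.in_total by blast+
  show ?thesis
    unfolding rs.bracket_homogeneous[OF family.single_component[OF f] family.single_component[OF g]]
      dstar_single[OF nm t] box_subst_eq[OF nm(2,1) t(2,1)] bilinear_sum_single[OF t(2,1)]
    by (simp add: family.scale_single single_diff add.commute[of m n])
qed

lemma keys_bracket_single:
  assumes f: "f \<in> total (W n)" and g: "g \<in> total (W m)"
  shows "Poly_Mapping.keys (rs.bracket (Poly_Mapping.single n f) (Poly_Mapping.single m g) k) \<subseteq> {n + m}"
proof (cases "n \<ge> -1 \<and> m \<ge> -1")
  case False
  then have "f = 0 \<or> g = 0" using f g total_W_space_degenerate[of n P act] total_W_space_degenerate[of m P act] by auto
  moreover have "rs.bracket 0 y k = 0" "rs.bracket y 0 k = 0" if "y \<in> total algebra" for y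
    using rs.bracket_scale_left[OF family.sum.total_0 that, of 0 k]
      rs.bracket_scale_right[OF that family.sum.total_0, of 0 k] by simp_all
  ultimately show ?thesis using family.single_total[OF f] family.single_total[OF g] by auto
next
  case True
  have hom: "\<exists>v. rs.bracket (Poly_Mapping.single n x) (Poly_Mapping.single m y) k = Poly_Mapping.single (n + m) v"
    if "x \<in> W n p" "y \<in> W m r" for x y p r
    using bracket_single[OF _ _ that] True by blast
  obtain f0 f1 g0 g1 where d: "f0 \<in> W n 0" "f1 \<in> W n 1" "f = f0 + f1" "g0 \<in> W m 0" "g1 \<in> W m 1" "g = g0 + g1"
    using f g unfolding total_def by blast
  obtain a b c e where v:
    "rs.bracket (Poly_Mapping.single n f0) (Poly_Mapping.single m g0) k = Poly_Mapping.single (n + m) a"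
    "rs.bracket (Poly_Mapping.single n f0) (Poly_Mapping.single m g1) k = Poly_Mapping.single (n + m) b"
    "rs.bracket (Poly_Mapping.single n f1) (Poly_Mapping.single m g0) k = Poly_Mapping.single (n + m) c"
    "rs.bracket (Poly_Mapping.single n f1) (Poly_Mapping.single m g1) k = Poly_Mapping.single (n + m) e"
    using hom d by metis
  have t: "Poly_Mapping.single n f0 \<in> total algebra" "Poly_Mapping.single n f1 \<in> total algebra"
    "Poly_Mapping.single m g0 \<in> total algebra" "Poly_Mapping.single m g1 \<in> total algebra"
    using d family.comp.in_total family.single_total by blast+
  have "rs.bracket (Poly_Mapping.single n f) (Poly_Mapping.single m g) k = Poly_Mapping.single (n + m) (a + b + (c + e))"
    unfolding d(3,6) single_add using t v
    by (simp add: rs.bracket_add_left rs.bracket_add_right family.sum.total_add)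
  then show ?thesis by simp
qed

end

theorem theorem4p10:
  fixes scale :: "'k::field_char_0 \<Rightarrow> 'a::ab_group_add \<Rightarrow> 'a"
    and P :: "nat \<Rightarrow> bit \<Rightarrow> 'a set"
    and D :: "nat \<Rightarrow> 'a \<Rightarrow> 'a"
    and act :: "nat \<Rightarrow> (nat \<Rightarrow> nat) \<Rightarrow> 'a \<Rightarrow> 'a"
    and circ :: "nat \<Rightarrow> nat \<Rightarrow> nat \<Rightarrow> 'a \<Rightarrow> 'a \<Rightarrow> nat \<Rightarrow> 'a"
    and scaleq :: "'k \<Rightarrow> 'b::ab_group_add \<Rightarrow> 'b"
    and Pq :: "nat \<Rightarrow> nat \<Rightarrow> bit \<Rightarrow> 'b set"
    and Dq :: "nat \<Rightarrow> nat \<Rightarrow> 'b \<Rightarrow> 'b"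
    and actq :: "nat \<Rightarrow> nat \<Rightarrow> (nat \<Rightarrow> nat) \<Rightarrow> 'b \<Rightarrow> 'b"
    and tr :: "nat \<Rightarrow> nat \<Rightarrow> 'b \<Rightarrow> 'b"
    and pr :: "nat \<Rightarrow> nat \<Rightarrow> 'a \<Rightarrow> 'b"
  assumes "pro_conformal_pseudo_operad scale P D act circ scaleq Pq Dq actq tr pr"
  shows "\<exists>br. graded_pro_Lie_conformal_superalgebra
        scale (W_space P act) (\<lambda>n. D (arity n)) br
        scaleq (\<lambda>q. W_space (Pq q) (actq q)) (\<lambda>q n. Dq q (arity n))
        (\<lambda>q n. tr q (arity n)) (\<lambda>q n. pr q (arity n)) \<and>
      (\<forall>n\<ge>-1. \<forall>m\<ge>-1. \<forall>p r. \<forall>f\<in>W_space P act n p. \<forall>g\<in>W_space P act m r. \<forall>k.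
        br (Poly_Mapping.single n f) (Poly_Mapping.single m g) k =
          Poly_Mapping.single (n + m)
            (box P act circ scaleq Dq pr n m f g k -
             scale (koszul_sign p r) (box_subst P act circ scaleq Dq pr m n g f k)))"
proof -
  interpret pro_conformal_pseudo_operad scale P D act circ scaleq Pq Dq actq tr pr
    by (rule assms)
  interpret pseudo_operad_char_0 scale P D act circ scaleq Pq Dq actq tr pr
    by unfold_locales
  have "graded_pro_Lie_conformal_superalgebra scale W (\<lambda>n. D (arity n)) rs.bracket
      scaleq Wq (\<lambda>q n. Dq q (arity n)) (\<lambda>q n. tr q (arity n)) (\<lambda>q n. pr q (arity n))"
  proof (intro graded_pro_Lie_conformal_superalgebra.intro)
    show "pro_Lie_bracket (scale_family scale) algebra algebra_D rs.bracket (scale_family scaleq)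
        algebra_q algebra_Dq (\<lambda>q. Poly_Mapping.mapp (\<lambda>n. tr q (arity n))) algebra_pr"
      by (rule rs.pro_Lie_bracket_bracket) (rule algebra_tr_diff_hom)
  qed (use keys_bracket_single W_limit in auto)
  then show ?thesis using bracket_single by blast
qed

end
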